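(* Let $d\ge2$, let $A,\nu>0$, and for each $1\le j\le d$ let $U_j$ be a compact neighbourhood of the origin in $\mathbb R^{d-1}$. For each $\epsilon>0$, $q\ge\frac{2d}{d-1}$ and $1\le p\le\infty$ with $p'\le\frac{d-1}{d}q$, there exists a constant $C$, depending only on $A$, $\nu$, $\epsilon$, $d$, $p$, $q$ and $U_1,\dots,U_d$, such that the following holds. Let $\Sigma_j:U_j\to\mathbb R^d$ ($1\le j\le d$) be smooth parametrisations of $(d-1)$-dimensional submanifolds of $\mathbb R^d$ satisfying $$\det\bigl(Y_1(x^{(1)}),\dots,Y_d(x^{(d)})\bigr)\ge\nu\quad\text{for all }x^{(1)}\in U_1,\dots,x^{(d)}\in U_d,$$ and $$\|\Sigma_j\|_{C^2(U_j)}\le A\quad\text{for all }1\le j\le d.$$ Then $$\Bigl\|\prod_{j=1}^{d}\mathcal E_jg_j\Bigr\|_{L^{q/d}(B(0,R))}\le CR^{\epsilon}\prod_{j=1}^{d}\|g_j\|_{L^p(U_j)}$$ for all $g_j\in L^p(U_j)$, $1\le j\le d$, and all $R\ge1$.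
   Context: $\mathcal E_j$ is the extension operator associated to $\Sigma_j$: for $g\in L^1(U_j)$ and $\xi\in\mathbb R^d$, $\mathcal E_jg(\xi):=\int_{U_j}g(x)e^{i\xi\cdot\Sigma_j(x)}\,dx$. $Y_j(x):=\bigwedge_{k=1}^{d-1}\frac{\partial}{\partial x_k}\Sigma_j(x)$ is a $(d-1)$-form, viewed by duality as a vector field on $U_j$ with values in $\mathbb R^d$ (i.e. $\langle Y_j(x),v\rangle=\det(\partial_{x_1}\Sigma_j(x),\dots,\partial_{x_{d-1}}\Sigma_j(x),v)$ for $v\in\mathbb R^d$). No curvature condition is imposed. $p'$ is the conjugate exponent of $p$; $B(0,R)$ is the ball of radius $R$ centred at the origin; for $0<r<1$, $\|F\|_{L^r}=(\int|F|^r)^{1/r}$.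
   Formalization: The norm of Σ_j in C²(U_j) is taken as the infimum of the C² norms of extensions to all of R^{d-1}; with the supremum over U_j of derivatives the claim fails for some irregular compact U_j, while for convex or Lipschitz U_j both norms are equivalent. *)

theory Defs
  imports "HOL-Analysis.Analysis" "HOL-Probability.Essential_Supremum"
begin

text \<open>
  The space of parameters is \<open>real ^ 'm\<close> and the ambient space is \<open>real ^ 'm option\<close>, so that
  \<open>d = CARD('m option) = CARD('m) + 1\<close>. The type \<open>'m option\<close> serves as the set of coordinates
  \<open>{1, \<dots>, d}\<close>: the element \<open>Some k\<close> is the \<open>k\<close>-th coordinate for \<open>k \<le> d - 1\<close> and
  \<open>None\<close> is the last one. The determinants below are then the usual ones for every enumeration
  of \<open>'m\<close>, because an enumeration acts simultaneously on rows and columns.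
\<close>

subsection \<open>Smooth maps and the \<open>C\<^sup>2\<close> norm\<close>

definition pderiv_at :: "'m::finite \<Rightarrow> (real ^ 'm \<Rightarrow> 'b::real_normed_vector) \<Rightarrow> real ^ 'm \<Rightarrow> 'b" where
  "pderiv_at k f x = frechet_derivative f (at x) (axis k 1)"

text \<open>\<open>C\<^sup>n\<close> regularity, meant for open \<open>V\<close>.\<close>

fun Ck_on :: "nat \<Rightarrow> (real ^ 'm::finite) set \<Rightarrow> (real ^ 'm \<Rightarrow> 'b::real_normed_vector) \<Rightarrow> bool" where
  "Ck_on 0 V f \<longleftrightarrow> continuous_on V f"
| "Ck_on (Suc n) V f \<longleftrightarrow>
     (\<forall>x\<in>V. f differentiable (at x)) \<and> (\<forall>k. Ck_on n V (pderiv_at k f))"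

definition smooth_map_on ::
    "(real ^ 'm::finite) set \<Rightarrow> (real ^ 'm \<Rightarrow> 'b::real_normed_vector) \<Rightarrow> bool" where
  "smooth_map_on V f \<longleftrightarrow> (\<forall>n. Ck_on n V f)"

text \<open>
  A parametrisation of a submanifold over a compact set \<open>U\<close> is an injective immersion; smoothness
  on \<open>U\<close> means smoothness in an open neighbourhood of \<open>U\<close>. Values outside that neighbourhood are
  irrelevant.
\<close>

definition smooth_parametrisation ::
    "(real ^ 'm::finite) set \<Rightarrow> (real ^ 'm \<Rightarrow> 'b::real_normed_vector) \<Rightarrow> bool" where
  "smooth_parametrisation U f \<longleftrightarrow>
     (\<exists>V. open V \<and> U \<subseteq> V \<and> smooth_map_on V f) \<and>
     inj_on f U \<and> (\<forall>x\<in>U. inj (frechet_derivative f (at x)))"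

definition C2_norm_global :: "(real ^ 'm::finite \<Rightarrow> 'b::real_normed_vector) \<Rightarrow> ennreal" where
  "C2_norm_global F =
     (SUP x. ennreal (norm (F x)))
     + (\<Sum>k\<in>UNIV. SUP x. ennreal (norm (pderiv_at k F x)))
     + (\<Sum>k\<in>UNIV. \<Sum>l\<in>UNIV. SUP x. ennreal (norm (pderiv_at l (pderiv_at k F) x)))"

text \<open>
  The norm of \<open>C\<^sup>2(U)\<close> for a closed set \<open>U\<close> is the quotient norm, that is, the infimum of the
  norms of the \<open>C\<^sup>2\<close> extensions. For convex (or Lipschitz) \<open>U\<close> with nonempty interior it is
  equivalent to the supremum over \<open>U\<close> of the derivatives of order at most two, with constants
  depending on \<open>U\<close> only. For arbitrary compact \<open>U\<close> the latter does not control the oscillation of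
  \<open>f\<close> between nearby points of \<open>U\<close>: on infinitely many small pieces accumulating at a point,
  it allows each of the pieces to be translated independently.
\<close>

definition C2_norm ::
    "(real ^ 'm::finite) set \<Rightarrow> (real ^ 'm \<Rightarrow> 'b::real_normed_vector) \<Rightarrow> ennreal" where
  "C2_norm U f = (INF F \<in> {F. Ck_on 2 UNIV F \<and> (\<forall>x\<in>U. F x = f x)}. C2_norm_global F)"

subsection \<open>The wedge product of the tangent vectors\<close>

definition tangent_frame_with ::
    "(real ^ 'm::finite \<Rightarrow> real ^ 'm option) \<Rightarrow> real ^ 'm \<Rightarrow> real ^ 'm option
      \<Rightarrow> real ^ 'm option ^ 'm option" where
  "tangent_frame_with S x v =
     (\<chi> i c. (case c of Some k \<Rightarrow> pderiv_at k S x | None \<Rightarrow> v) $ i)"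

definition wedge_field ::
    "(real ^ 'm::finite \<Rightarrow> real ^ 'm option) \<Rightarrow> real ^ 'm \<Rightarrow> real ^ 'm option" where
  "wedge_field S x = (\<chi> i. det (tangent_frame_with S x (axis i 1)))"

lemma wedge_field_inner:
  "wedge_field S x \<bullet> v = det (tangent_frame_with S x v)"
proof -
  define c where "c k = (case k of Some k \<Rightarrow> pderiv_at k S x | None \<Rightarrow> 0)" for k
  define L where "L v = det (\<chi> k. if k = None then v else c k)" for v
  have L: "det (tangent_frame_with S x v) = L v" for v
  proof -
    have "tangent_frame_with S x v = transpose (\<chi> k. if k = None then v else c k)"
      by (auto simp: tangent_frame_with_def transpose_def vec_eq_iff c_def split: option.split)
    then show ?thesis by (simp add: L_def)
  qed
  have "linear L"
  proof (rule linearI)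
    show "L (a + b) = L a + L b" for a b
      unfolding L_def using det_row_add[of None "\<lambda>_. a" "\<lambda>_. b" c] by simp
    show "L (r *\<^sub>R a) = r *\<^sub>R L a" for r a
      unfolding L_def using det_row_mul[of None r "\<lambda>_. a" c] by (simp add: scalar_mult_eq_scaleR cong: if_cong)
  qed
  have "v = (\<Sum>i\<in>UNIV. (v $ i) *\<^sub>R axis i 1)"
    using basis_expansion[of v] by (simp add: scalar_mult_eq_scaleR)
  then have "L v = L (\<Sum>i\<in>UNIV. (v $ i) *\<^sub>R axis i 1)"
    by (rule arg_cong)
  also have "\<dots> = (\<Sum>i\<in>UNIV. (v $ i) * L (axis i 1))"
    using \<open>linear L\<close> by (simp add: linear_sum linear_scale)
  finally have "L v = (\<Sum>i\<in>UNIV. (v $ i) * L (axis i 1))" .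
  then show ?thesis
    by (simp add: L wedge_field_def inner_vec_def mult.commute)
qed

definition wedge_det ::
    "('m option \<Rightarrow> real ^ 'm::finite \<Rightarrow> real ^ 'm option) \<Rightarrow> ('m option \<Rightarrow> real ^ 'm) \<Rightarrow> real" where
  "wedge_det S x = det (\<chi> i j. wedge_field (S j) (x j) $ i)"

subsection \<open>Lebesgue spaces and the extension operator\<close>

definition conj_exponent :: "ennreal \<Rightarrow> ennreal" where
  "conj_exponent p = inverse (1 - inverse p)"

lemma conj_exponent_top: "conj_exponent \<infinity> = 1"
  by (simp add: conj_exponent_def)

lemma conj_exponent_1: "conj_exponent 1 = \<infinity>"
  by (simp add: conj_exponent_def)

lemma conj_exponent_eq:
  assumes "1 \<le> p"
  shows "inverse p + inverse (conj_exponent p) = 1"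
proof -
  have "inverse p \<le> 1"
  proof (cases p)
    case (real r)
    then have "1 \<le> r" using assms by (simp flip: ennreal_1)
    then show ?thesis using real
      by (simp add: inverse_ennreal inverse_le_1_iff flip: ennreal_1)
  qed auto
  moreover have "inverse (inverse y) = y" for y :: ennreal
  proof (cases y)
    case (real r)
    then show ?thesis by (cases "r = 0") (auto simp: inverse_ennreal)
  qed auto
  ultimately show ?thesis
    by (simp add: conj_exponent_def add_diff_inverse_ennreal)
qed

text \<open>The (quasi-)norm of \<open>L\<^sup>p\<close> for all \<open>0 < p \<le> \<infinity>\<close>.\<close>

definition Lp_norm :: "'a measure \<Rightarrow> ennreal \<Rightarrow> ('a \<Rightarrow> 'b::real_normed_vector) \<Rightarrow> ennreal" where
  "Lp_norm M p f =
     (if p = \<infinity> then esssup M (\<lambda>x. ennreal (norm (f x)))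
      else let r = enn2real p; I = (\<integral>\<^sup>+ x. ennreal (norm (f x) powr r) \<partial>M)
           in if I = \<infinity> then \<infinity> else ennreal (enn2real I powr (1 / r)))"

definition Lp_space :: "'a measure \<Rightarrow> ennreal \<Rightarrow> ('a \<Rightarrow> 'b::real_normed_vector) set" where
  "Lp_space M p = {f \<in> borel_measurable M. Lp_norm M p f < \<infinity>}"

definition extension_op ::
    "(real ^ 'm::finite) set \<Rightarrow> (real ^ 'm \<Rightarrow> 'b::euclidean_space) \<Rightarrow> (real ^ 'm \<Rightarrow> complex)
      \<Rightarrow> 'b \<Rightarrow> complex" where
  "extension_op U S g \<xi> = (LINT x|lebesgue_on U. g x * exp (\<i> * of_real (\<xi> \<bullet> S x)))"

end

theory Submission
  imports Defs
begin

text \<open>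
  Put \<open>\<theta> = 1 / (d - 1)\<close>. The heart of the matter is the endpoint \<open>p = 2\<close>, \<open>q = 2 d / (d - 1)\<close>, that is, a
  bound for the integral over \<open>B(0, R)\<close> of \<open>\<Prod>\<^sub>j |\<E>\<^sub>j g\<^sub>j|\<close> to the power \<open>2 \<theta>\<close>. It is proved by an
  induction on scales in the spirit of the short arguments of Guth (for the Kakeya analogue) and
  Bejenaru, in a discrete form in which the induction handles only finite sums.

  On a small piece of \<open>U\<^sub>j\<close>, and after linear changes of the variables, the hypersurfaces have the form
  \<open>u + r\<^sub>j(u)\<close> with \<open>u\<^sub>j = 0\<close>, where \<open>r\<^sub>j\<close> has Lipschitz constant at most \<open>1 / K\<close> for a large integer \<open>K\<close>
  that is at our disposal. At scale \<open>K\<^sup>n\<close> one replaces \<open>\<E>\<^sub>j g\<^sub>j\<close> by an exponential sum over the points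
  \<open>u\<close> of the grid of mesh \<open>K\<^sup>-\<^sup>n\<close> and the integral by a sum over integer frequencies in \<open>[0, K\<^sup>n)\<^sup>d\<close>.
  To pass from \<open>n\<close> to \<open>n + 1\<close> write the frequency as \<open>K\<^sup>n \<eta> + \<xi>\<close> and the point as \<open>y + w\<close> with \<open>y\<close> in the
  coarser grid. Because \<open>r\<^sub>j\<close> is so flat, the phase is, up to a bounded error, the phase of \<open>\<xi>\<close> at the
  coarse point \<open>y\<close>, plus a term that depends on \<open>\<eta>\<close> and \<open>y\<close> only, plus the phase of the discrete
  Fourier transform that sends \<open>w\<close> to \<open>\<eta>\<close>; the latter does not see the coordinate \<open>\<eta>\<^sub>j\<close>. For fixed \<open>\<eta>\<close>
  the induction hypothesis bounds the sum over \<open>\<xi>\<close> by a product of functions of \<open>\<eta>\<close>, the \<open>j\<close>-th of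
  which is independent of \<open>\<eta>\<^sub>j\<close>. The inequality of Loomis and Whitney (\<open>loomis_whitney\<close>) bounds the sum
  over \<open>\<eta>\<close>, and Parseval's identity (\<open>parseval_box\<close>) evaluates the factors. Apart from the normalising
  power of \<open>K\<close> a step thus costs a factor \<open>C\<close> that depends on \<open>d\<close> only (\<open>discrete_restriction\<close>). After
  \<open>n\<close> steps the loss is \<open>C\<^sup>n\<close>, which is at most \<open>(K\<^sup>n)\<close> to the power \<open>\<epsilon>\<close> as soon as \<open>K\<close> to the power
  \<open>\<epsilon>\<close> exceeds \<open>C\<close>.

  Bounded errors in the phase are harmless because the Taylor series of the exponential separates
  the frequency from the point: each term only multiplies the coefficients by bounded factors, and
  the terms decay factorially, which makes up for the lack of convexity when \<open>2 \<theta> < 1\<close>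
  (\<open>bounded_phase_perturbation\<close>). The same lemma carries the discrete inequality over to integrals
  (\<open>cell_restriction\<close>, \<open>piece_estimate\<close>); translates of a lattice then cover the ball
  (\<open>local_restriction\<close>) and finitely many pieces cover \<open>U\<^sub>j\<close> (\<open>multilinear_restriction_L2\<close>).

  The remaining exponents follow by interpolation with the trivial bound from \<open>L\<^sup>1\<close> to \<open>L\<^sup>\<infinity>\<close>, carried
  out by hand on the dyadic level sets of \<open>g\<^sub>j\<close>: only \<open>O(log R)\<close> levels matter, and a factor \<open>R\<^sup>\<epsilon>\<close> is
  available to pay for them (\<open>multilinear_restriction_Lp\<close>).
\<close>

section \<open>Discrete boxes\<close>

text \<open>
  The value \<open>0\<close> outside \<open>J\<close> lets the boxes of all coordinate sets share one type: the hyperplane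
  \<open>m j = 0\<close> of the full box is the box of \<open>- {j}\<close>.
\<close>

definition index_box :: "nat \<Rightarrow> 'n set \<Rightarrow> ('n \<Rightarrow> nat) set" where
  "index_box K J = {m. (\<forall>k\<in>J. m k < K) \<and> (\<forall>k. k \<notin> J \<longrightarrow> m k = 0)}"

lemma index_box_empty [simp]: "index_box K {} = {\<lambda>_. 0}"
  by (auto simp: index_box_def)

lemma finite_box:
  assumes "finite J" shows "finite (index_box K J)"
proof -
  have "index_box K J \<subseteq> {f. \<forall>x. (x \<in> J \<longrightarrow> f x \<in> {..<K}) \<and> (x \<notin> J \<longrightarrow> f x = 0)}"
    by (auto simp: index_box_def)
  then show ?thesis
    using finite_set_of_finite_funs[OF assms finite_lessThan[of K], of 0] finite_subset by blast
qed

lemma finite_box_UNIV [simp]: "finite (index_box K (J :: 'n::finite set))"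
  by (simp add: finite_box)

lemma sum_box_insert:
  assumes "k \<notin> J"
  shows "(\<Sum>m\<in>index_box K (insert k J). f m) = (\<Sum>t<K. \<Sum>m\<in>index_box K J. f (m(k := t)))"
  unfolding sum.cartesian_product
  by (rule sum.reindex_bij_witness[where j = "\<lambda>m. (m k, m(k := 0))" and i = "\<lambda>(t, m). m(k := t)"])
     (use assms in \<open>auto simp: index_box_def fun_eq_iff split: if_splits\<close>)

text \<open>Division with remainder in every coordinate splits a fine index into a coarse cell and a position in it.\<close>

lemma sum_box_mult:
  fixes J :: "'b set"
  assumes "L > 0"
  shows "(\<Sum>m\<in>index_box (M * L) J. f m) = (\<Sum>a\<in>index_box M J. \<Sum>b\<in>index_box L J. f (\<lambda>k. a k * L + b k))"
proof -
  have lt: "a * L + b < M * L" if "a < M" "b < L" for a b :: nat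
  proof -
    have "a * L + b < Suc a * L" using that by simp
    also have "\<dots> \<le> M * L" using that by (intro mult_right_mono) auto
    finally show ?thesis .
  qed
  have less: "b x < L" if "\<forall>k\<in>J. b k < L" "\<forall>k. k \<notin> J \<longrightarrow> b k = 0" for b :: "'b \<Rightarrow> nat" and x
    using that assms by (cases "x \<in> J") auto
  show ?thesis
    unfolding sum.cartesian_product
    by (rule sum.reindex_bij_witness[where j = "\<lambda>m. (\<lambda>k. m k div L, \<lambda>k. m k mod L)"
          and i = "\<lambda>(a, b) k. a k * L + b k"])
       (use assms lt less in \<open>auto simp: index_box_def fun_eq_iff less_mult_imp_div_less intro: less\<close>)
qed

section \<open>The inequalities of Hoelder and Loomis-Whitney\<close>

text \<open>
  Hoelder's inequality with equal exponents: normalise all sums to be \<open>1\<close> and apply the inequality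
  of the arithmetic and geometric means for each \<open>t\<close>.
\<close>

lemma sum_prod_powr_le:
  fixes G :: "'j \<Rightarrow> 't \<Rightarrow> real"
  assumes "finite T" "finite J" "J \<noteq> {}" and nonneg: "\<And>j t. j \<in> J \<Longrightarrow> t \<in> T \<Longrightarrow> 0 \<le> G j t"
  shows "(\<Sum>t\<in>T. \<Prod>j\<in>J. G j t powr (1 / card J)) \<le> (\<Prod>j\<in>J. (\<Sum>t\<in>T. G j t) powr (1 / card J))"
proof -
  define n where "n = card J"
  have n: "n > 0" using assms by (auto simp: n_def card_gt_0_iff)
  define s where "s j = (\<Sum>t\<in>T. G j t)" for j
  have s0: "s j \<ge> 0" if "j \<in> J" for j unfolding s_def using nonneg that by (intro sum_nonneg) auto
  show ?thesis
  proof (cases "\<exists>j\<in>J. s j = 0")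
    case True
    then obtain j where j: "j \<in> J" "s j = 0" by blast
    then have "G j t = 0" if "t \<in> T" for t
      using that nonneg assms(1) unfolding s_def by (subst (asm) sum_nonneg_eq_0_iff) auto
    then have "(\<Prod>j\<in>J. G j t powr (1 / card J)) = 0" if "t \<in> T" for t
      using j that assms(2) by (auto simp: prod_zero_iff intro!: bexI[of _ j])
    then have "(\<Sum>t\<in>T. \<Prod>j\<in>J. G j t powr (1 / card J)) = 0" by (simp cong: sum.cong)
    then show ?thesis by (simp add: prod_nonneg)
  next
    case False
    then have spos: "s j > 0" if "j \<in> J" for j using s0 that by force
    have amgm: "(\<Prod>j\<in>J. G j t powr (1 / n)) \<le> (\<Prod>j\<in>J. s j powr (1 / n)) * (\<Sum>j\<in>J. G j t / s j) / n"
      if t: "t \<in> T" for t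
    proof -
      have "(\<Prod>j\<in>J. G j t powr (1 / n)) = (\<Prod>j\<in>J. s j powr (1 / n)) * (\<Prod>j\<in>J. (G j t / s j) powr (1 / n))"
        unfolding prod.distrib[symmetric]
      proof (intro prod.cong refl)
        fix j assume "j \<in> J"
        with spos[OF this] nonneg[OF this t]
        show "G j t powr (1 / n) = s j powr (1 / n) * (G j t / s j) powr (1 / n)"
          by (simp add: powr_mult[symmetric])
      qed
      also have "(\<Prod>j\<in>J. (G j t / s j) powr (1 / n)) = (\<Prod>j\<in>J. G j t / s j) powr (1 / n)"
        by (rule prod_powr_distrib[symmetric])
      also have "\<dots> \<le> (\<Sum>j\<in>J. G j t / s j) / n"
        using arith_geom_mean[of J "\<lambda>j. G j t / s j"] assms(2,3) spos nonneg t
        by (simp add: n_def less_imp_le sum_divide_distrib)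
      finally show ?thesis by (simp add: mult_left_mono prod_nonneg)
    qed
    have "(\<Sum>t\<in>T. \<Prod>j\<in>J. G j t powr (1 / n))
        \<le> (\<Sum>t\<in>T. (\<Prod>j\<in>J. s j powr (1 / n)) * (\<Sum>j\<in>J. G j t / s j) / n)"
      by (intro sum_mono amgm)
    also have "\<dots> = (\<Prod>j\<in>J. s j powr (1 / n)) / n * (\<Sum>j\<in>J. \<Sum>t\<in>T. G j t / s j)"
      by (subst sum.swap) (simp add: sum_distrib_left sum_divide_distrib mult_ac)
    also have "(\<Sum>j\<in>J. \<Sum>t\<in>T. G j t / s j) = n"
    proof -
      have "(\<Sum>t\<in>T. G j t / s j) = 1" if "j \<in> J" for j
        using spos[OF that] by (simp add: sum_divide_distrib[symmetric] s_def[symmetric])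
      then show ?thesis by (simp add: n_def)
    qed
    finally show ?thesis using n by (simp add: n_def s_def)
  qed
qed

text \<open>
  The coordinates are summed one after the other. When the coordinate \<open>k\<close> is summed, the factor
  \<open>j = k\<close> is constant and the other \<open>d - 1\<close> factors, each to the power \<open>1 / (d - 1)\<close>, are just what
  Hoelder's inequality handles. The set \<open>J\<close> in the induction collects the coordinates already summed.
\<close>

lemma loomis_whitney:
  fixes B :: "'n::finite \<Rightarrow> ('n \<Rightarrow> nat) \<Rightarrow> real"
  assumes card: "CARD('n) \<ge> 2" and nonneg: "\<And>j z. 0 \<le> B j z"
  defines "\<theta> \<equiv> 1 / (real CARD('n) - 1)"
  shows "(\<Sum>\<eta>\<in>index_box K UNIV. \<Prod>j\<in>UNIV. B j (\<eta>(j := 0)) powr \<theta>)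
     \<le> (\<Prod>j\<in>UNIV. (\<Sum>z\<in>index_box K (- {j}). B j z) powr \<theta>)"
proof -
  define b where "b J j \<eta> = (\<Sum>z\<in>index_box K (J - {j}). B j ((\<lambda>k. \<eta> k + z k)(j := 0)))" for J j and \<eta> :: "'n \<Rightarrow> nat"
  have b_nonneg: "0 \<le> b J j \<eta>" for J j \<eta> unfolding b_def by (intro sum_nonneg nonneg)
  have "(\<Sum>\<eta>\<in>index_box K UNIV. \<Prod>j\<in>UNIV. B j (\<eta>(j := 0)) powr \<theta>)
     \<le> (\<Sum>\<eta>\<in>index_box K (- J). \<Prod>j\<in>UNIV. b J j \<eta> powr \<theta>)" for J
  proof (induction J rule: infinite_finite_induct)
    case empty
    then show ?case by (simp add: b_def)
  next
    case (insert k J)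
    have eq: "- J = insert k (- insert k J)" using insert by auto
    have "(\<Sum>\<eta>\<in>index_box K (- J). \<Prod>j\<in>UNIV. b J j \<eta> powr \<theta>)
       = (\<Sum>\<eta>\<in>index_box K (- insert k J). \<Sum>t<K. \<Prod>j\<in>UNIV. b J j (\<eta>(k := t)) powr \<theta>)"
      by (subst eq, subst sum_box_insert) (auto intro: sum.swap)
    also have "\<dots> \<le> (\<Sum>\<eta>\<in>index_box K (- insert k J). \<Prod>j\<in>UNIV. b (insert k J) j \<eta> powr \<theta>)"
    proof (rule sum_mono)
      fix \<eta> assume \<eta>: "\<eta> \<in> index_box K (- insert k J)"
      have U: "UNIV = insert k (- {k})" by auto
      have ck: "card (- {k}) = CARD('n) - 1" by (simp add: card_Diff_singleton Compl_eq_Diff_UNIV)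
      have th: "\<theta> = 1 / card (- {k})" using card by (simp add: ck \<theta>_def of_nat_diff)
      have "- {k} \<noteq> {}" using card ck by (intro notI) simp
      have bk: "b J k (\<eta>(k := t)) = b (insert k J) k \<eta>" for t
        unfolding b_def using insert by (intro sum.cong) (auto intro!: arg_cong[where f = "B k"])
      have bj: "(\<Sum>t<K. b J j (\<eta>(k := t))) = b (insert k J) j \<eta>" if "j \<noteq> k" for j
      proof -
        have *: "insert k J - {j} = insert k (J - {j})" using that by auto
        have nk: "k \<notin> J - {j}" using insert by auto
        show ?thesis
          unfolding b_def * sum_box_insert[OF nk]
        proof (intro sum.cong refl arg_cong[where f = "B j"])
          fix t z assume "z \<in> index_box K (J - {j})"
          then have "z k = 0" using nk by (auto simp: index_box_def)
          moreover have "\<eta> k = 0" using \<eta> by (auto simp: index_box_def)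
          ultimately show "(\<lambda>a. (\<eta>(k := t)) a + z a)(j := 0) = (\<lambda>a. \<eta> a + (z(k := t)) a)(j := 0)"
            by (auto simp: fun_eq_iff)
        qed
      qed
      have "(\<Sum>t<K. \<Prod>j\<in>UNIV. b J j (\<eta>(k := t)) powr \<theta>)
         = (\<Sum>t<K. b (insert k J) k \<eta> powr \<theta> * (\<Prod>j\<in>-{k}. b J j (\<eta>(k := t)) powr \<theta>))"
        by (subst U, subst prod.insert) (auto simp: bk)
      also have "\<dots> = b (insert k J) k \<eta> powr \<theta> * (\<Sum>t<K. \<Prod>j\<in>-{k}. b J j (\<eta>(k := t)) powr \<theta>)"
        by (simp add: sum_distrib_left)
      also have "\<dots> \<le> b (insert k J) k \<eta> powr \<theta> * (\<Prod>j\<in>-{k}. (\<Sum>t<K. b J j (\<eta>(k := t))) powr \<theta>)"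
        unfolding th using \<open>- {k} \<noteq> {}\<close> by (intro mult_left_mono sum_prod_powr_le) (auto simp: b_nonneg)
      also have "(\<Prod>j\<in>-{k}. (\<Sum>t<K. b J j (\<eta>(k := t))) powr \<theta>) = (\<Prod>j\<in>-{k}. b (insert k J) j \<eta> powr \<theta>)"
        by (intro prod.cong) (auto simp: bj)
      also have "b (insert k J) k \<eta> powr \<theta> * \<dots> = (\<Prod>j\<in>UNIV. b (insert k J) j \<eta> powr \<theta>)"
        by (subst U, subst prod.insert) auto
      finally show "(\<Sum>t<K. \<Prod>j\<in>UNIV. b J j (\<eta>(k := t)) powr \<theta>)
          \<le> (\<Prod>j\<in>UNIV. b (insert k J) j \<eta> powr \<theta>)" .
    qed
    finally show ?case using insert.IH by linarith
  qed auto
  from this[of UNIV] have "(\<Sum>\<eta>\<in>index_box K UNIV. \<Prod>j\<in>UNIV. B j (\<eta>(j := 0)) powr \<theta>)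
     \<le> (\<Prod>j\<in>UNIV. b UNIV j (\<lambda>_. 0) powr \<theta>)" by simp
  moreover have "b UNIV j (\<lambda>_. 0) = (\<Sum>z\<in>index_box K (- {j}). B j z)" for j
    unfolding b_def Compl_eq_Diff_UNIV
    by (intro sum.cong arg_cong[where f = "B j"]) (auto simp: index_box_def fun_eq_iff)
  ultimately show ?thesis by simp
qed

section \<open>Parseval's identity for finite cyclic groups\<close>

lemma sum_cis_orthogonal:
  assumes K: "K > 0" and "u < K" "v < K"
  shows "(\<Sum>t<K. cis (2 * pi * real t * (real u - real v) / real K)) = (if u = v then of_nat K else 0)"
proof (cases "u = v")
  case False
  define z where "z = cis (2 * pi * (real u - real v) / real K)"
  have zt: "cis (2 * pi * real t * (real u - real v) / real K) = z ^ t" for t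
    unfolding z_def Complex.DeMoivre by (rule arg_cong[where f = cis]) simp
  have "z ^ K = cis (2 * pi * of_int (int u - int v))"
    unfolding z_def Complex.DeMoivre by (rule arg_cong[where f = cis]) (use K in \<open>simp add: field_simps\<close>)
  then have zK: "z ^ K = 1" using cis_multiple_2pi[of "of_int (int u - int v)"] by simp
  have "z \<noteq> 1"
  proof
    assume "z = 1"
    then have "cos (2 * pi * (real u - real v) / real K) = 1"
      by (metis z_def cis.sel(1) one_complex.sel(1))
    then obtain n :: int where "2 * pi * (real u - real v) / real K = real_of_int n * 2 * pi"
      using cos_one_2pi_int by blast
    then have "(2 * pi) * (real u - real v - real_of_int n * real K) = 0"
      using K by (simp add: field_simps)
    then have "real u - real v = real_of_int n * real K" by simp
    then have n: "int u - int v = n * int K"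
      by (metis of_int_diff of_int_eq_iff of_int_mult of_int_of_nat_eq)
    have "int K dvd int u - int v" by (simp add: n)
    then have "int u mod int K = int v mod int K" by (simp add: mod_eq_dvd_iff)
    then show False using assms False by simp
  qed
  then show ?thesis using False zK by (simp add: zt geometric_sum)
qed simp

lemma parseval_1d:
  fixes b :: "nat \<Rightarrow> complex"
  assumes K: "K > 0"
  shows "(\<Sum>t<K. (norm (\<Sum>u<K. b u * cis (2 * pi * real t * real u / real K)))\<^sup>2) = K * (\<Sum>u<K. (norm (b u))\<^sup>2)"
proof -
  have 1: "complex_of_real ((norm (\<Sum>u<K. b u * cis (2 * pi * real t * real u / real K)))\<^sup>2)
     = (\<Sum>u<K. \<Sum>v<K. b u * cnj (b v) * cis (2 * pi * real t * (real u - real v) / real K))" for t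
  proof -
    have "cis (2 * pi * real t * (real u - real v) / real K)
       = cis (2 * pi * real t * real u / real K) * cnj (cis (2 * pi * real t * real v / real K))" for u v
      by (simp add: cis_cnj cis_mult diff_divide_distrib right_diff_distrib)
    then show ?thesis
      unfolding complex_norm_square cnj_sum sum_product by (simp add: mult_ac)
  qed
  have "complex_of_real (\<Sum>t<K. (norm (\<Sum>u<K. b u * cis (2 * pi * real t * real u / real K)))\<^sup>2)
     = (\<Sum>t<K. \<Sum>u<K. \<Sum>v<K. b u * cnj (b v) * cis (2 * pi * real t * (real u - real v) / real K))"
    by (simp add: 1 del: of_real_power)
  also have "\<dots> = (\<Sum>u<K. \<Sum>t<K. \<Sum>v<K. b u * cnj (b v) * cis (2 * pi * real t * (real u - real v) / real K))"
    by (rule sum.swap)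
  also have "\<dots> = (\<Sum>u<K. \<Sum>v<K. \<Sum>t<K. b u * cnj (b v) * cis (2 * pi * real t * (real u - real v) / real K))"
    by (intro sum.cong refl sum.swap)
  also have "\<dots> = (\<Sum>u<K. \<Sum>v<K. b u * cnj (b v) * (if u = v then of_nat K else 0))"
    unfolding sum_distrib_left[symmetric] using sum_cis_orthogonal[OF K] by (intro sum.cong refl) auto
  also have "\<dots> = (\<Sum>u<K. b u * cnj (b u) * of_nat K)"
    by (intro sum.cong refl) (simp add: if_distrib[of "\<lambda>x. _ * x"] cong: if_cong)
  also have "\<dots> = complex_of_real (K * (\<Sum>u<K. (norm (b u))\<^sup>2))"
    by (simp add: complex_norm_square sum_distrib_left mult_ac del: of_real_power)
  finally show ?thesis using of_real_eq_iff by blast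
qed

text \<open>The transform on a box is the tensor power of the one on \<open>{..<K}\<close>, so one coordinate is added at a time.\<close>

lemma parseval_box:
  fixes b :: "('n \<Rightarrow> nat) \<Rightarrow> complex"
  assumes K: "K > 0" and "finite J"
  shows "(\<Sum>\<eta>\<in>index_box K J. (norm (\<Sum>m\<in>index_box K J. b m * cis (2 * pi * (\<Sum>k\<in>J. real (\<eta> k) * real (m k)) / real K)))\<^sup>2)
    = real K ^ card J * (\<Sum>m\<in>index_box K J. (norm (b m))\<^sup>2)"
  using assms(2)
proof (induction J arbitrary: b)
  case (insert k J)
  define E where "E \<eta> m = cis (2 * pi * (\<Sum>k\<in>J. real (\<eta> k) * real (m k)) / real K)" for \<eta> m :: "'n \<Rightarrow> nat"
  have E: "cis (2 * pi * (\<Sum>l\<in>insert k J. real ((\<eta>(k := t)) l) * real ((m(k := u)) l)) / real K)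
     = cis (2 * pi * real t * real u / real K) * E \<eta> m" for \<eta> m t u
  proof -
    have "(\<Sum>l\<in>J. real ((\<eta>(k := t)) l) * real ((m(k := u)) l)) = (\<Sum>l\<in>J. real (\<eta> l) * real (m l))"
      by (intro sum.cong refl) (use insert.hyps in auto)
    then have S: "(\<Sum>l\<in>insert k J. real ((\<eta>(k := t)) l) * real ((m(k := u)) l))
       = real t * real u + (\<Sum>l\<in>J. real (\<eta> l) * real (m l))"
      unfolding sum.insert[OF insert.hyps] by (simp only: fun_upd_same)
    show ?thesis unfolding E_def cis_mult S
      by (simp add: add_divide_distrib distrib_left mult.assoc)
  qed
  have "(\<Sum>\<eta>\<in>index_box K (insert k J). (norm (\<Sum>m\<in>index_box K (insert k J). b m *
          cis (2 * pi * (\<Sum>k\<in>insert k J. real (\<eta> k) * real (m k)) / real K)))\<^sup>2)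
     = (\<Sum>t<K. \<Sum>\<eta>\<in>index_box K J. (norm (\<Sum>u<K. \<Sum>m\<in>index_box K J. b (m(k := u)) *
          (cis (2 * pi * real t * real u / real K) * E \<eta> m)))\<^sup>2)"
    unfolding sum_box_insert[OF insert.hyps(2)] E by simp
  also have "\<dots> = (\<Sum>t<K. \<Sum>\<eta>\<in>index_box K J. (norm (\<Sum>m\<in>index_box K J. (\<Sum>u<K. b (m(k := u)) *
          cis (2 * pi * real t * real u / real K)) * E \<eta> m))\<^sup>2)"
    by (subst sum.swap) (simp add: sum_distrib_right mult.assoc)
  also have "\<dots> = (\<Sum>t<K. real K ^ card J * (\<Sum>m\<in>index_box K J. (norm (\<Sum>u<K. b (m(k := u)) *
          cis (2 * pi * real t * real u / real K)))\<^sup>2))"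
    unfolding E_def by (simp only: insert.IH)
  also have "\<dots> = real K ^ card J * (\<Sum>m\<in>index_box K J. \<Sum>t<K. (norm (\<Sum>u<K. b (m(k := u)) *
          cis (2 * pi * real t * real u / real K)))\<^sup>2)"
    unfolding sum_distrib_left[symmetric] by (subst sum.swap) simp
  also have "\<dots> = real K ^ card J * (\<Sum>m\<in>index_box K J. K * (\<Sum>u<K. (norm (b (m(k := u))))\<^sup>2))"
    by (simp only: parseval_1d[OF K])
  also have "\<dots> = real K ^ card (insert k J) * (\<Sum>m\<in>index_box K (insert k J). (norm (b m))\<^sup>2)"
    unfolding sum_box_insert[OF insert.hyps(2)] sum_distrib_left[symmetric] card_insert_disjoint[OF insert.hyps]
      sum.swap[of _ "{..<K}"] by (simp add: mult_ac)
  finally show ?case .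
qed simp

section \<open>Bounded perturbations of the phase\<close>

text \<open>
  Bound for \<open>\<Sum>\<^sub>m k\<^sup>m (M\<^sup>m / m!)\<^sup>\<theta>\<close>, the sum over all words in \<open>k\<close> letters of the \<open>\<theta>\<close>-th powers of the
  Taylor coefficients.
\<close>

definition exp_const :: "nat \<Rightarrow> real \<Rightarrow> real \<Rightarrow> real" where
  "exp_const k M \<theta> = 2 * exp (\<theta> * (M * (2 * real k) powr (1 / \<theta>)))"

text \<open>
  The loss caused by a bounded phase in each of \<open>n\<close> factors. What matters below is that it depends
  neither on the scale nor on the functions involved.
\<close>

definition phase_const :: "nat \<Rightarrow> nat \<Rightarrow> real \<Rightarrow> real \<Rightarrow> real" where
  "phase_const n k M s = (exp_const k M (1 / 2) powr s * exp_const k M (s / 2)) ^ n"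

lemma phase_const_pos: "phase_const n k M s > 0"
  by (simp add: phase_const_def exp_const_def)

lemma power_over_fact_le_exp:
  fixes x :: real
  assumes "x \<ge> 0"
  shows "x ^ m / fact m \<le> exp x"
proof -
  have "(\<Sum>n\<in>{m}. inverse (fact n) * x ^ n) \<le> (\<Sum>n. inverse (fact n) * x ^ n)"
    using assms by (intro sum_le_suminf summable_exp) auto
  then show ?thesis by (simp add: exp_def divide_inverse mult.commute)
qed

text \<open>Writing the term as \<open>(E\<^sup>m / m!)\<^sup>\<theta> 2\<^sup>-\<^sup>m\<close> with \<open>E = M (2 k)\<^sup>1\<^sup>/\<^sup>\<theta>\<close> leaves a geometric series.\<close>

lemma sum_exp_const:
  assumes "M > 0" "\<theta> > 0" "k > 0"
  shows "(\<Sum>m<N. real k ^ m * (M ^ m / fact m) powr \<theta>) \<le> exp_const k M \<theta>"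
proof -
  define E where "E = M * (2 * real k) powr (1 / \<theta>)"
  have E: "E > 0" using assms by (simp add: E_def)
  have "real k ^ m * (M ^ m / fact m) powr \<theta> \<le> exp (\<theta> * E) * (1 / 2) ^ m" for m
  proof -
    have "(E ^ m / fact m) powr \<theta> = (M ^ m / fact m * ((2 * real k) powr (1 / \<theta>)) ^ m) powr \<theta>"
      by (simp add: E_def power_mult_distrib)
    also have "\<dots> = (M ^ m / fact m) powr \<theta> * (((2 * real k) powr (1 / \<theta>)) ^ m) powr \<theta>"
      using assms by (subst powr_mult) auto
    also have "(((2 * real k) powr (1 / \<theta>)) ^ m) powr \<theta> = (2 * real k) ^ m"
      using assms by (simp add: powr_power powr_powr powr_realpow)
    finally have "real k ^ m * (M ^ m / fact m) powr \<theta> = (E ^ m / fact m) powr \<theta> * (1 / 2) ^ m"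
      by (simp add: power_mult_distrib field_simps)
    also have "\<dots> \<le> exp E powr \<theta> * (1 / 2) ^ m"
      using E assms power_over_fact_le_exp[of E m] by (intro mult_right_mono powr_mono2) auto
    finally show ?thesis by (simp add: exp_powr_real mult.commute)
  qed
  then have "(\<Sum>m<N. real k ^ m * (M ^ m / fact m) powr \<theta>) \<le> (\<Sum>m<N. exp (\<theta> * E) * (1 / 2) ^ m)"
    by (intro sum_mono)
  also have "\<dots> = exp (\<theta> * E) * (\<Sum>m<N. (1 / 2) ^ m)" by (simp add: sum_distrib_left)
  also have "(\<Sum>m<N. (1 / 2) ^ m) \<le> (2::real)" by (simp add: sum_gp_strict)
  finally show ?thesis by (simp add: exp_const_def E_def mult_ac)
qed

text \<open>
  A substitute for convexity that is valid for all \<open>s > 0\<close>: half of each coefficient is spent on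
  replacing the sum by its largest term, and the \<open>s\<close>-th power of the largest term is at most the sum
  of the \<open>s\<close>-th powers.
\<close>

lemma sum_powr_le_sum_powr:
  fixes c u :: "'l \<Rightarrow> real"
  assumes "finite I" "s > 0" and c: "\<And>l. l \<in> I \<Longrightarrow> 0 \<le> c l" and u: "\<And>l. l \<in> I \<Longrightarrow> 0 \<le> u l"
  shows "(\<Sum>l\<in>I. c l * u l) powr s \<le> (\<Sum>l\<in>I. sqrt (c l)) powr s * (\<Sum>l\<in>I. c l powr (s / 2) * u l powr s)"
proof (cases "I = {}")
  case False
  define w where "w l = sqrt (c l) * u l" for l
  have w0: "w l \<ge> 0" if "l \<in> I" for l using c u that by (simp add: w_def)
  obtain l where l: "l \<in> I" "\<And>l'. l' \<in> I \<Longrightarrow> w l' \<le> w l"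
  proof -
    have "Max (w ` I) \<in> w ` I" using assms(1) False by simp
    then obtain l where "l \<in> I" "w l = Max (w ` I)" by (metis imageE)
    then show ?thesis using that assms(1) by (metis Max_ge finite_imageI imageI)
  qed
  have "(\<Sum>l\<in>I. c l * u l) = (\<Sum>l\<in>I. sqrt (c l) * w l)"
    by (intro sum.cong refl) (use c in \<open>auto simp: w_def mult.assoc[symmetric]\<close>)
  also have "\<dots> \<le> (\<Sum>l'\<in>I. sqrt (c l') * w l)" using l c by (intro sum_mono mult_left_mono) auto
  also have "\<dots> = (\<Sum>l\<in>I. sqrt (c l)) * w l" by (simp add: sum_distrib_right)
  finally have "(\<Sum>l\<in>I. c l * u l) powr s \<le> ((\<Sum>l\<in>I. sqrt (c l)) * w l) powr s"
    using assms by (intro powr_mono2) (auto intro!: sum_nonneg)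
  also have "\<dots> = (\<Sum>l\<in>I. sqrt (c l)) powr s * w l powr s"
    using w0 l c by (subst powr_mult) (auto intro!: sum_nonneg)
  also have "w l powr s \<le> (\<Sum>l\<in>I. w l powr s)" using l assms(1) by (intro member_le_sum) auto
  also have "(\<Sum>l\<in>I. w l powr s) = (\<Sum>l\<in>I. c l powr (s / 2) * u l powr s)"
    by (intro sum.cong refl) (use c u in \<open>auto simp: w_def powr_mult powr_half_sqrt[symmetric] powr_powr\<close>)
  finally show ?thesis by (simp add: mult_left_mono)
qed simp

lemma prod_sum_eq_sum_prod_choice:
  fixes f :: "'n::finite \<Rightarrow> 'l \<Rightarrow> 'a::comm_semiring_1"
  assumes "finite I"
  shows "(\<Prod>j\<in>UNIV. \<Sum>l\<in>I. f j l) = (\<Sum>\<sigma>\<in>UNIV \<rightarrow> I. \<Prod>j\<in>UNIV. f j (\<sigma> j))"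
  using prod_sum_PiE[of "UNIV :: 'n set" "\<lambda>_. I" f] assms by (simp add: PiE_UNIV_domain)

text \<open>
  If every factor is dominated by a series and every choice of one term in each factor obeys the bound
  \<open>B\<close>, then so do the factors themselves, up to a constant determined by the coefficients.
\<close>

lemma sum_prod_powr_expansion:
  fixes F :: "'n::finite \<Rightarrow> 'x \<Rightarrow> complex" and t :: "'n \<Rightarrow> 'x \<Rightarrow> 'l \<Rightarrow> real"
  assumes fin: "finite \<Xi>" "finite I" and s: "s > 0" and c: "\<And>l. l \<in> I \<Longrightarrow> 0 \<le> c l"
    and t: "\<And>j \<xi> l. \<xi> \<in> \<Xi> \<Longrightarrow> 0 \<le> t j \<xi> l"
    and F: "\<And>j \<xi>. \<xi> \<in> \<Xi> \<Longrightarrow> norm (F j \<xi>) \<le> (\<Sum>l\<in>I. c l * t j \<xi> l)"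
    and B: "\<And>\<sigma>. (\<Sum>\<xi>\<in>\<Xi>. \<Prod>j\<in>UNIV. t j \<xi> (\<sigma> j) powr s) \<le> B"
  shows "(\<Sum>\<xi>\<in>\<Xi>. \<Prod>j\<in>UNIV. norm (F j \<xi>) powr s)
    \<le> ((\<Sum>l\<in>I. sqrt (c l)) powr s * (\<Sum>l\<in>I. c l powr (s / 2))) ^ CARD('n) * B"
proof -
  define C where "C = (\<Sum>l\<in>I. sqrt (c l)) powr s"
  have "(\<Sum>\<xi>\<in>\<Xi>. \<Prod>j\<in>UNIV. norm (F j \<xi>) powr s)
     \<le> (\<Sum>\<xi>\<in>\<Xi>. \<Prod>j\<in>(UNIV::'n set). C * (\<Sum>l\<in>I. c l powr (s / 2) * t j \<xi> l powr s))"
  proof (intro sum_mono prod_mono conjI)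
    fix \<xi> j assume \<xi>: "\<xi> \<in> \<Xi>"
    have "norm (F j \<xi>) powr s \<le> (\<Sum>l\<in>I. c l * t j \<xi> l) powr s"
      using F[OF \<xi>] s by (intro powr_mono2) auto
    also have "\<dots> \<le> C * (\<Sum>l\<in>I. c l powr (s / 2) * t j \<xi> l powr s)"
      unfolding C_def using c t \<xi> s fin by (intro sum_powr_le_sum_powr) auto
    finally show "norm (F j \<xi>) powr s \<le> C * (\<Sum>l\<in>I. c l powr (s / 2) * t j \<xi> l powr s)" .
  qed simp
  also have "\<dots> = C ^ CARD('n) * (\<Sum>\<xi>\<in>\<Xi>. \<Sum>\<sigma>\<in>UNIV \<rightarrow> I. (\<Prod>j\<in>UNIV. c (\<sigma> j) powr (s / 2)) * (\<Prod>j\<in>UNIV. t j \<xi> (\<sigma> j) powr s))"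
    by (simp add: prod.distrib prod_sum_eq_sum_prod_choice[OF fin(2)] sum_distrib_left)
  also have "\<dots> = C ^ CARD('n) * (\<Sum>\<sigma>\<in>UNIV \<rightarrow> I. (\<Prod>j\<in>UNIV. c (\<sigma> j) powr (s / 2)) * (\<Sum>\<xi>\<in>\<Xi>. \<Prod>j\<in>(UNIV::'n set). t j \<xi> (\<sigma> j) powr s))"
    by (subst sum.swap) (simp add: sum_distrib_left)
  also have "\<dots> \<le> C ^ CARD('n) * (\<Sum>\<sigma>\<in>UNIV \<rightarrow> I. (\<Prod>j\<in>(UNIV::'n set). c (\<sigma> j) powr (s / 2)) * B)"
    by (intro mult_left_mono sum_mono B) (auto intro!: prod_nonneg simp: C_def)
  also have "\<dots> = C ^ CARD('n) * (\<Prod>j\<in>(UNIV::'n set). \<Sum>l\<in>I. c l powr (s / 2)) * B"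
    by (simp add: sum_distrib_right[symmetric] prod_sum_eq_sum_prod_choice[OF fin(2)] del: prod_constant)
  finally show ?thesis by (simp add: C_def power_mult_distrib)
qed

abbreviation lists_of_length :: "nat \<Rightarrow> 'k list set" where
  "lists_of_length m \<equiv> {l. length l = m}"

lemma finite_lists_of_length: "finite (lists_of_length m :: 'k::finite list set)"
  using finite_lists_length_eq[of "UNIV :: 'k set" m] by simp

lemma card_lists_of_length: "card (lists_of_length m :: 'k::finite list set) = CARD('k) ^ m"
  using card_lists_length_eq[of "UNIV :: 'k set" m] by simp

text \<open>Words avoid multinomial coefficients in the expansion of a power of a sum.\<close>

lemma power_sum_eq_sum_lists:
  fixes f :: "'k::finite \<Rightarrow> 'a::comm_semiring_1"
  shows "(\<Sum>k\<in>UNIV. f k) ^ m = (\<Sum>l\<in>lists_of_length m. prod_list (map f l))"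
proof (induction m)
  case (Suc m)
  have "(\<Sum>l\<in>lists_of_length (Suc m). prod_list (map f l))
      = (\<Sum>(k, l)\<in>UNIV \<times> lists_of_length m. f k * prod_list (map f l))"
    by (rule sum.reindex_bij_witness[where j = "\<lambda>l. (hd l, tl l)" and i = "\<lambda>(k, l). k # l"])
       (auto simp: length_Suc_conv)
  also have "\<dots> = (\<Sum>k\<in>UNIV. f k) * (\<Sum>l\<in>lists_of_length m. prod_list (map f l))"
    by (simp add: sum.cartesian_product[symmetric] sum_product)
  finally show ?case using Suc by simp
qed simp

lemma sum_lists_up_to:
  "(\<Sum>l\<in>{l::'k::finite list. length l < N}. f l) = (\<Sum>m<N. \<Sum>l\<in>lists_of_length m. f l)"
proof -
  have "{l::'k list. length l < N} = (\<Union>m<N. lists_of_length m)" by auto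
  then show ?thesis
    by (simp only:) (rule sum.UNION_disjoint, auto simp: finite_lists_of_length)
qed

lemma finite_lists_up_to: "finite {l::'k::finite list. length l < N}"
proof -
  have "{l::'k list. length l < N} = (\<Union>m<N. lists_of_length m)" by auto
  then show ?thesis by (simp add: finite_lists_of_length)
qed

text \<open>
  The phase \<open>\<Sum>\<^sub>k u\<^sub>k(\<xi>) v\<^sub>k(x)\<close> is bounded, so its exponential is the sum of the series with terms
  \<open>(\<i>\<^sup>m / m!) \<Prod>\<^sub>i u\<^bsub>k(i)\<^esub>(\<xi>) \<Prod>\<^sub>i v\<^bsub>k(i)\<^esub>(x)\<close> over the words \<open>k\<close> of length \<open>m\<close>. In each term the first product
  is at most \<open>1\<close>, and the second one is a multiplier \<open>\<psi>\<close> of the coefficient \<open>a\<close>, up to the constant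
  \<open>M0\<^sup>m\<close>. Hence a bound that is insensitive to multipliers is insensitive to the phase.
\<close>

lemma bounded_phase_perturbation:
  fixes M :: "'n::finite \<Rightarrow> 'a measure" and a :: "'n \<Rightarrow> 'a \<Rightarrow> complex"
    and e :: "'n \<Rightarrow> 'x \<Rightarrow> 'a \<Rightarrow> complex" and u :: "'n \<Rightarrow> 'x \<Rightarrow> 'k::finite \<Rightarrow> real"
    and v :: "'n \<Rightarrow> 'k \<Rightarrow> 'a \<Rightarrow> real"
  assumes fin: "finite \<Xi>" and s: "s > 0" and M0: "M0 > 0"
    and a: "\<And>j. integrable (M j) (a j)"
    and e [measurable]: "\<And>j \<xi>. e j \<xi> \<in> borel_measurable (M j)" and e1: "\<And>j \<xi> x. norm (e j \<xi> x) \<le> 1"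
    and u: "\<And>j \<xi> k. \<xi> \<in> \<Xi> \<Longrightarrow> \<bar>u j \<xi> k\<bar> \<le> 1"
    and v [measurable]: "\<And>j k. v j k \<in> borel_measurable (M j)"
    and v1: "\<And>j k x. x \<in> space (M j) \<Longrightarrow> \<bar>v j k x\<bar> \<le> M0"
    and hyp: "\<And>\<psi>. (\<And>j. \<psi> j \<in> borel_measurable (M j)) \<Longrightarrow> (\<And>j x. x \<in> space (M j) \<Longrightarrow> \<bar>\<psi> j x\<bar> \<le> 1) \<Longrightarrow>
      (\<Sum>\<xi>\<in>\<Xi>. \<Prod>j\<in>UNIV. norm (LINT x|M j. a j x * of_real (\<psi> j x) * e j \<xi> x) powr s) \<le> B"
  shows "(\<Sum>\<xi>\<in>\<Xi>. \<Prod>j\<in>UNIV. norm (LINT x|M j. a j x * e j \<xi> x * cis (\<Sum>k\<in>UNIV. u j \<xi> k * v j k x)) powr s)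
     \<le> phase_const CARD('n) CARD('k) M0 s * B"
proof -
  note am [measurable] = borel_measurable_integrable[OF a]
  define \<psi> where "\<psi> j l x = prod_list (map (\<lambda>k. v j k x / M0) l)" for j l x
  have \<psi>m [measurable]: "\<psi> j l \<in> borel_measurable (M j)" for j l
    unfolding \<psi>_def by (induction l) auto
  have \<psi>1: "\<bar>\<psi> j l x\<bar> \<le> 1" if "x \<in> space (M j)" for j l x
  proof (induction l)
    case (Cons k l)
    have "\<bar>v j k x / M0\<bar> \<le> 1" using v1[OF that, of k] M0 by simp
    then have "\<bar>v j k x / M0\<bar> * \<bar>\<psi> j l x\<bar> \<le> 1 * 1" using Cons by (intro mult_mono) auto
    then show ?case by (simp add: \<psi>_def abs_mult)
  qed (simp add: \<psi>_def)
  define T where "T j \<xi> l = (LINT x|M j. a j x * of_real (\<psi> j l x) * e j \<xi> x)" for j \<xi> l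
  have intT: "integrable (M j) (\<lambda>x. a j x * of_real (\<psi> j l x) * e j \<xi> x)" for j l \<xi>
  proof (rule Bochner_Integration.integrable_bound[OF a[of j]])
    show "AE x in M j. norm (a j x * of_real (\<psi> j l x) * e j \<xi> x) \<le> norm (a j x)"
    proof (rule AE_I2)
      fix x assume x: "x \<in> space (M j)"
      have "norm (a j x) * \<bar>\<psi> j l x\<bar> * norm (e j \<xi> x) \<le> norm (a j x) * 1 * 1"
        using \<psi>1[OF x] e1 by (intro mult_mono) auto
      then show "norm (a j x * of_real (\<psi> j l x) * e j \<xi> x) \<le> norm (a j x)" by (simp add: norm_mult)
    qed
  qed measurable
  define \<phi> where "\<phi> j \<xi> x = (\<Sum>k\<in>UNIV. u j \<xi> k * v j k x)" for j \<xi> x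
  have \<phi>m [measurable]: "\<phi> j \<xi> \<in> borel_measurable (M j)" for j \<xi> unfolding \<phi>_def by measurable
  have \<phi>1: "\<bar>\<phi> j \<xi> x\<bar> \<le> CARD('k) * M0" if "\<xi> \<in> \<Xi>" "x \<in> space (M j)" for j \<xi> x
  proof -
    have "\<bar>\<phi> j \<xi> x\<bar> \<le> (\<Sum>k\<in>(UNIV::'k set). \<bar>u j \<xi> k * v j k x\<bar>)" unfolding \<phi>_def by (rule sum_abs)
    also have "\<dots> \<le> (\<Sum>k\<in>(UNIV::'k set). 1 * M0)"
      unfolding abs_mult using u[OF that(1)] v1[OF that(2)] by (intro sum_mono mult_mono) auto
    finally show ?thesis by simp
  qed
  define c where "c l = M0 ^ length l / fact (length l)" for l :: "'k list"
  define P where "P N j \<xi> = (LINT x|M j. a j x * e j \<xi> x * (\<Sum>m<N. (\<i> * of_real (\<phi> j \<xi> x)) ^ m / fact m))" for N j \<xi>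
  define F where "F j \<xi> = (LINT x|M j. a j x * e j \<xi> x * cis (\<phi> j \<xi> x))" for j \<xi>
  have P_eq: "P N j \<xi> = (\<Sum>l | length l < N. of_real (c l) * \<i> ^ length l * of_real (prod_list (map (u j \<xi>) l)) * T j \<xi> l)" for N j \<xi>
  proof -
    have uv: "prod_list (map (\<lambda>k. u j \<xi> k * v j k x) l) = M0 ^ length l * prod_list (map (u j \<xi>) l) * \<psi> j l x" for l x
      unfolding \<psi>_def using M0 by (induction l) auto
    have "(\<Sum>m<N. (\<i> * of_real (\<phi> j \<xi> x)) ^ m / fact m)
      = (\<Sum>l | length l < N. of_real (c l) * \<i> ^ length l * of_real (prod_list (map (u j \<xi>) l)) * of_real (\<psi> j l x))" for x
    proof -
      have "(\<i> * of_real (\<phi> j \<xi> x)) ^ m / fact m = (\<Sum>l\<in>lists_of_length m. \<i> ^ m / fact m * of_real (prod_list (map (\<lambda>k. u j \<xi> k * v j k x) l)))" for m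
        unfolding \<phi>_def power_mult_distrib of_real_power[symmetric] power_sum_eq_sum_lists
        by (simp add: sum_distrib_left sum_divide_distrib)
      then show ?thesis
        unfolding sum_lists_up_to uv c_def by (intro sum.cong refl) (simp add: mult_ac)
    qed
    then have "P N j \<xi> = (LINT x|M j. (\<Sum>l | length l < N. of_real (c l) * \<i> ^ length l * of_real (prod_list (map (u j \<xi>) l)) * (a j x * of_real (\<psi> j l x) * e j \<xi> x)))"
      unfolding P_def by (simp add: sum_distrib_left mult_ac)
    also have "\<dots> = (\<Sum>l | length l < N. of_real (c l) * \<i> ^ length l * of_real (prod_list (map (u j \<xi>) l)) * T j \<xi> l)"
      unfolding T_def by (subst Bochner_Integration.integral_sum) (auto intro!: intT integrable_mult_right)
    finally show ?thesis .
  qed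
  have u_le: "\<bar>prod_list (map (u j \<xi>) l)\<bar> \<le> 1" if "\<xi> \<in> \<Xi>" for j \<xi> l
  proof (induction l)
    case (Cons k l)
    have "\<bar>u j \<xi> k\<bar> * \<bar>prod_list (map (u j \<xi>) l)\<bar> \<le> 1 * 1" using Cons u[OF that] by (intro mult_mono) auto
    then show ?case by (simp add: abs_mult)
  qed simp
  have c0: "c l \<ge> 0" for l using M0 by (simp add: c_def)
  have B0: "B \<ge> 0"
  proof -
    have "0 \<le> (\<Sum>\<xi>\<in>\<Xi>. \<Prod>j\<in>UNIV. norm (LINT x|M j. a j x * of_real ((\<lambda>_ _. 1) j x) * e j \<xi> x) powr s)"
      by (intro sum_nonneg prod_nonneg) auto
    also have "\<dots> \<le> B" by (rule hyp) auto
    finally show ?thesis .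
  qed
  have PN: "(\<Sum>\<xi>\<in>\<Xi>. \<Prod>j\<in>UNIV. norm (P N j \<xi>) powr s) \<le> phase_const CARD('n) CARD('k) M0 s * B" for N
  proof -
    define I where "I = {l::'k list. length l < N}"
    have k0: "CARD('k) > 0" by simp
    have sumI: "(\<Sum>l\<in>I. c l powr \<theta>) \<le> exp_const CARD('k) M0 \<theta>" if "\<theta> > 0" for \<theta>
    proof -
      have "(\<Sum>l\<in>I. c l powr \<theta>) = (\<Sum>m<N. real CARD('k) ^ m * (M0 ^ m / fact m) powr \<theta>)"
        unfolding I_def sum_lists_up_to c_def by (simp add: card_lists_of_length)
      also have "\<dots> \<le> exp_const CARD('k) M0 \<theta>" by (rule sum_exp_const[OF M0 that k0])
      finally show ?thesis .
    qed
    have "(\<Sum>\<xi>\<in>\<Xi>. \<Prod>j\<in>UNIV. norm (P N j \<xi>) powr s)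
       \<le> ((\<Sum>l\<in>I. sqrt (c l)) powr s * (\<Sum>l\<in>I. c l powr (s / 2))) ^ CARD('n) * B"
    proof (rule sum_prod_powr_expansion[where t = "\<lambda>j \<xi> l. norm (T j \<xi> l)"])
      show "finite I" by (simp add: I_def finite_lists_up_to)
      show "norm (P N j \<xi>) \<le> (\<Sum>l\<in>I. c l * norm (T j \<xi> l))" if "\<xi> \<in> \<Xi>" for j \<xi>
      proof -
        have "norm (P N j \<xi>) \<le> (\<Sum>l\<in>I. norm (of_real (c l) * \<i> ^ length l * of_real (prod_list (map (u j \<xi>) l)) * T j \<xi> l))"
          unfolding P_eq I_def by (rule norm_sum)
        also have "\<dots> \<le> (\<Sum>l\<in>I. c l * norm (T j \<xi> l))"
        proof (rule sum_mono)
          fix l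
          have "c l * norm (T j \<xi> l) * \<bar>prod_list (map (u j \<xi>) l)\<bar> \<le> c l * norm (T j \<xi> l) * 1"
            using u_le[OF that] c0 by (intro mult_left_mono) auto
          then show "norm (of_real (c l) * \<i> ^ length l * of_real (prod_list (map (u j \<xi>) l)) * T j \<xi> l) \<le> c l * norm (T j \<xi> l)"
            using c0[of l] by (simp add: norm_mult norm_power mult_ac)
        qed
        finally show ?thesis .
      qed
      show "(\<Sum>\<xi>\<in>\<Xi>. \<Prod>j\<in>UNIV. norm (T j \<xi> (\<sigma> j)) powr s) \<le> B" for \<sigma>
        unfolding T_def by (rule hyp) (auto intro: \<psi>1)
    qed (use fin s c0 in auto)
    also have "\<dots> \<le> phase_const CARD('n) CARD('k) M0 s * B"
    proof -
      have "(\<Sum>l\<in>I. sqrt (c l)) \<le> exp_const CARD('k) M0 (1 / 2)"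
        using sumI[of "1/2"] c0 by (simp add: powr_half_sqrt)
      then have "(\<Sum>l\<in>I. sqrt (c l)) powr s \<le> exp_const CARD('k) M0 (1 / 2) powr s"
        using s c0 by (intro powr_mono2) (auto intro!: sum_nonneg)
      then show ?thesis unfolding phase_const_def
        using sumI[of "s / 2"] s B0 by (intro mult_right_mono power_mono mult_mono) (auto intro!: sum_nonneg mult_nonneg_nonneg)
    qed
    finally show ?thesis .
  qed
  have lim: "(\<lambda>N. P N j \<xi>) \<longlonglongrightarrow> F j \<xi>" if \<xi>: "\<xi> \<in> \<Xi>" for j \<xi>
    unfolding P_def F_def
  proof (rule integral_dominated_convergence[where w = "\<lambda>x. norm (a j x) * exp (CARD('k) * M0)"])
    show "integrable (M j) (\<lambda>x. norm (a j x) * exp (CARD('k) * M0))" using a by auto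
    have exps: "(\<lambda>m. (\<i> * of_real (\<phi> j \<xi> x)) ^ m / fact m) sums cis (\<phi> j \<xi> x)" for x
      using exp_converges[of "\<i> * of_real (\<phi> j \<xi> x)"] by (simp add: cis_conv_exp scaleR_conv_of_real divide_inverse mult.commute)
    show "AE x in M j. (\<lambda>N. a j x * e j \<xi> x * (\<Sum>m<N. (\<i> * of_real (\<phi> j \<xi> x)) ^ m / fact m)) \<longlonglongrightarrow> a j x * e j \<xi> x * cis (\<phi> j \<xi> x)"
      using exps unfolding sums_def by (intro AE_I2 tendsto_mult tendsto_const) auto
    show "AE x in M j. norm (a j x * e j \<xi> x * (\<Sum>m<N. (\<i> * of_real (\<phi> j \<xi> x)) ^ m / fact m)) \<le> norm (a j x) * exp (CARD('k) * M0)" for N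
    proof (rule AE_I2)
      fix x assume x: "x \<in> space (M j)"
      have "norm (\<Sum>m<N. (\<i> * of_real (\<phi> j \<xi> x)) ^ m / fact m) \<le> (\<Sum>m<N. \<bar>\<phi> j \<xi> x\<bar> ^ m / fact m)"
        by (rule order_trans[OF norm_sum]) (simp add: norm_divide norm_power norm_mult)
      also have "\<dots> \<le> (\<Sum>m. inverse (fact m) * \<bar>\<phi> j \<xi> x\<bar> ^ m)"
        unfolding divide_inverse mult.commute[of _ "inverse _"] by (intro sum_le_suminf summable_exp) auto
      also have "\<dots> = exp \<bar>\<phi> j \<xi> x\<bar>" by (simp add: exp_def)
      also have "\<dots> \<le> exp (CARD('k) * M0)" using \<phi>1[OF \<xi> x] by simp
      finally have "norm (a j x) * norm (e j \<xi> x) * norm (\<Sum>m<N. (\<i> * of_real (\<phi> j \<xi> x)) ^ m / fact m) \<le> norm (a j x) * 1 * exp (CARD('k) * M0)"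
        using e1 by (intro mult_mono) auto
      then show "norm (a j x * e j \<xi> x * (\<Sum>m<N. (\<i> * of_real (\<phi> j \<xi> x)) ^ m / fact m)) \<le> norm (a j x) * exp (CARD('k) * M0)"
        by (simp add: norm_mult)
    qed
  qed (auto simp: cis_conv_exp)
  have "(\<lambda>N. \<Sum>\<xi>\<in>\<Xi>. \<Prod>j\<in>UNIV. norm (P N j \<xi>) powr s) \<longlonglongrightarrow> (\<Sum>\<xi>\<in>\<Xi>. \<Prod>j\<in>UNIV. norm (F j \<xi>) powr s)"
    using s by (intro tendsto_sum tendsto_prod tendsto_powr' tendsto_norm lim tendsto_const) auto
  then have "(\<Sum>\<xi>\<in>\<Xi>. \<Prod>j\<in>UNIV. norm (F j \<xi>) powr s) \<le> phase_const CARD('n) CARD('k) M0 s * B"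
    using PN by (intro LIMSEQ_le_const2) auto
  then show ?thesis by (simp add: F_def \<phi>_def)
qed

section \<open>Induction on scales\<close>

lemma power2_powr:
  fixes x :: real
  assumes "x \<ge> 0"
  shows "(x\<^sup>2) powr t = x powr (2 * t)"
  using assms by (cases "x = 0") (auto simp: powr_powr simp flip: powr_numeral)

lemma cis_2pi_add_nat: "cis (2 * pi * (x + real p)) = cis (2 * pi * x)"
proof -
  have "cis (2 * pi * real p) = 1" by (rule cis_multiple_2pi) simp
  then show ?thesis by (simp add: distrib_left cis_mult[symmetric])
qed

text \<open>The exponent in the inequality of Loomis and Whitney; the multilinear estimates concern its double.\<close>

definition lw_exponent :: "nat \<Rightarrow> real" where
  "lw_exponent d = 1 / (real d - 1)"

text \<open>
  The price of one step of the induction. The phase error of a step is a combination of \<open>2 d\<close> products,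
  each bounded by \<open>4 \<pi>\<close>.
\<close>

definition step_const :: "nat \<Rightarrow> real" where
  "step_const d = phase_const d (d + d) (4 * pi) (2 * lw_exponent d)"

lemma step_const_pos: "step_const d > 0"
  by (simp add: step_const_def phase_const_pos)

text \<open>
  The \<open>j\<close>-th hypersurface is parametrised by \<open>x + r j x\<close> with \<open>x j = 0\<close>. Up to Lipschitz constant \<open>1 / K\<close> it is
  the \<open>j\<close>-th coordinate hyperplane, and \<open>K\<close> is also the ratio of consecutive scales.
\<close>

locale near_coordinate_hyperplanes =
  fixes r :: "'n::finite \<Rightarrow> ('n \<Rightarrow> real) \<Rightarrow> 'n \<Rightarrow> real" and K :: nat and \<theta> :: real
  defines "\<theta> \<equiv> lw_exponent CARD('n)"
  assumes card: "CARD('n) \<ge> 2" and K: "K > 0"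
    and Lip: "\<And>j x y \<beta> k. \<lbrakk>\<And>l. 0 \<le> x l \<and> x l \<le> 1; \<And>l. 0 \<le> y l \<and> y l \<le> 1; x j = 0; y j = 0;
       \<And>l. \<bar>x l - y l\<bar> \<le> \<beta>\<rbrakk> \<Longrightarrow> \<bar>r j x k - r j y k\<bar> \<le> \<beta> / K"
begin


definition grid_pt :: "nat \<Rightarrow> ('n \<Rightarrow> nat) \<Rightarrow> 'n \<Rightarrow> real" where
  "grid_pt n m k = real (m k) / real (K ^ n)"

definition surf :: "nat \<Rightarrow> 'n \<Rightarrow> ('n \<Rightarrow> nat) \<Rightarrow> 'n \<Rightarrow> real" where
  "surf n j m k = grid_pt n m k + r j (grid_pt n m) k"

lemma \<theta>_pos: "\<theta> > 0" using card by (simp add: \<theta>_def lw_exponent_def)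

lemma power_card_powr_\<theta>: "(real K ^ card (- {j::'n})) powr \<theta> = K"
proof -
  have "card (- {j}) = CARD('n) - 1" by (simp add: card_Diff_singleton Compl_eq_Diff_UNIV)
  then have "real (card (- {j})) * \<theta> = 1" using card by (simp add: \<theta>_def lw_exponent_def of_nat_diff)
  then show ?thesis using K by (simp add: powr_powr flip: powr_realpow)
qed

lemma grid_pt_01:
  assumes "m \<in> index_box (K ^ n) J"
  shows "0 \<le> grid_pt n m k \<and> grid_pt n m k \<le> 1"
proof -
  have "m k \<le> K ^ n" using assms by (cases "k \<in> J") (auto simp: index_box_def less_imp_le)
  then have "real (m k) \<le> real (K ^ n)" by (simp only: of_nat_le_iff)
  then show ?thesis using K by (simp add: grid_pt_def)
qed

text \<open>
  One step of the induction with the bounded part of the phase removed. The term with \<open>r j\<close> is constant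
  on each coarse cell and is absorbed into the coefficients; what remains of the dependence on \<open>\<eta>\<close> is the
  discrete Fourier transform \<open>D j y\<close>, which ignores \<open>\<eta> j\<close>.
\<close>

lemma flat_step:
  fixes b :: "'n \<Rightarrow> ('n \<Rightarrow> nat) \<Rightarrow> complex"
  assumes IH: "\<And>a. (\<Sum>\<xi>\<in>index_box (K ^ n) UNIV. \<Prod>j\<in>UNIV.
      norm (\<Sum>m\<in>index_box (K ^ n) (- {j}). a j m * cis (2 * pi * (\<Sum>k\<in>UNIV. real (\<xi> k) * surf n j m k))) powr (2 * \<theta>))
      \<le> A * (\<Prod>j\<in>UNIV. (\<Sum>m\<in>index_box (K ^ n) (- {j}). (norm (a j m))\<^sup>2) powr \<theta>)"
    and A: "A \<ge> 0"
  shows "(\<Sum>\<eta>\<in>index_box K UNIV. \<Sum>\<xi>\<in>index_box (K ^ n) UNIV. \<Prod>j\<in>UNIV.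
      norm (\<Sum>m\<in>index_box (K ^ n * K) (- {j}). b j m *
        cis (2 * pi * ((\<Sum>k\<in>UNIV. real (\<xi> k) * surf n j (\<lambda>k. m k div K) k)
          + real (K ^ n) * (\<Sum>k\<in>UNIV. real (\<eta> k) * r j (grid_pt n (\<lambda>k. m k div K)) k)
          + (\<Sum>k\<in>-{j}. real (\<eta> k) * real (m k mod K)) / K))) powr (2 * \<theta>))
      \<le> A * K ^ CARD('n) * (\<Prod>j\<in>UNIV. (\<Sum>m\<in>index_box (K ^ n * K) (- {j}). (norm (b j m))\<^sup>2) powr \<theta>)"
proof -
  let ?N = "K ^ n"
  define D where "D j y z = (\<Sum>w\<in>index_box K (- {j}). b j (\<lambda>k. y k * K + w k) *
       cis (2 * pi * (\<Sum>k\<in>-{j}. real (z k) * real (w k)) / K))" for j y z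
  define a' where "a' \<eta> j y = cis (2 * pi * (real ?N * (\<Sum>k\<in>UNIV. real (\<eta> k) * r j (grid_pt n y) k))) * D j y \<eta>" for \<eta> j y
  define B where "B j z = (\<Sum>y\<in>index_box ?N (- {j}). (norm (D j y z))\<^sup>2)" for j z
  have B0: "B j z \<ge> 0" for j z by (simp add: B_def sum_nonneg)
  have D_upd: "D j y (\<eta>(j := 0)) = D j y \<eta>" for j y \<eta>
    unfolding D_def by (intro sum.cong refl arg_cong2[where f = "(*)"] arg_cong[where f = cis] arg_cong2[where f = "(/)"]) auto
  have F: "(\<Sum>m\<in>index_box (?N * K) (- {j}). b j m *
        cis (2 * pi * ((\<Sum>k\<in>UNIV. real (\<xi> k) * surf n j (\<lambda>k. m k div K) k)
          + real ?N * (\<Sum>k\<in>UNIV. real (\<eta> k) * r j (grid_pt n (\<lambda>k. m k div K)) k)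
          + (\<Sum>k\<in>-{j}. real (\<eta> k) * real (m k mod K)) / K)))
     = (\<Sum>y\<in>index_box ?N (- {j}). a' \<eta> j y * cis (2 * pi * (\<Sum>k\<in>UNIV. real (\<xi> k) * surf n j y k)))" for \<eta> \<xi> j
    unfolding sum_box_mult[OF K]
  proof (intro sum.cong refl)
    fix y assume "y \<in> index_box ?N (- {j})"
    have "(\<Sum>w\<in>index_box K (- {j}). b j (\<lambda>k. y k * K + w k) * cis (2 * pi *
       ((\<Sum>k\<in>UNIV. real (\<xi> k) * surf n j (\<lambda>k. (y k * K + w k) div K) k) +
        real ?N * (\<Sum>k\<in>UNIV. real (\<eta> k) * r j (grid_pt n (\<lambda>k. (y k * K + w k) div K)) k) +
        (\<Sum>k\<in>- {j}. real (\<eta> k) * real ((y k * K + w k) mod K)) / real K)))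
     = (\<Sum>w\<in>index_box K (- {j}). b j (\<lambda>k. y k * K + w k) *
          cis (2 * pi * (\<Sum>k\<in>-{j}. real (\<eta> k) * real (w k)) / K) *
          cis (2 * pi * (real ?N * (\<Sum>k\<in>UNIV. real (\<eta> k) * r j (grid_pt n y) k))) *
          cis (2 * pi * (\<Sum>k\<in>UNIV. real (\<xi> k) * surf n j y k)))"
    proof (intro sum.cong refl)
      fix w assume w: "w \<in> index_box K (- {j})"
      have wK: "w k < K" for k using w K by (cases "k = j") (auto simp: index_box_def)
      have 1: "(y k * K + w k) div K = y k" for k using wK[of k] K by simp
      have 2: "(y k * K + w k) mod K = w k" for k using wK[of k] K by simp
      show "b j (\<lambda>k. y k * K + w k) * cis (2 * pi *
       ((\<Sum>k\<in>UNIV. real (\<xi> k) * surf n j (\<lambda>k. (y k * K + w k) div K) k) +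
        real ?N * (\<Sum>k\<in>UNIV. real (\<eta> k) * r j (grid_pt n (\<lambda>k. (y k * K + w k) div K)) k) +
        (\<Sum>k\<in>- {j}. real (\<eta> k) * real ((y k * K + w k) mod K)) / real K))
      = b j (\<lambda>k. y k * K + w k) *
          cis (2 * pi * (\<Sum>k\<in>-{j}. real (\<eta> k) * real (w k)) / K) *
          cis (2 * pi * (real ?N * (\<Sum>k\<in>UNIV. real (\<eta> k) * r j (grid_pt n y) k))) *
          cis (2 * pi * (\<Sum>k\<in>UNIV. real (\<xi> k) * surf n j y k))"
        unfolding 1 2 mult.assoc cis_mult
        by (intro arg_cong2[where f = "(*)"] arg_cong[where f = cis] refl) (simp add: distrib_left)
    qed
    also have "\<dots> = a' \<eta> j y * cis (2 * pi * (\<Sum>k\<in>UNIV. real (\<xi> k) * surf n j y k))"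
      unfolding a'_def D_def by (simp add: sum_distrib_left sum_distrib_right mult_ac)
    finally show "(\<Sum>w\<in>index_box K (- {j}). b j (\<lambda>k. y k * K + w k) * cis (2 * pi *
       ((\<Sum>k\<in>UNIV. real (\<xi> k) * surf n j (\<lambda>k. (y k * K + w k) div K) k) +
        real ?N * (\<Sum>k\<in>UNIV. real (\<eta> k) * r j (grid_pt n (\<lambda>k. (y k * K + w k) div K)) k) +
        (\<Sum>k\<in>- {j}. real (\<eta> k) * real ((y k * K + w k) mod K)) / real K)))
      = a' \<eta> j y * cis (2 * pi * (\<Sum>k\<in>UNIV. real (\<xi> k) * surf n j y k))" .
  qed
  have a'B: "(\<Sum>m\<in>index_box ?N (- {j}). (norm (a' \<eta> j m))\<^sup>2) = B j (\<eta>(j := 0))" for \<eta> j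
    by (simp add: B_def a'_def norm_mult D_upd)
  have sumB: "(\<Sum>z\<in>index_box K (- {j}). B j z) = real K ^ card (- {j}) * (\<Sum>m\<in>index_box (?N * K) (- {j}). (norm (b j m))\<^sup>2)" for j
  proof -
    have "(\<Sum>z\<in>index_box K (- {j}). B j z) = (\<Sum>y\<in>index_box ?N (- {j}). \<Sum>z\<in>index_box K (- {j}). (norm (D j y z))\<^sup>2)"
      unfolding B_def by (rule sum.swap)
    also have "\<dots> = (\<Sum>y\<in>index_box ?N (- {j}). real K ^ card (- {j}) * (\<Sum>w\<in>index_box K (- {j}). (norm (b j (\<lambda>k. y k * K + w k)))\<^sup>2))"
      unfolding D_def by (intro sum.cong refl parseval_box[OF K]) simp
    finally show ?thesis by (simp add: sum_box_mult[OF K] sum_distrib_left)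
  qed
  have "(\<Sum>\<eta>\<in>index_box K UNIV. \<Sum>\<xi>\<in>index_box ?N UNIV. \<Prod>j\<in>UNIV.
      norm (\<Sum>y\<in>index_box ?N (- {j}). a' \<eta> j y * cis (2 * pi * (\<Sum>k\<in>UNIV. real (\<xi> k) * surf n j y k))) powr (2 * \<theta>))
     \<le> (\<Sum>\<eta>\<in>index_box K UNIV. A * (\<Prod>j\<in>UNIV. B j (\<eta>(j := 0)) powr \<theta>))"
    using IH[of "a' _"] unfolding a'B by (intro sum_mono)
  also have "\<dots> = A * (\<Sum>\<eta>\<in>index_box K UNIV. \<Prod>j\<in>UNIV. B j (\<eta>(j := 0)) powr \<theta>)"
    by (simp add: sum_distrib_left)
  also have "\<dots> \<le> A * (\<Prod>j\<in>UNIV. (\<Sum>z\<in>index_box K (- {j}). B j z) powr \<theta>)"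
    using loomis_whitney[of B K] card B0 A by (intro mult_left_mono) (auto simp: \<theta>_def lw_exponent_def)
  also have "(\<Prod>j\<in>UNIV. (\<Sum>z\<in>index_box K (- {j}). B j z) powr \<theta>)
     = (\<Prod>j\<in>UNIV. K * (\<Sum>m\<in>index_box (?N * K) (- {j}). (norm (b j m))\<^sup>2) powr \<theta>)"
    by (intro prod.cong refl) (simp add: sumB powr_mult sum_nonneg power_card_powr_\<theta>)
  also have "\<dots> = K ^ CARD('n) * (\<Prod>j\<in>UNIV. (\<Sum>m\<in>index_box (?N * K) (- {j}). (norm (b j m))\<^sup>2) powr \<theta>)"
    by (simp add: prod.distrib)
  finally show ?thesis unfolding F by (simp add: mult.assoc)
qed

text \<open>
  Compared with the phase of \<open>flat_step\<close>, the true phase at the frequency \<open>\<eta> K\<^sup>n + \<xi>\<close> contains the integer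
  \<open>\<Sum>\<^sub>k \<eta> k * par m k\<close>, which is invisible, and two further terms: \<open>\<xi>\<close> times the displacement inside a coarse
  cell, where \<open>|\<xi>| \<le> K\<^sup>n\<close> meets a displacement of size \<open>K\<^sup>-\<^sup>n\<close>, and \<open>K\<^sup>n \<eta>\<close> times the increment of \<open>r j\<close>,
  where \<open>K\<^sup>n\<^sup>+\<^sup>1\<close> meets an increment of size \<open>K\<^sup>-\<^sup>n / K\<close>. Both are bounded, the second one precisely because
  of the Lipschitz constant \<open>1 / K\<close>.
\<close>

theorem discrete_restriction:
  fixes a :: "'n \<Rightarrow> ('n \<Rightarrow> nat) \<Rightarrow> complex"
  shows "(\<Sum>\<xi>\<in>index_box (K ^ n) UNIV. \<Prod>j\<in>UNIV.
      norm (\<Sum>m\<in>index_box (K ^ n) (- {j}). a j m * cis (2 * pi * (\<Sum>k\<in>UNIV. real (\<xi> k) * surf n j m k))) powr (2 * \<theta>))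
      \<le> (step_const CARD('n) * K ^ CARD('n)) ^ n * (\<Prod>j\<in>UNIV. (\<Sum>m\<in>index_box (K ^ n) (- {j}). (norm (a j m))\<^sup>2) powr \<theta>)"
proof (induction n arbitrary: a)
  case 0
  have "index_box (Suc 0) J = {\<lambda>_. 0}" for J :: "'n set" by (auto simp: index_box_def)
  then show ?case by (simp add: norm_mult power2_powr)
next
  case (Suc n)
  let ?N = "K ^ n"
  let ?A = "(step_const CARD('n) * K ^ CARD('n)) ^ n"
  define nrm where "nrm = (\<Prod>j\<in>UNIV. (\<Sum>m\<in>index_box (?N * K) (- {j}). (norm (a j m))\<^sup>2) powr \<theta>)"
  define par where "par m = (\<lambda>k. m k div K)" for m :: "'n \<Rightarrow> nat"
  define \<Xi> where "\<Xi> = (index_box K UNIV \<times> index_box ?N UNIV :: (('n \<Rightarrow> nat) \<times> ('n \<Rightarrow> nat)) set)"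
  define M where "M j = count_space (index_box (?N * K) (- {j}))" for j :: 'n
  define dr where "dr j m k = r j (grid_pt (Suc n) m) k - r j (grid_pt n (par m)) k" for j m k
  define e where "e j p m = cis (2 * pi * ((\<Sum>k\<in>UNIV. real (snd p k) * surf n j (par m) k)
          + real ?N * (\<Sum>k\<in>UNIV. real (fst p k) * r j (grid_pt n (par m)) k)
          + (\<Sum>k\<in>-{j}. real (fst p k) * real (m k mod K)) / K))" for j and p :: "('n \<Rightarrow> nat) \<times> ('n \<Rightarrow> nat)" and m
  define u where "u j p k = (case k of Inl k \<Rightarrow> real (snd p k) / ?N | Inr k \<Rightarrow> real (fst p k) / K)"
    for j :: 'n and p :: "('n \<Rightarrow> nat) \<times> ('n \<Rightarrow> nat)" and k :: "'n + 'n"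
  define v where "v j k m = (case k of Inl k \<Rightarrow> 2 * pi * ?N * (grid_pt (Suc n) m k - grid_pt n (par m) k + dr j m k)
      | Inr k \<Rightarrow> 2 * pi * ?N * K * dr j m k)" for j m and k :: "'n + 'n"
  have N: "real ?N > 0" using K by simp
  have intM: "(LINT x|M j. f x) = (\<Sum>m\<in>index_box (?N * K) (- {j}). f m)" for f :: "_ \<Rightarrow> complex" and j
    unfolding M_def by (rule lebesgue_integral_count_space_finite) simp
  have pt_diff: "\<bar>grid_pt (Suc n) m k - grid_pt n (par m) k\<bar> \<le> 1 / ?N" for m k
  proof -
    have "real (m k) = real (m k div K) * K + real (m k mod K)"
      by (metis div_mult_mod_eq of_nat_add of_nat_mult)
    then have "grid_pt (Suc n) m k - grid_pt n (par m) k = real (m k mod K) / K / ?N"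
      using K unfolding grid_pt_def par_def by (simp add: field_simps)
    moreover have "real (m k mod K) / K \<le> 1" using K by (simp add: less_imp_le)
    moreover have "real (m k mod K) / K / ?N \<le> 1 / ?N"
      by (rule divide_right_mono) (use calculation(2) in auto)
    ultimately show ?thesis by simp
  qed
  have dr_le: "\<bar>dr j m k\<bar> \<le> 1 / ?N / K" if m: "m \<in> index_box (?N * K) (- {j})" for j m k
    unfolding dr_def
  proof (rule Lip)
    have m': "m \<in> index_box (K ^ Suc n) (- {j})" using m by (simp add: mult.commute)
    have pm: "par m \<in> index_box (K ^ n) (- {j})"
      using m K by (auto simp: index_box_def par_def less_mult_imp_div_less)
    show "0 \<le> grid_pt (Suc n) m l \<and> grid_pt (Suc n) m l \<le> 1" for l by (rule grid_pt_01[OF m'])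
    show "0 \<le> grid_pt n (par m) l \<and> grid_pt n (par m) l \<le> 1" for l by (rule grid_pt_01[OF pm])
    show "grid_pt (Suc n) m j = 0" "grid_pt n (par m) j = 0" using m by (auto simp: grid_pt_def index_box_def par_def)
    show "\<bar>grid_pt (Suc n) m l - grid_pt n (par m) l\<bar> \<le> 1 / ?N" for l by (rule pt_diff)
  qed
  have phase: "cis (2 * pi * (\<Sum>k\<in>UNIV. real (fst p k * ?N + snd p k) * surf (Suc n) j m k))
     = e j p m * cis (\<Sum>k\<in>UNIV. u j p k * v j k m)" if m: "m \<in> index_box (?N * K) (- {j})" for j p m
  proof -
    have uv: "(\<Sum>k\<in>UNIV. u j p k * v j k m) = 2 * pi * ((\<Sum>k\<in>UNIV. real (snd p k) * (grid_pt (Suc n) m k - grid_pt n (par m) k + dr j m k))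
        + real ?N * (\<Sum>k\<in>UNIV. real (fst p k) * dr j m k))"
    proof -
      have Plus: "(\<Sum>k\<in>UNIV. f k) = (\<Sum>k\<in>UNIV. f (Inl k)) + (\<Sum>k\<in>UNIV. f (Inr k))" for f :: "'n + 'n \<Rightarrow> real"
        unfolding UNIV_Plus_UNIV[symmetric] by (subst sum.Plus) auto
      have Inl: "u j p (Inl k) * v j (Inl k) m
         = 2 * pi * (real (snd p k) * (grid_pt (Suc n) m k - grid_pt n (par m) k + dr j m k))" for k
        using N K by (simp add: u_def v_def)
      have Inr: "u j p (Inr k) * v j (Inr k) m = 2 * pi * (real ?N * (real (fst p k) * dr j m k))" for k
        using N K by (simp add: u_def v_def)
      show ?thesis unfolding Plus Inl Inr sum_distrib_left[symmetric] by (simp add: distrib_left)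
    qed
    have pt: "real ?N * grid_pt (Suc n) m k = real (m k div K) + real (m k mod K) / K" for k
    proof -
      have "real (m k) = real (m k div K) * K + real (m k mod K)"
        by (metis div_mult_mod_eq of_nat_add of_nat_mult)
      then show ?thesis using K unfolding grid_pt_def by (simp add: field_simps)
    qed
    have U: "UNIV = insert j (- {j})" by auto
    have mj: "m j mod K = 0" using m by (simp add: index_box_def)
    have rem: "(\<Sum>k\<in>UNIV. real (fst p k) * real (m k mod K)) = (\<Sum>k\<in>-{j}. real (fst p k) * real (m k mod K))"
      by (subst U, subst sum.insert) (auto simp: mj)
    have term1: "real (fst p k * ?N + snd p k) * surf (Suc n) j m k
       = real (snd p k) * surf n j (par m) k
        + real (snd p k) * (grid_pt (Suc n) m k - grid_pt n (par m) k + dr j m k)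
        + real ?N * (real (fst p k) * r j (grid_pt n (par m)) k) + real ?N * (real (fst p k) * dr j m k)
        + real (fst p k) * (real (m k div K) + real (m k mod K) / K)" for k
      unfolding pt[symmetric] surf_def dr_def by (simp add: algebra_simps)
    have sum1: "(\<Sum>k\<in>UNIV. real (fst p k * ?N + snd p k) * surf (Suc n) j m k)
       = ((\<Sum>k\<in>UNIV. real (snd p k) * surf n j (par m) k)
          + real ?N * (\<Sum>k\<in>UNIV. real (fst p k) * r j (grid_pt n (par m)) k)
          + (\<Sum>k\<in>-{j}. real (fst p k) * real (m k mod K)) / K)
        + ((\<Sum>k\<in>UNIV. real (snd p k) * (grid_pt (Suc n) m k - grid_pt n (par m) k + dr j m k))
           + real ?N * (\<Sum>k\<in>UNIV. real (fst p k) * dr j m k))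
        + real (\<Sum>k\<in>UNIV. fst p k * (m k div K))"
      unfolding term1 rem[symmetric]
      by (simp add: sum.distrib sum_distrib_left sum_divide_distrib distrib_left)
    show ?thesis
      unfolding sum1 cis_2pi_add_nat e_def uv cis_mult by (simp add: distrib_left)
  qed
  have "(\<Sum>p\<in>\<Xi>. \<Prod>j\<in>UNIV. norm (LINT x|M j. a j x * e j p x * cis (\<Sum>k\<in>UNIV. u j p k * v j k x)) powr (2 * \<theta>))
     \<le> phase_const CARD('n) CARD('n + 'n) (4 * pi) (2 * \<theta>) * (?A * K ^ CARD('n) * nrm)"
  proof (rule bounded_phase_perturbation)
    show "finite \<Xi>" by (simp add: \<Xi>_def)
    show "integrable (M j) (a j)" for j unfolding M_def by (rule integrable_count_space) simp
    show "norm (e j p m) \<le> 1" for j p m by (simp add: e_def)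
    show "\<bar>u j p k\<bar> \<le> 1" if "p \<in> \<Xi>" for j p k
      using that K by (auto simp: u_def \<Xi>_def index_box_def less_imp_le split: sum.split)
    show "\<bar>v j k m\<bar> \<le> 4 * pi" if "m \<in> space (M j)" for j k m
    proof -
      have m: "m \<in> index_box (?N * K) (- {j})" using that by (simp add: M_def)
      have K1: "real K \<ge> 1" using K by simp
      show ?thesis
      proof (cases k)
        case (Inl k')
        have "1 / ?N / K \<le> 1 / ?N / 1" using K1 N by (intro divide_left_mono) auto
        then have "\<bar>grid_pt (Suc n) m k' - grid_pt n (par m) k' + dr j m k'\<bar> \<le> 2 / ?N"
          using pt_diff[of m k'] dr_le[OF m, of k'] by linarith
        then have "2 * pi * ?N * \<bar>grid_pt (Suc n) m k' - grid_pt n (par m) k' + dr j m k'\<bar> \<le> 2 * pi * ?N * (2 / ?N)"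
          by (intro mult_left_mono) auto
        also have "\<dots> = 4 * pi" using K by simp
        finally show ?thesis using Inl by (simp add: v_def abs_mult)
      next
        case (Inr k')
        have "2 * pi * ?N * K * \<bar>dr j m k'\<bar> \<le> 2 * pi * ?N * K * (1 / ?N / K)"
          by (intro mult_left_mono dr_le[OF m]) auto
        also have "\<dots> = 2 * pi" using N K by simp
        finally have "2 * pi * ?N * K * \<bar>dr j m k'\<bar> \<le> 4 * pi" using pi_gt_zero by linarith
        then show ?thesis using Inr by (simp add: v_def abs_mult)
      qed
    qed
    fix \<psi> :: "'n \<Rightarrow> ('n \<Rightarrow> nat) \<Rightarrow> real"
    assume \<psi>: "\<And>j m. m \<in> space (M j) \<Longrightarrow> \<bar>\<psi> j m\<bar> \<le> 1"
    have "(\<Sum>p\<in>\<Xi>. \<Prod>j\<in>UNIV. norm (LINT x|M j. a j x * of_real (\<psi> j x) * e j p x) powr (2 * \<theta>))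
       \<le> ?A * K ^ CARD('n) * (\<Prod>j\<in>UNIV. (\<Sum>m\<in>index_box (?N * K) (- {j}). (norm (a j m * of_real (\<psi> j m)))\<^sup>2) powr \<theta>)"
      unfolding \<Xi>_def intM e_def par_def
      using flat_step[OF Suc.IH, of "\<lambda>j m. a j m * of_real (\<psi> j m)"]
      by (simp add: step_const_def phase_const_pos less_imp_le sum.cartesian_product case_prod_unfold)
    also have "\<dots> \<le> ?A * K ^ CARD('n) * nrm"
    proof (intro mult_left_mono)
      show "(\<Prod>j\<in>UNIV. (\<Sum>m\<in>index_box (?N * K) (- {j}). (norm (a j m * of_real (\<psi> j m)))\<^sup>2) powr \<theta>) \<le> nrm"
        unfolding nrm_def
      proof (intro prod_mono conjI powr_mono2 sum_mono power_mono)
        fix j :: 'n and m assume "m \<in> index_box (?N * K) (- {j})"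
        then have "\<bar>\<psi> j m\<bar> \<le> 1" by (intro \<psi>) (simp add: M_def)
        then show "norm (a j m * of_real (\<psi> j m)) \<le> norm (a j m)"
          by (simp add: norm_mult mult_left_le)
      qed (use \<theta>_pos in \<open>auto intro!: sum_nonneg\<close>)
    qed (auto simp: step_const_def phase_const_pos less_imp_le)
    finally show "(\<Sum>p\<in>\<Xi>. \<Prod>j\<in>UNIV. norm (LINT x|M j. a j x * of_real (\<psi> j x) * e j p x) powr (2 * \<theta>))
       \<le> ?A * K ^ CARD('n) * nrm" .
  qed (use \<theta>_pos in \<open>auto simp: M_def\<close>)
  also have "(\<Sum>p\<in>\<Xi>. \<Prod>j\<in>UNIV. norm (LINT x|M j. a j x * e j p x * cis (\<Sum>k\<in>UNIV. u j p k * v j k x)) powr (2 * \<theta>))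
     = (\<Sum>p\<in>\<Xi>. \<Prod>j\<in>UNIV. norm (\<Sum>m\<in>index_box (?N * K) (- {j}). a j m * cis (2 * pi * (\<Sum>k\<in>UNIV. real (fst p k * ?N + snd p k) * surf (Suc n) j m k))) powr (2 * \<theta>))"
    unfolding intM
    by (intro sum.cong prod.cong refl arg_cong2[where f = "(powr)"] arg_cong[where f = norm])
       (subst phase, assumption, rule mult.assoc)
  also have "\<dots> = (\<Sum>\<xi>\<in>index_box (K * ?N) UNIV. \<Prod>j\<in>UNIV. norm (\<Sum>m\<in>index_box (?N * K) (- {j}). a j m * cis (2 * pi * (\<Sum>k\<in>UNIV. real (\<xi> k) * surf (Suc n) j m k))) powr (2 * \<theta>))"
    unfolding \<Xi>_def using K by (subst sum_box_mult) (auto simp: sum.cartesian_product case_prod_unfold)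
  finally show ?case
    by (simp add: nrm_def step_const_def \<theta>_def mult_ac)
qed

text \<open>
  The passage from grids to measures. On each cell the surface \<open>S j\<close> stays within \<open>O(K\<^sup>-\<^sup>n)\<close> of a grid point,
  so the phase may be frozen there at the cost of a bounded perturbation; the coefficients are the
  integrals of \<open>g j\<close> over the cells, and the inequality of Cauchy and Schwarz bounds their squares.
\<close>

lemma cell_restriction:
  fixes M :: "'n \<Rightarrow> 'a measure" and g :: "'n \<Rightarrow> 'a \<Rightarrow> complex"
    and cell :: "'n \<Rightarrow> 'a \<Rightarrow> 'n \<Rightarrow> nat" and S :: "'n \<Rightarrow> 'a \<Rightarrow> 'n \<Rightarrow> real"
  assumes M: "\<And>j. finite_measure (M j)"
    and g [measurable]: "\<And>j. g j \<in> borel_measurable (M j)" and gb: "\<And>j x. norm (g j x) \<le> G"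
    and cell [measurable]: "\<And>j. cell j \<in> M j \<rightarrow>\<^sub>M count_space UNIV"
    and cell_box: "\<And>j x. x \<in> space (M j) \<Longrightarrow> cell j x \<in> index_box (K ^ n) (- {j})"
    and V: "\<And>j m. measure (M j) {x \<in> space (M j). cell j x = m} \<le> V"
    and S [measurable]: "\<And>j k. (\<lambda>x. S j x k) \<in> borel_measurable (M j)"
    and S_close: "\<And>j x k. x \<in> space (M j) \<Longrightarrow> \<bar>S j x k - surf n j (cell j x) k\<bar> \<le> 2 / K ^ n"
  shows "(\<Sum>\<xi>\<in>index_box (K ^ n) UNIV. \<Prod>j\<in>UNIV.
      norm (LINT x|M j. g j x * cis (2 * pi * (\<Sum>k\<in>UNIV. real (\<xi> k) * S j x k))) powr (2 * \<theta>))
    \<le> phase_const CARD('n) CARD('n) (4 * pi) (2 * \<theta>) * ((step_const CARD('n) * K ^ CARD('n)) ^ n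
        * (\<Prod>j\<in>UNIV. (V * (LINT x|M j. (norm (g j x))\<^sup>2)) powr \<theta>))"
proof -
  let ?N = "K ^ n"
  have N: "real ?N > 0" using K by simp
  have gi: "integrable (M j) (g j)" for j
    by (rule finite_measure.integrable_const_bound[OF M, of _ G]) (use gb in auto)
  have g2i: "integrable (M j) (\<lambda>x. (norm (g j x))\<^sup>2)" for j
    by (rule finite_measure.integrable_const_bound[OF M, of _ "G\<^sup>2"]) (auto intro!: power_mono gb)
  have V0: "V \<ge> 0" using V measure_nonneg order_trans by blast
  define e where "e j \<xi> x = cis (2 * pi * (\<Sum>k\<in>UNIV. real (\<xi> k) * surf n j (cell j x) k))" for j and \<xi> :: "'n \<Rightarrow> nat" and x
  define u where "u j \<xi> k = real (\<xi> k) / ?N" for j :: 'n and \<xi> :: "'n \<Rightarrow> nat" and k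
  define v where "v j k x = 2 * pi * ?N * (S j x k - surf n j (cell j x) k)" for j k x
  have surf_m [measurable]: "(\<lambda>x. surf n j (cell j x) k) \<in> borel_measurable (M j)" for j k
    by (rule measurable_compose[OF cell]) simp
  have sets_cell [measurable]: "{x \<in> space (M j). cell j x = m} \<in> sets (M j)" for j m
    using measurable_sets[OF cell, of "{m}" j] by (simp add: vimage_def Int_def conj_commute)
  have "(\<Sum>\<xi>\<in>index_box ?N UNIV. \<Prod>j\<in>UNIV.
      norm (LINT x|M j. g j x * e j \<xi> x * cis (\<Sum>k\<in>UNIV. u j \<xi> k * v j k x)) powr (2 * \<theta>))
    \<le> phase_const CARD('n) CARD('n) (4 * pi) (2 * \<theta>) * ((step_const CARD('n) * K ^ CARD('n)) ^ n
        * (\<Prod>j\<in>UNIV. (V * (LINT x|M j. (norm (g j x))\<^sup>2)) powr \<theta>))"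
  proof (rule bounded_phase_perturbation)
    show "e j \<xi> \<in> borel_measurable (M j)" for j \<xi> unfolding e_def by measurable
    show "v j k \<in> borel_measurable (M j)" for j k unfolding v_def by measurable
    show "\<bar>u j \<xi> k\<bar> \<le> 1" if "\<xi> \<in> index_box ?N UNIV" for j \<xi> k
    proof -
      have "\<xi> k \<le> ?N" using that by (simp add: index_box_def less_imp_le)
      then have "real (\<xi> k) \<le> real ?N" by (simp only: of_nat_le_iff)
      then show ?thesis using N by (simp add: u_def)
    qed
    show "\<bar>v j k x\<bar> \<le> 4 * pi" if "x \<in> space (M j)" for j k x
    proof -
      have "2 * pi * ?N * \<bar>S j x k - surf n j (cell j x) k\<bar> \<le> 2 * pi * ?N * (2 / ?N)"
        using S_close[OF that] by (intro mult_left_mono) auto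
      also have "\<dots> = 4 * pi" using K by simp
      finally show ?thesis by (simp add: v_def abs_mult)
    qed
    fix \<psi> :: "'n \<Rightarrow> 'a \<Rightarrow> real"
    assume \<psi>m [measurable]: "\<And>j. \<psi> j \<in> borel_measurable (M j)"
      and \<psi>1: "\<And>j x. x \<in> space (M j) \<Longrightarrow> \<bar>\<psi> j x\<bar> \<le> 1"
    define f where "f j x = g j x * of_real (\<psi> j x)" for j x
    have fm [measurable]: "f j \<in> borel_measurable (M j)" for j unfolding f_def by measurable
    have f_le: "norm (f j x) \<le> norm (g j x)" if "x \<in> space (M j)" for j x
      using \<psi>1[OF that] by (simp add: f_def norm_mult mult_left_le)
    define ind where "ind j m x = (indicator {x \<in> space (M j). cell j x = m} x :: real)" for j m x
    have ind_m [measurable]: "ind j m \<in> borel_measurable (M j)" for j m unfolding ind_def by measurable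
    have fi: "integrable (M j) (\<lambda>x. f j x * of_real (ind j m x))" for j m
      by (rule Bochner_Integration.integrable_bound[OF gi])
         (use f_le in \<open>auto simp: norm_mult ind_def indicator_def\<close>)
    define a where "a j m = (LINT x|M j. f j x * of_real (ind j m x))" for j m
    have sum_ind: "h (cell j x) = (\<Sum>m\<in>index_box ?N (- {j}). of_real (ind j m x) * h m)" if "x \<in> space (M j)"
      for j x and h :: "_ \<Rightarrow> complex"
    proof -
      have "(\<Sum>m\<in>index_box ?N (- {j}). of_real (ind j m x) * h m) = (\<Sum>m\<in>index_box ?N (- {j}). if m = cell j x then h m else 0)"
        using that by (intro sum.cong) (auto simp: ind_def)
      then show ?thesis using cell_box[OF that] by simp
    qed
    have decomp: "(LINT x|M j. g j x * of_real (\<psi> j x) * e j \<xi> x)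
        = (\<Sum>m\<in>index_box ?N (- {j}). a j m * cis (2 * pi * (\<Sum>k\<in>UNIV. real (\<xi> k) * surf n j m k)))" for j \<xi>
    proof -
      have "(LINT x|M j. g j x * of_real (\<psi> j x) * e j \<xi> x) = (LINT x|M j.
          (\<Sum>m\<in>index_box ?N (- {j}). f j x * of_real (ind j m x) * cis (2 * pi * (\<Sum>k\<in>UNIV. real (\<xi> k) * surf n j m k))))"
        unfolding f_def[symmetric] e_def
      proof (intro Bochner_Integration.integral_cong refl)
        fix x assume x: "x \<in> space (M j)"
        show "f j x * cis (2 * pi * (\<Sum>k\<in>UNIV. real (\<xi> k) * surf n j (cell j x) k))
           = (\<Sum>m\<in>index_box ?N (- {j}). f j x * of_real (ind j m x) * cis (2 * pi * (\<Sum>k\<in>UNIV. real (\<xi> k) * surf n j m k)))"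
          unfolding sum_ind[OF x, of "\<lambda>m. cis (2 * pi * (\<Sum>k\<in>UNIV. real (\<xi> k) * surf n j m k))"]
          by (simp only: sum_distrib_left mult.assoc)
      qed
      also have "\<dots> = (\<Sum>m\<in>index_box ?N (- {j}). a j m * cis (2 * pi * (\<Sum>k\<in>UNIV. real (\<xi> k) * surf n j m k)))"
        unfolding a_def by (subst Bochner_Integration.integral_sum) (auto intro!: fi integrable_mult_left)
      finally show ?thesis .
    qed
    have a_le: "(norm (a j m))\<^sup>2 \<le> V * (LINT x|M j. (norm (g j x))\<^sup>2 * ind j m x)" for j m
    proof -
      have i1: "integrable (M j) (\<lambda>x. norm (g j x) * ind j m x)"
        by (rule Bochner_Integration.integrable_bound[OF gi]) (auto simp: ind_def indicator_def)
      have i2: "integrable (M j) (\<lambda>x. (norm (g j x))\<^sup>2 * ind j m x)"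
        by (rule Bochner_Integration.integrable_bound[OF g2i]) (auto simp: ind_def indicator_def)
      have i3: "integrable (M j) (ind j m)"
        by (rule finite_measure.integrable_const_bound[OF M, of _ 1]) (auto simp: ind_def indicator_def)
      have mu: "(LINT x|M j. ind j m x) \<le> V"
        using V[of j m] unfolding ind_def by simp
      define I where "I = (LINT x|M j. norm (g j x) * ind j m x)"
      define Q where "Q = (LINT x|M j. (norm (g j x))\<^sup>2 * ind j m x)"
      have I0: "I \<ge> 0" unfolding I_def by (intro integral_nonneg_AE) (auto simp: ind_def)
      have Q0: "Q \<ge> 0" unfolding Q_def by (intro integral_nonneg_AE) (auto simp: ind_def)
      \<comment> \<open>Cauchy-Schwarz in the form of a quadratic polynomial in \<open>c\<close> that is nowhere negative\<close>
      have quad: "0 \<le> Q - 2 * c * I + c\<^sup>2 * V" for c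
      proof -
        have "0 \<le> (LINT x|M j. (norm (g j x) - c)\<^sup>2 * ind j m x)"
          by (intro integral_nonneg_AE) (auto simp: ind_def)
        also have "\<dots> = (LINT x|M j. (norm (g j x))\<^sup>2 * ind j m x - 2 * c * (norm (g j x) * ind j m x) + c\<^sup>2 * ind j m x)"
          by (intro Bochner_Integration.integral_cong refl) (simp add: power2_diff algebra_simps)
        also have "\<dots> = Q - 2 * c * I + c\<^sup>2 * (LINT x|M j. ind j m x)"
          unfolding Q_def I_def using i1 i2 i3 by simp
        also have "\<dots> \<le> Q - 2 * c * I + c\<^sup>2 * V" using mu by (simp add: mult_left_mono)
        finally show ?thesis .
      qed
      have "I\<^sup>2 \<le> V * Q"
      proof (cases "V = 0")
        case True
        have "I = 0"
        proof (rule ccontr)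
          assume "I \<noteq> 0"
          with I0 have "I > 0" by simp
          then show False using quad[of "(Q + 1) / (2 * I)"] True by simp
        qed
        then show ?thesis using True by simp
      next
        case False
        then have "V > 0" using V0 by simp
        then show ?thesis using quad[of "I / V"] by (simp add: field_simps power2_eq_square)
      qed
      moreover have "norm (a j m) \<le> I"
      proof -
        have "norm (a j m) \<le> (LINT x|M j. norm (f j x * of_real (ind j m x)))" unfolding a_def by (rule integral_norm_bound)
        also have "\<dots> \<le> I" unfolding I_def
          by (intro integral_mono i1 integrable_norm fi) (use f_le in \<open>auto simp: norm_mult ind_def indicator_def\<close>)
        finally show ?thesis .
      qed
      ultimately show ?thesis unfolding Q_def[symmetric] using power_mono[of "norm (a j m)" I 2] by simp
    qed
    have sum_a: "(\<Sum>m\<in>index_box ?N (- {j}). (norm (a j m))\<^sup>2) \<le> V * (LINT x|M j. (norm (g j x))\<^sup>2)" for j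
    proof -
      have i2: "integrable (M j) (\<lambda>x. (norm (g j x))\<^sup>2 * ind j m x)" for m
        by (rule Bochner_Integration.integrable_bound[OF g2i]) (auto simp: ind_def indicator_def)
      have "(\<Sum>m\<in>index_box ?N (- {j}). (norm (a j m))\<^sup>2) \<le> (\<Sum>m\<in>index_box ?N (- {j}). V * (LINT x|M j. (norm (g j x))\<^sup>2 * ind j m x))"
        by (intro sum_mono a_le)
      also have "\<dots> = V * (LINT x|M j. (\<Sum>m\<in>index_box ?N (- {j}). (norm (g j x))\<^sup>2 * ind j m x))"
        by (subst Bochner_Integration.integral_sum) (auto intro: i2 simp: sum_distrib_left)
      also have "(LINT x|M j. (\<Sum>m\<in>index_box ?N (- {j}). (norm (g j x))\<^sup>2 * ind j m x)) = (LINT x|M j. (norm (g j x))\<^sup>2)"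
      proof (intro Bochner_Integration.integral_cong refl)
        fix x assume x: "x \<in> space (M j)"
        have "(\<Sum>m\<in>index_box ?N (- {j}). ind j m x) = (\<Sum>m\<in>index_box ?N (- {j}). if m = cell j x then 1 else 0)"
          using x by (intro sum.cong) (auto simp: ind_def)
        then show "(\<Sum>m\<in>index_box ?N (- {j}). (norm (g j x))\<^sup>2 * ind j m x) = (norm (g j x))\<^sup>2"
          using cell_box[OF x] by (simp flip: sum_distrib_left)
      qed
      finally show ?thesis .
    qed
    have "(\<Sum>\<xi>\<in>index_box ?N UNIV. \<Prod>j\<in>UNIV. norm (LINT x|M j. g j x * of_real (\<psi> j x) * e j \<xi> x) powr (2 * \<theta>))
      \<le> (step_const CARD('n) * K ^ CARD('n)) ^ n * (\<Prod>j\<in>UNIV. (\<Sum>m\<in>index_box ?N (- {j}). (norm (a j m))\<^sup>2) powr \<theta>)"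
      unfolding decomp by (rule discrete_restriction)
    also have "\<dots> \<le> (step_const CARD('n) * K ^ CARD('n)) ^ n * (\<Prod>j\<in>UNIV. (V * (LINT x|M j. (norm (g j x))\<^sup>2)) powr \<theta>)"
      using \<theta>_pos sum_a step_const_pos[of "CARD('n)"]
      by (intro mult_left_mono prod_mono conjI powr_mono2) (auto intro!: sum_nonneg)
    finally show "(\<Sum>\<xi>\<in>index_box ?N UNIV. \<Prod>j\<in>UNIV. norm (LINT x|M j. g j x * of_real (\<psi> j x) * e j \<xi> x) powr (2 * \<theta>))
      \<le> (step_const CARD('n) * K ^ CARD('n)) ^ n * (\<Prod>j\<in>UNIV. (V * (LINT x|M j. (norm (g j x))\<^sup>2)) powr \<theta>)" .
  qed (use \<theta>_pos gi in \<open>auto simp: e_def\<close>)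
  moreover have "e j \<xi> x * cis (\<Sum>k\<in>UNIV. u j \<xi> k * v j k x) = cis (2 * pi * (\<Sum>k\<in>UNIV. real (\<xi> k) * S j x k))" for j \<xi> x
  proof -
    have uv: "u j \<xi> k * v j k x = 2 * pi * (real (\<xi> k) * S j x k - real (\<xi> k) * surf n j (cell j x) k)" for k
      using K by (simp add: u_def v_def algebra_simps)
    show ?thesis unfolding e_def cis_mult uv sum_distrib_left[symmetric] by (simp add: sum_subtractf right_diff_distrib)
  qed
  ultimately show ?thesis by (simp add: mult.assoc)
qed

end

section \<open>Quantitative linear algebra\<close>

lemma abs_det_le:
  fixes A :: "real ^ 'n::finite ^ 'n" and a :: real
  assumes "\<And>i j. \<bar>A $ i $ j\<bar> \<le> a"
  shows "\<bar>det A\<bar> \<le> fact CARD('n) * a ^ CARD('n)"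
proof -
  have "\<bar>det A\<bar> \<le> (\<Sum>p\<in>{p. p permutes (UNIV::'n set)}. \<bar>of_int (sign p) * (\<Prod>i\<in>UNIV. A $ i $ p i)\<bar>)"
    unfolding det_def by (rule sum_abs)
  also have "\<dots> \<le> (\<Sum>p\<in>{p. p permutes (UNIV::'n set)}. a ^ CARD('n))"
  proof (rule sum_mono)
    fix p :: "'n \<Rightarrow> 'n"
    have "\<bar>of_int (sign p) * (\<Prod>i\<in>UNIV. A $ i $ p i)\<bar> = (\<Prod>i\<in>UNIV. \<bar>A $ i $ p i\<bar>)"
      by (simp add: abs_mult abs_prod sign_def)
    also have "\<dots> \<le> (\<Prod>i\<in>(UNIV::'n set). a)" by (intro prod_mono conjI assms) auto
    finally show "\<bar>of_int (sign p) * (\<Prod>i\<in>UNIV. A $ i $ p i)\<bar> \<le> a ^ CARD('n)" by simp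
  qed
  also have "\<dots> = fact CARD('n) * a ^ CARD('n)" by (simp add: card_permutations)
  finally show ?thesis .
qed

definition inv_const :: "nat \<Rightarrow> real \<Rightarrow> real \<Rightarrow> real" where
  "inv_const d a c = real d * (fact d * (a + 1) ^ d / c)"

text \<open>Cramer's rule bounds the inverse in terms of the entries and of a lower bound for the determinant.\<close>

lemma norm_le_inv_const:
  fixes A :: "real ^ 'n::finite ^ 'n" and a :: real
  assumes A: "\<And>i j. \<bar>A $ i $ j\<bar> \<le> a" and c: "0 < c" "c \<le> \<bar>det A\<bar>"
  shows "norm x \<le> inv_const CARD('n) a c * norm (A *v x)"
proof -
  have a0: "a \<ge> 0" using A[of undefined undefined] by linarith
  have d0: "det A \<noteq> 0" using c by auto
  have unit: "norm x \<le> inv_const CARD('n) a c" if b: "norm (A *v x) \<le> 1" for x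
  proof -
    have "\<bar>x $ k\<bar> \<le> fact CARD('n) * (a + 1) ^ CARD('n) / c" for k
    proof -
      define B where "B = (\<chi> i j. if j = k then (A *v x) $ i else A $ i $ j)"
      have "x = (\<chi> k. det (\<chi> i j. if j = k then (A *v x) $ i else A $ i $ j) / det A)"
        using cramer[OF d0, of x "A *v x"] by blast
      then have xk: "x $ k = det B / det A" unfolding B_def by (metis (no_types, lifting) vec_lambda_beta)
      have "\<bar>B $ i $ j\<bar> \<le> a + 1" for i j
        using A[of i j] a0 b component_le_norm_cart[of "A *v x" i] by (auto simp: B_def)
      then have "\<bar>det B\<bar> \<le> fact CARD('n) * (a + 1) ^ CARD('n)" by (rule abs_det_le)
      then have "\<bar>det B\<bar> / \<bar>det A\<bar> \<le> fact CARD('n) * (a + 1) ^ CARD('n) / c"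
        using c a0 by (intro frac_le) auto
      then show ?thesis by (simp add: xk abs_divide)
    qed
    then have "(\<Sum>k\<in>UNIV. \<bar>x $ k\<bar>) \<le> (\<Sum>k\<in>(UNIV::'n set). fact CARD('n) * (a + 1) ^ CARD('n) / c)"
      by (intro sum_mono)
    then show ?thesis using norm_le_l1_cart[of x] by (simp add: inv_const_def)
  qed
  show ?thesis
  proof (cases "A *v x = 0")
    case True
    then have "x = 0" using d0 by (metis invertible_det_nz invertible_def matrix_vector_mul_assoc matrix_vector_mul_lid matrix_vector_mult_0_right)
    then show ?thesis by simp
  next
    case False
    let ?t = "norm (A *v x)"
    have t: "?t > 0" using False by simp
    have "A *v ((1 / ?t) *\<^sub>R x) = (1 / ?t) *\<^sub>R (A *v x)"
      by (simp add: matrix_vector_mult_scaleR)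
    then have "norm ((1 / ?t) *\<^sub>R x) \<le> inv_const CARD('n) a c" using t by (intro unit) simp
    then show ?thesis using t by (simp add: field_simps)
  qed
qed

lemma norm_matrix_vector_le:
  fixes A :: "real ^ 'n::finite ^ 'm::finite" and a :: real
  assumes A: "\<And>i j. \<bar>A $ i $ j\<bar> \<le> a"
  shows "norm (A *v x) \<le> CARD('m) * (CARD('n) * a) * norm x"
proof -
  have "\<bar>(A *v x) $ i\<bar> \<le> CARD('n) * a * norm x" for i
  proof -
    have "\<bar>(A *v x) $ i\<bar> \<le> (\<Sum>j\<in>UNIV. \<bar>A $ i $ j * x $ j\<bar>)"
      unfolding matrix_vector_mult_def by (simp add: sum_abs)
    also have "\<dots> \<le> (\<Sum>j\<in>(UNIV::'n set). a * norm x)"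
      unfolding abs_mult using A component_le_norm_cart[of x] order_trans[OF abs_ge_zero A]
      by (intro sum_mono mult_mono) auto
    finally show ?thesis by simp
  qed
  then have "(\<Sum>i\<in>UNIV. \<bar>(A *v x) $ i\<bar>) \<le> (\<Sum>i\<in>(UNIV::'m set). CARD('n) * a * norm x)" by (intro sum_mono)
  then show ?thesis using norm_le_l1_cart[of "A *v x"] by (simp add: mult_ac)
qed

text \<open>The derivative of \<open>F\<close> at \<open>x0\<close>, written with partial derivatives.\<close>

definition frame_deriv :: "(real ^ 'm::finite \<Rightarrow> real ^ 'm option) \<Rightarrow> real ^ 'm \<Rightarrow> real ^ 'm \<Rightarrow> real ^ 'm option" where
  "frame_deriv F x0 x = (\<Sum>k\<in>UNIV. x $ k *\<^sub>R pderiv_at k F x0)"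

definition extend0 :: "real ^ 'm::finite \<Rightarrow> real ^ 'm option" where
  "extend0 x = (\<chi> c. case c of Some k \<Rightarrow> x $ k | None \<Rightarrow> 0)"

lemma sum_UNIV_option: "(\<Sum>c\<in>(UNIV::'m::finite option set). f c) = f None + (\<Sum>k\<in>UNIV. f (Some k))"
  by (simp add: UNIV_option_conv sum.reindex)

lemma norm_extend0: "norm (extend0 x) = norm x"
  by (simp add: norm_vec_def L2_set_def extend0_def sum_UNIV_option)

lemma tangent_frame_extend0: "tangent_frame_with F x0 v *v extend0 x = frame_deriv F x0 x"
  by (simp add: vec_eq_iff matrix_vector_mult_def sum_UNIV_option tangent_frame_with_def extend0_def
      frame_deriv_def mult.commute)

lemma wedge_field_inner_pderiv: "wedge_field F x \<bullet> pderiv_at k F x = 0"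
proof -
  have "det (tangent_frame_with F x (pderiv_at k F x)) = 0"
    by (rule det_identical_columns[of None "Some k"])
       (auto simp: column_def tangent_frame_with_def)
  then show ?thesis by (simp add: wedge_field_inner)
qed

definition frame_normals :: "('m option \<Rightarrow> real ^ 'm::finite \<Rightarrow> real ^ 'm option) \<Rightarrow> ('m option \<Rightarrow> real ^ 'm) \<Rightarrow> real ^ 'm option ^ 'm option" where
  "frame_normals F x = (\<chi> i j. wedge_field (F j) (x j) $ i)"

text \<open>
  If the frequency is expressed in the basis of the normals \<open>Y\<^sub>j\<close>, then the derivative of the \<open>j\<close>-th surface
  is multiplied by the transpose of the matrix of normals. Its \<open>j\<close>-th coordinate becomes the inner
  product of \<open>Y\<^sub>j\<close> with a tangent vector and vanishes, so that the \<open>j\<close>-th tangent space is the \<open>j\<close>-th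
  coordinate hyperplane.
\<close>

definition straight_deriv :: "('m option \<Rightarrow> real ^ 'm::finite \<Rightarrow> real ^ 'm option) \<Rightarrow> ('m option \<Rightarrow> real ^ 'm) \<Rightarrow> 'm option \<Rightarrow> real ^ 'm \<Rightarrow> real ^ 'm option" where
  "straight_deriv F x0 j x = transpose (frame_normals F x0) *v frame_deriv (F j) (x0 j) x"

definition straightened :: "real \<Rightarrow> ('m option \<Rightarrow> real ^ 'm::finite \<Rightarrow> real ^ 'm option) \<Rightarrow> ('m option \<Rightarrow> real ^ 'm) \<Rightarrow> bool" where
  "straightened C F x0 \<longleftrightarrow>
     (\<forall>z. norm (frame_normals F x0 *v z) \<le> C * norm z) \<and>
     (\<forall>y. \<exists>z. frame_normals F x0 *v z = y \<and> norm z \<le> C * norm y) \<and>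
     (\<forall>y. norm (transpose (frame_normals F x0) *v y) \<le> C * norm y) \<and>
     (\<forall>j x. straight_deriv F x0 j x $ j = 0) \<and>
     (\<forall>j x. norm x \<le> C * norm (straight_deriv F x0 j x)) \<and>
     (\<forall>j x. norm (straight_deriv F x0 j x) \<le> C * norm x) \<and>
     (\<forall>j. \<exists>B. linear B \<and> (\<forall>u. u $ j = 0 \<longrightarrow> straight_deriv F x0 j (B u) = u))"

text \<open>
  All changes of variables are controlled by \<open>A\<close> and \<open>\<nu>\<close> alone. The lower bound \<open>\<nu>\<close> for the determinant of the
  normals bounds the inverse of their matrix, and hence \<open>|Y\<^sub>j|\<close> from below. The matrix whose columns are
  the tangent vectors of the \<open>j\<close>-th surface and \<open>Y\<^sub>j\<close> has determinant \<open>|Y\<^sub>j|\<^sup>2\<close>, which bounds the inverse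
  of the derivative on the tangent space.
\<close>

lemma straightening:
  fixes A \<nu> :: real
  assumes A: "A > 0" and \<nu>: "\<nu> > 0"
  shows "\<exists>C\<ge>1. \<forall>(F :: 'm option \<Rightarrow> real ^ 'm::finite \<Rightarrow> real ^ 'm option) x0.
     (\<forall>j k. norm (pderiv_at k (F j) (x0 j)) \<le> A) \<longrightarrow> wedge_det F x0 \<ge> \<nu> \<longrightarrow> straightened C F x0"
proof -
  let ?d = "CARD('m option)"
  define a1 where "a1 = fact ?d * (A + 1) ^ ?d"
  define c1 where "c1 = inv_const ?d a1 \<nu>"
  define a2 where "a2 = A + a1"
  define a3 where "a3 = real ?d * (a1 * a2)"
  define c2 where "c2 = \<nu> / c1\<^sup>2"
  define c3 where "c3 = inv_const ?d a3 c2"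
  define C where "C = 1 + c1 + c3 + real ?d * (real ?d * a1) + real ?d * (real ?d * a3)"
  have a1: "a1 > 0" using A by (simp add: a1_def)
  have c1: "c1 > 0" using a1 \<nu> by (simp add: c1_def inv_const_def)
  have a2: "a2 > 0" using A a1 by (simp add: a2_def)
  have a3: "a3 > 0" using a1 a2 by (simp add: a3_def)
  have c2: "c2 > 0" using \<nu> c1 by (simp add: c2_def)
  have c3: "c3 > 0" using a3 c2 by (simp add: c3_def inv_const_def)
  have C_ge: "C \<ge> 1" "C \<ge> c1" "C \<ge> c3" "C \<ge> real ?d * (real ?d * a1)" "C \<ge> real ?d * (real ?d * a3)"
    using a1 c1 c3 a3 by (simp_all add: C_def)
  show ?thesis
    unfolding straightened_def
  proof (intro exI[of _ C] conjI C_ge(1) allI impI)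
    fix F :: "'m option \<Rightarrow> real ^ 'm \<Rightarrow> real ^ 'm option" and x0
    assume pd: "\<forall>j k. norm (pderiv_at k (F j) (x0 j)) \<le> A" and wd: "wedge_det F x0 \<ge> \<nu>"
    let ?N = "frame_normals F x0"
    let ?D = "straight_deriv F x0"
    define Y where "Y j = wedge_field (F j) (x0 j)" for j
    have Y_le: "\<bar>Y j $ i\<bar> \<le> a1" for j i
      unfolding Y_def wedge_field_def a1_def vec_lambda_beta
    proof (rule abs_det_le)
      fix i' c
      have "\<bar>pderiv_at k (F j) (x0 j) $ i'\<bar> \<le> A + 1" for k
        using pd component_le_norm_cart[of "pderiv_at k (F j) (x0 j)" i'] by (smt (verit))
      then show "\<bar>tangent_frame_with (F j) (x0 j) (axis i 1) $ i' $ c\<bar> \<le> A + 1"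
        using A by (auto simp: tangent_frame_with_def axis_def split: option.split intro: order_trans)
    qed
    have N_le: "\<bar>?N $ i $ j\<bar> \<le> a1" for i j
      using Y_le by (simp add: frame_normals_def Y_def)
    have N_le': "\<bar>transpose ?N $ i $ j\<bar> \<le> a1" for i j
      using N_le by (simp add: transpose_def)
    have detN: "\<nu> \<le> \<bar>det ?N\<bar>" using wd by (simp add: wedge_det_def frame_normals_def)
    have N_low: "norm z \<le> c1 * norm (?N *v z)" for z
      unfolding c1_def by (rule norm_le_inv_const[OF N_le \<nu> detN])
    have Y_low: "1 \<le> c1 * norm (Y j)" for j
    proof -
      have "?N *v axis j 1 = Y j"
        by (simp add: vec_eq_iff matrix_vector_mult_basis column_def frame_normals_def Y_def)
      then show ?thesis using N_low[of "axis j 1"] by (simp add: norm_axis_1)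
    qed
    define W where "W j = transpose ?N ** tangent_frame_with (F j) (x0 j) (Y j)" for j
    have frame_le: "\<bar>tangent_frame_with (F j) (x0 j) (Y j) $ i $ c\<bar> \<le> a2" for j i c
    proof -
      have "\<bar>pderiv_at k (F j) (x0 j) $ i\<bar> \<le> a2" for k
        using pd component_le_norm_cart[of "pderiv_at k (F j) (x0 j)" i] a1 unfolding a2_def by (smt (verit))
      then show ?thesis using Y_le[of j i] A a1
        by (auto simp: tangent_frame_with_def a2_def split: option.split intro: order_trans)
    qed
    have W_le: "\<bar>W j $ i $ c\<bar> \<le> a3" for j i c
    proof -
      have "\<bar>W j $ i $ c\<bar> \<le> (\<Sum>l\<in>UNIV. \<bar>transpose ?N $ i $ l * tangent_frame_with (F j) (x0 j) (Y j) $ l $ c\<bar>)"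
        unfolding W_def matrix_matrix_mult_def by (simp add: sum_abs)
      also have "\<dots> \<le> (\<Sum>l\<in>(UNIV::'m option set). a1 * a2)"
        unfolding abs_mult using N_le' frame_le a1 by (intro sum_mono mult_mono) auto
      finally show ?thesis by (simp add: a3_def)
    qed
    have detW: "c2 \<le> \<bar>det (W j)\<bar>" for j
    proof -
      have "det (W j) = det ?N * (Y j \<bullet> Y j)"
        unfolding W_def det_mul det_transpose using wedge_field_inner[of "F j" "x0 j" "Y j"] by (simp add: Y_def)
      then have "\<bar>det (W j)\<bar> = \<bar>det ?N\<bar> * (norm (Y j))\<^sup>2" by (simp add: abs_mult dot_square_norm)
      moreover have "\<nu> * (1 / c1)\<^sup>2 \<le> \<bar>det ?N\<bar> * (norm (Y j))\<^sup>2"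
        using detN Y_low[of j] c1 \<nu> by (intro mult_mono power_mono) (auto simp: field_simps)
      ultimately show ?thesis by (simp add: c2_def power_divide)
    qed
    have W_low: "norm z \<le> c3 * norm (W j *v z)" for z j
      unfolding c3_def by (rule norm_le_inv_const[OF W_le c2 detW])
    have D_W: "?D j x = W j *v extend0 x" for j x
      unfolding straight_deriv_def W_def matrix_vector_mul_assoc[symmetric] tangent_frame_extend0 ..
    have D_j: "?D j x $ j = 0" for j x
    proof -
      have "?D j x $ j = Y j \<bullet> frame_deriv (F j) (x0 j) x"
        by (simp add: straight_deriv_def matrix_vector_mult_def transpose_def frame_normals_def Y_def inner_vec_def)
      also have "\<dots> = 0" by (simp add: frame_deriv_def inner_sum_right Y_def wedge_field_inner_pderiv)
      finally show ?thesis .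
    qed
    show "norm (?N *v z) \<le> C * norm z" for z
      using norm_matrix_vector_le[of ?N a1 z] N_le C_ge(4) by (meson mult_right_mono norm_ge_zero order_trans)
    show "\<exists>z. ?N *v z = y \<and> norm z \<le> C * norm y" for y
    proof -
      have "det ?N \<noteq> 0" using detN \<nu> by auto
      then obtain N' where N': "?N ** N' = mat 1" using invertible_det_nz invertible_def by metis
      have "?N *v (N' *v y) = y" by (simp add: matrix_vector_mul_assoc N')
      moreover have "norm (N' *v y) \<le> C * norm y"
        using N_low[of "N' *v y"] C_ge(2) calculation by (metis mult_right_mono norm_ge_zero order_trans)
      ultimately show ?thesis by blast
    qed
    show "norm (transpose ?N *v y) \<le> C * norm y" for y
      using norm_matrix_vector_le[of "transpose ?N" a1 y] N_le' C_ge(4) by (meson mult_right_mono norm_ge_zero order_trans)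
    show "?D j x $ j = 0" for j x by (rule D_j)
    show "norm x \<le> C * norm (?D j x)" for j x
      using W_low[of "extend0 x" j] C_ge(3) unfolding norm_extend0 D_W[symmetric] by (meson mult_right_mono norm_ge_zero order_trans)
    show "norm (?D j x) \<le> C * norm x" for j x
      using norm_matrix_vector_le[of "W j" a3 "extend0 x"] W_le C_ge(5) unfolding norm_extend0 D_W[symmetric]
      by (meson mult_right_mono norm_ge_zero order_trans)
    show "\<exists>B. linear B \<and> (\<forall>u. u $ j = 0 \<longrightarrow> ?D j (B u) = u)" for j
    proof -
      have "det (W j) \<noteq> 0" using detW[of j] c2 by auto
      then obtain W' where W': "W j ** W' = mat 1" using invertible_det_nz invertible_def by metis
      define B where "B u = (\<chi> k. (W' *v u) $ Some k)" for u
      have "linear B"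
        unfolding B_def by (rule linearI) (simp_all add: vec_eq_iff matrix_vector_right_distrib matrix_vector_mult_scaleR)
      moreover have "?D j (B u) = u" if u: "u $ j = 0" for u
      proof -
        define z where "z = W' *v u"
        have Wz: "W j *v z = u" by (simp add: z_def matrix_vector_mul_assoc W')
        have z: "z = extend0 (B u) + z $ None *\<^sub>R axis None 1"
          by (auto simp: vec_eq_iff extend0_def B_def z_def axis_def split: option.split)
        have frN: "tangent_frame_with (F j) (x0 j) (Y j) *v axis None 1 = Y j"
          by (simp add: vec_eq_iff matrix_vector_mult_basis column_def tangent_frame_with_def)
        have WN: "W j *v axis None 1 = transpose ?N *v Y j"
          unfolding W_def matrix_vector_mul_assoc[symmetric] frN ..
        have "W j *v z = ?D j (B u) + z $ None *\<^sub>R (transpose ?N *v Y j)"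
          by (subst z) (simp add: matrix_vector_right_distrib matrix_vector_mult_scaleR D_W WN)
        then have eq: "u = ?D j (B u) + z $ None *\<^sub>R (transpose ?N *v Y j)" using Wz by simp
        have "(transpose ?N *v Y j) $ j = Y j \<bullet> Y j"
          by (simp add: matrix_vector_mult_def transpose_def frame_normals_def Y_def inner_vec_def)
        moreover have "u $ j = ?D j (B u) $ j + z $ None * (transpose ?N *v Y j) $ j"
          by (subst eq) simp
        ultimately have "z $ None * (Y j \<bullet> Y j) = 0" using u D_j by simp
        moreover have "Y j \<bullet> Y j \<noteq> 0" using Y_low[of j] by auto
        ultimately have "z $ None = 0" by simp
        then show ?thesis using eq by simp
      qed
      ultimately show ?thesis by blast
    qed
  qed
qed

section \<open>Small pieces of hypersurfaces\<close>

abbreviation osc_int :: "(real ^ 'm::finite) set \<Rightarrow> (real ^ 'm \<Rightarrow> complex) \<Rightarrow> (real ^ 'm \<Rightarrow> 'b::euclidean_space) \<Rightarrow> 'b \<Rightarrow> complex" where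
  "osc_int T g F \<xi> \<equiv> (LINT x|lebesgue_on T. g x * cis (\<xi> \<bullet> F x))"

abbreviation L2_mass :: "(real ^ 'm::finite) set \<Rightarrow> (real ^ 'm \<Rightarrow> complex) \<Rightarrow> real" where
  "L2_mass T g \<equiv> (LINT x|lebesgue_on T. (norm (g x))\<^sup>2)"

text \<open>All that the argument uses of a bound in \<open>C\<^sup>2\<close> is that the first derivatives are bounded and Lipschitz.\<close>

definition C11_bounded :: "real \<Rightarrow> (real ^ 'm::finite \<Rightarrow> 'b::real_normed_vector) \<Rightarrow> bool" where
  "C11_bounded A F \<longleftrightarrow> (\<forall>x. F differentiable at x) \<and> (\<forall>k x. norm (pderiv_at k F x) \<le> A) \<and>
     (\<forall>k x y. norm (pderiv_at k F x - pderiv_at k F y) \<le> A * norm (x - y))"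

lemma frechet_derivative_eq_sum:
  fixes F :: "real ^ 'm::finite \<Rightarrow> 'b::real_normed_vector"
  assumes "F differentiable at x"
  shows "frechet_derivative F (at x) h = (\<Sum>k\<in>UNIV. h $ k *\<^sub>R pderiv_at k F x)"
proof -
  have lin: "linear (frechet_derivative F (at x))"
    using assms by (rule linear_frechet_derivative)
  have "h = (\<Sum>k\<in>UNIV. h $ k *\<^sub>R axis k 1)"
    using basis_expansion[of h] by (simp add: scalar_mult_eq_scaleR)
  then have "frechet_derivative F (at x) h = frechet_derivative F (at x) (\<Sum>k\<in>UNIV. h $ k *\<^sub>R axis k 1)" by simp
  also have "\<dots> = (\<Sum>k\<in>UNIV. h $ k *\<^sub>R pderiv_at k F x)"
    using lin by (simp add: linear_sum linear_scale pderiv_at_def)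
  finally show ?thesis .
qed

lemma has_derivative_sum_pderiv:
  fixes F :: "real ^ 'm::finite \<Rightarrow> 'b::real_normed_vector"
  assumes "F differentiable at x"
  shows "(F has_derivative (\<lambda>h. \<Sum>k\<in>UNIV. h $ k *\<^sub>R pderiv_at k F x)) (at x)"
  using assms frechet_derivative_eq_sum[OF assms] by (metis (no_types, lifting) ext frechet_derivative_works)

lemma norm_sum_components_le:
  fixes c :: "'m::finite \<Rightarrow> 'b::real_normed_vector" and b :: real
  assumes "\<And>k. norm (c k) \<le> b"
  shows "norm (\<Sum>k\<in>UNIV. h $ k *\<^sub>R c k) \<le> CARD('m) * b * norm (h :: real ^ 'm)"
proof -
  have "norm (\<Sum>k\<in>UNIV. h $ k *\<^sub>R c k) \<le> (\<Sum>k\<in>(UNIV::'m set). norm h * b)"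
    using assms component_le_norm_cart[of h] by (intro sum_norm_le) (auto intro!: mult_mono)
  then show ?thesis by (simp add: mult_ac)
qed

text \<open>On a ball of radius \<open>\<kappa>\<close> the derivative of the remainder is at most \<open>O(A \<kappa>)\<close>, hence so is its Lipschitz constant.\<close>

lemma remainder_lipschitz:
  fixes F :: "real ^ 'm::finite \<Rightarrow> real ^ 'm option" and A \<kappa> :: real
  assumes F: "C11_bounded A F" and A: "A > 0"
    and x: "x \<in> cball x0 \<kappa>" and y: "y \<in> cball x0 \<kappa>"
  defines "q \<equiv> \<lambda>x. F x - F x0 - frame_deriv F x0 (x - x0)"
  shows "norm (q x - q y) \<le> CARD('m) * (A * \<kappa>) * norm (x - y)"
proof -
  have dF: "F differentiable at z" for z using F by (simp add: C11_bounded_def)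
  have "norm (q x - q y) \<le> (CARD('m) * (A * \<kappa>)) * norm (x - y)"
  proof (rule differentiable_bound[of "cball x0 \<kappa>" q "\<lambda>z h. \<Sum>k\<in>UNIV. h $ k *\<^sub>R (pderiv_at k F z - pderiv_at k F x0)"])
    fix z assume z: "z \<in> cball x0 \<kappa>"
    have lin: "bounded_linear (\<lambda>h. \<Sum>k\<in>UNIV. h $ k *\<^sub>R pderiv_at k F x0)"
      by (intro bounded_linear_sum bounded_linear_scaleR_left[THEN bounded_linear_compose] bounded_linear_vec_nth)
    have "((\<lambda>x. frame_deriv F x0 (x - x0)) has_derivative (\<lambda>h. \<Sum>k\<in>UNIV. h $ k *\<^sub>R pderiv_at k F x0)) (at z within cball x0 \<kappa>)"
      unfolding frame_deriv_def
      by (rule has_derivative_compose[of "\<lambda>x. x - x0" "\<lambda>h. h" _ _ "\<lambda>x. \<Sum>k\<in>UNIV. x $ k *\<^sub>R pderiv_at k F x0", OF _ bounded_linear_imp_has_derivative[OF lin]])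
         (auto intro!: derivative_eq_intros)
    moreover have "(F has_derivative (\<lambda>h. \<Sum>k\<in>UNIV. h $ k *\<^sub>R pderiv_at k F z)) (at z within cball x0 \<kappa>)"
      by (rule has_derivative_at_withinI[OF has_derivative_sum_pderiv[OF dF]])
    ultimately show "(q has_derivative (\<lambda>h. \<Sum>k\<in>UNIV. h $ k *\<^sub>R (pderiv_at k F z - pderiv_at k F x0))) (at z within cball x0 \<kappa>)"
      unfolding q_def by (auto intro!: derivative_eq_intros simp: scaleR_diff_right sum_subtractf)
    have "norm (pderiv_at k F z - pderiv_at k F x0) \<le> A * \<kappa>" for k
    proof -
      have "norm (pderiv_at k F z - pderiv_at k F x0) \<le> A * norm (z - x0)" using F by (simp add: C11_bounded_def)
      also have "\<dots> \<le> A * \<kappa>" using z A by (intro mult_left_mono) (auto simp: dist_norm norm_minus_commute)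
      finally show ?thesis .
    qed
    then show "onorm (\<lambda>h. \<Sum>k\<in>UNIV. h $ k *\<^sub>R (pderiv_at k F z - pderiv_at k F x0)) \<le> CARD('m) * (A * \<kappa>)"
      by (intro onorm_le norm_sum_components_le)
  qed (use x y in auto)
  then show ?thesis .
qed

lemma C11_bounded_continuous:
  assumes "C11_bounded A F" shows "continuous_on S F"
  using assms unfolding C11_bounded_def continuous_on_eq_continuous_within
  by (metis continuous_at_imp_continuous_at_within differentiable_imp_continuous_within)

lemma inner_matrix_vector_transpose:
  fixes N :: "real ^ 'n::finite ^ 'n"
  shows "(N *v z) \<bullet> y = z \<bullet> (transpose N *v y)"
  by (metis dot_lmul_matrix vector_transpose_matrix)

lemma linear_straight_deriv: "linear (straight_deriv F x0 j)"
  unfolding straight_deriv_def frame_deriv_def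
  by (rule linearI) (simp_all del: transpose_matrix_vector add: scaleR_add_left sum.distrib matrix_vector_right_distrib
      matrix_vector_mult_scaleR[symmetric] scaleR_sum_right)

text \<open>
  Pieces of diameter \<open>\<kappa>\<close> are magnified by \<open>1 / \<rho>\<close> in the parameter space, and the frequencies are taken from
  a lattice of mesh proportional to \<open>1 / \<rho>\<close> spanned by the normals. In these coordinates the \<open>j\<close>-th piece
  is \<open>u + r j u\<close> with \<open>u $ j = 0\<close>, where the Lipschitz constant of \<open>r j\<close> is \<open>O(\<rho>)\<close>.
\<close>

theorem piece_estimate:
  fixes A \<nu> :: real and K :: nat
  assumes A: "A > 0" and \<nu>: "\<nu> > 0" and K: "K > 0"
  defines "\<theta> \<equiv> lw_exponent CARD('m::finite option)"
  shows "\<exists>\<rho>>0. \<exists>\<kappa>>0. \<exists>C>0. \<forall>(F :: 'm option \<Rightarrow> real ^ 'm \<Rightarrow> real ^ 'm option) x0 \<tau> g G n.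
     (\<forall>j. C11_bounded A (F j)) \<longrightarrow> wedge_det F x0 \<ge> \<nu> \<longrightarrow>
     (\<forall>j. \<tau> j \<in> sets lebesgue \<and> \<tau> j \<subseteq> ball (x0 j) \<kappa>) \<longrightarrow>
     (\<forall>j. g j \<in> borel_measurable (lebesgue_on (\<tau> j)) \<and> (\<forall>x. norm (g j x) \<le> G)) \<longrightarrow>
     (\<Sum>\<xi>\<in>index_box (K ^ n) UNIV. \<Prod>j\<in>UNIV. norm (osc_int (\<tau> j) (g j) (F j) ((2 * pi / \<rho>) *\<^sub>R (frame_normals F x0 *v (\<chi> k. real (\<xi> k))))) powr (2 * \<theta>))
     \<le> C * step_const CARD('m option) ^ n * (\<Prod>j\<in>UNIV. (L2_mass (\<tau> j) (g j)) powr \<theta>)"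
proof -
  let ?d = "CARD('m option)"
  obtain C0 where C0: "C0 \<ge> 1" and str: "\<And>(F :: 'm option \<Rightarrow> real ^ 'm \<Rightarrow> real ^ 'm option) x0.
     (\<forall>j k. norm (pderiv_at k (F j) (x0 j)) \<le> A) \<Longrightarrow> wedge_det F x0 \<ge> \<nu> \<Longrightarrow> straightened C0 F x0"
    using straightening[OF A \<nu>, where 'm = 'm] by blast
  define m where "m = CARD('m)"
  have d_m: "?d = Suc m" and m0: "m > 0" by (simp_all add: m_def)
  \<comment> \<open>chosen to make the Lipschitz constant of the magnified remainder at most \<open>1 / K\<close>\<close>
  define \<rho> where "\<rho> = 1 / (C0 * (real m * (A * (C0 * ?d))) * (C0 * ?d) * K)"
  have \<rho>: "\<rho> > 0" using C0 A K m0 by (simp add: \<rho>_def)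
  \<comment> \<open>small enough for the magnified piece to fit between \<open>1/4\<close> and \<open>3/4\<close> in every coordinate\<close>
  define \<kappa> where "\<kappa> = \<rho> / (4 * C0)"
  have \<kappa>: "\<kappa> > 0" using \<rho> C0 by (simp add: \<kappa>_def)
  define V0 where "V0 = (4 * (C0 * \<rho> * ?d)) ^ m"
  have V0: "V0 > 0" using C0 \<rho> by (simp add: V0_def)
  define C where "C = phase_const ?d ?d (4 * pi) (2 * \<theta>) * (V0 powr \<theta>) ^ ?d"
  have C: "C > 0" using V0 by (simp add: C_def phase_const_pos)
  have \<theta>m: "real m * \<theta> = 1" unfolding \<theta>_def lw_exponent_def d_m using m0 by simp
  show ?thesis
  proof (rule exI[of _ \<rho>], rule conjI[OF \<rho>], rule exI[of _ \<kappa>], rule conjI[OF \<kappa>],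
      rule exI[of _ C], rule conjI[OF C], intro allI impI)
    fix F :: "'m option \<Rightarrow> real ^ 'm \<Rightarrow> real ^ 'm option" and x0 \<tau> and g :: "'m option \<Rightarrow> real ^ 'm \<Rightarrow> complex" and G n
    assume F: "\<forall>j. C11_bounded A (F j)" and wd: "wedge_det F x0 \<ge> \<nu>"
      and \<tau>: "\<forall>j. \<tau> j \<in> sets lebesgue \<and> \<tau> j \<subseteq> ball (x0 j) \<kappa>"
      and g: "\<forall>j. g j \<in> borel_measurable (lebesgue_on (\<tau> j)) \<and> (\<forall>x. norm (g j x) \<le> G)"
    let ?N = "frame_normals F x0"
    define D where "D = straight_deriv F x0"
    have "\<forall>j k. norm (pderiv_at k (F j) (x0 j)) \<le> A" using F by (simp add: C11_bounded_def)
    note st = str[OF this wd, unfolded straightened_def, folded D_def]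
    have Nt: "norm (transpose ?N *v y) \<le> C0 * norm y" for y using st by blast
    have D_j: "D j x $ j = 0" for j x using st by blast
    have D_low: "norm x \<le> C0 * norm (D j x)" for j x using st by blast
    have D_up: "norm (D j x) \<le> C0 * norm x" for j x using st by blast
    have linD: "linear (D j)" for j unfolding D_def by (rule linear_straight_deriv)
    obtain B where linB: "\<And>j. linear (B j)" and DB: "\<And>j u. u $ j = 0 \<Longrightarrow> D j (B j u) = u"
      using st by metis
    have B_le: "norm (B j u) \<le> C0 * norm u" if "u $ j = 0" for j u
      using D_low[of "B j u" j] DB[OF that] by simp
    \<comment> \<open>moves the base point to the centre of the face \<open>u $ j = 0\<close> of the unit cube\<close>
    define h :: "'m option \<Rightarrow> real ^ 'm option" where "h j = (\<chi> k. if k = j then 0 else 1 / 2)" for j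
    define q where "q j x = F j x - F j (x0 j) - frame_deriv (F j) (x0 j) (x - x0 j)" for j x
    define r where "r j u k = ((1 / \<rho>) *\<^sub>R (transpose ?N *v q j (x0 j + \<rho> *\<^sub>R B j ((\<chi> l. u l) - h j)))) $ k"
      for j and u :: "'m option \<Rightarrow> real" and k
    interpret near_coordinate_hyperplanes r K \<theta>
    proof unfold_locales
      show "2 \<le> CARD('m option)" unfolding d_m using m0 by simp
      show "0 < K" by (rule K)
      show "\<theta> \<equiv> lw_exponent CARD('m option)" by (simp add: \<theta>_def)
      fix j and x y :: "'m option \<Rightarrow> real" and \<beta> :: real and k
      assume x: "\<And>l. 0 \<le> x l \<and> x l \<le> 1" and y: "\<And>l. 0 \<le> y l \<and> y l \<le> 1"
        and xj: "x j = 0" and yj: "y j = 0" and xy: "\<And>l. \<bar>x l - y l\<bar> \<le> \<beta>"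
      define z where "z u = x0 j + \<rho> *\<^sub>R B j ((\<chi> l. u l) - h j)" for u
      have z_ball: "z u \<in> cball (x0 j) (\<rho> * (C0 * ?d))" if u: "\<And>l. 0 \<le> u l \<and> u l \<le> 1" and uj: "u j = 0" for u
      proof -
        have "norm ((\<chi> l. u l) - h j) \<le> (\<Sum>l\<in>UNIV. \<bar>((\<chi> l. u l) - h j) $ l\<bar>)" by (rule norm_le_l1_cart)
        also have "\<dots> \<le> (\<Sum>l\<in>(UNIV :: 'm option set). 1)"
        proof (rule sum_mono)
          show "\<bar>((\<chi> l. u l) - h j) $ l\<bar> \<le> 1" for l using u[of l] by (auto simp: h_def)
        qed
        finally have "norm ((\<chi> l. u l) - h j) \<le> ?d" by simp
        then have "C0 * norm ((\<chi> l. u l) - h j) \<le> C0 * ?d" using C0 by (intro mult_left_mono) auto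
        moreover have "norm (B j ((\<chi> l. u l) - h j)) \<le> C0 * norm ((\<chi> l. u l) - h j)"
          by (rule B_le) (simp add: uj h_def)
        ultimately have "norm (B j ((\<chi> l. u l) - h j)) \<le> C0 * ?d" by linarith
        then have "\<rho> * norm (B j ((\<chi> l. u l) - h j)) \<le> \<rho> * (C0 * ?d)"
          using \<rho> by (intro mult_left_mono) auto
        then show ?thesis using \<rho> unfolding z_def mem_cball dist_norm by simp
      qed
      have zx: "z x \<in> cball (x0 j) (\<rho> * (C0 * ?d))" by (rule z_ball) (use x xj in auto)
      have zy: "z y \<in> cball (x0 j) (\<rho> * (C0 * ?d))" by (rule z_ball) (use y yj in auto)
      have dz: "norm (z x - z y) \<le> \<rho> * (C0 * (?d * \<beta>))"
      proof -
        have "z x - z y = \<rho> *\<^sub>R B j ((\<chi> l. x l) - (\<chi> l. y l))"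
          unfolding z_def by (simp add: linear_diff[OF linB] scaleR_diff_right)
        moreover have "norm ((\<chi> l. x l) - (\<chi> l. y l) :: real ^ 'm option) \<le> ?d * \<beta>"
        proof -
          have "norm ((\<chi> l. x l) - (\<chi> l. y l) :: real ^ 'm option) \<le> (\<Sum>l\<in>UNIV. \<bar>((\<chi> l. x l) - (\<chi> l. y l) :: real ^ 'm option) $ l\<bar>)"
            by (rule norm_le_l1_cart)
          also have "\<dots> \<le> (\<Sum>l\<in>(UNIV :: 'm option set). \<beta>)" using xy by (intro sum_mono) simp
          finally show ?thesis by simp
        qed
        moreover have "norm (B j ((\<chi> l. x l) - (\<chi> l. y l))) \<le> C0 * norm ((\<chi> l. x l) - (\<chi> l. y l) :: real ^ 'm option)"
          by (rule B_le) (simp add: xj yj)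
        moreover have "\<rho> * norm (B j ((\<chi> l. x l) - (\<chi> l. y l))) \<le> \<rho> * (C0 * (?d * \<beta>))"
          using \<rho> C0 calculation(2,3) by (intro mult_left_mono order_trans[OF calculation(3)]) auto
        ultimately show ?thesis using \<rho> by simp
      qed
      have "norm (q j (z x) - q j (z y)) \<le> real m * (A * (\<rho> * (C0 * ?d))) * norm (z x - z y)"
        unfolding q_def m_def by (rule remainder_lipschitz[OF F[rule_format] A zx zy])
      also have "\<dots> \<le> real m * (A * (\<rho> * (C0 * ?d))) * (\<rho> * (C0 * (?d * \<beta>)))"
        using dz A \<rho> C0 by (intro mult_left_mono) auto
      finally have dq: "norm (q j (z x) - q j (z y)) \<le> real m * (A * (\<rho> * (C0 * ?d))) * (\<rho> * (C0 * (?d * \<beta>)))" .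
      have "\<bar>r j x k - r j y k\<bar> = \<bar>((1 / \<rho>) *\<^sub>R (transpose ?N *v (q j (z x) - q j (z y)))) $ k\<bar>"
        unfolding r_def z_def by (simp del: transpose_matrix_vector add: matrix_vector_mult_diff_distrib diff_divide_distrib)
      also have "\<dots> \<le> norm ((1 / \<rho>) *\<^sub>R (transpose ?N *v (q j (z x) - q j (z y))))" by (rule component_le_norm_cart)
      also have "\<dots> = (1 / \<rho>) * norm (transpose ?N *v (q j (z x) - q j (z y)))" using \<rho> by simp
      also have "\<dots> \<le> (1 / \<rho>) * (C0 * (real m * (A * (\<rho> * (C0 * ?d))) * (\<rho> * (C0 * (?d * \<beta>)))))"
        using \<rho> C0 dq by (intro mult_left_mono order_trans[OF Nt]) auto
      also have "\<dots> = \<beta> * (C0 * (real m * (A * (C0 * ?d))) * (C0 * ?d)) * \<rho>" using \<rho> by simp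
      also have "\<dots> = \<beta> / K" unfolding \<rho>_def using C0 A K m0 by simp
      finally show "\<bar>r j x k - r j y k\<bar> \<le> \<beta> / K" .
    qed
    define u where "u j x = (1 / \<rho>) *\<^sub>R D j (x - x0 j) + h j" for j x
    define cell where "cell j x = (\<lambda>k. nat \<lfloor>real (K ^ n) * u j x $ k\<rfloor>)" for j x
    define S where "S j x k = ((1 / \<rho>) *\<^sub>R (transpose ?N *v (F j x - F j (x0 j))) + h j) $ k" for j x k
    have N: "real (K ^ n) > 0" using K by simp
    have uj: "u j x $ j = 0" for j x by (simp add: u_def D_j h_def)
    have u_int: "1 / 4 \<le> u j x $ k \<and> u j x $ k \<le> 3 / 4" if "x \<in> \<tau> j" "k \<noteq> j" for j x k
    proof -
      have "norm (D j (x - x0 j)) \<le> C0 * norm (x - x0 j)" by (rule D_up)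
      also have "\<dots> \<le> C0 * \<kappa>" using \<tau> that C0 by (intro mult_left_mono) (auto simp: dist_norm norm_minus_commute subset_iff less_imp_le)
      also have "\<dots> = \<rho> / 4" using C0 by (simp add: \<kappa>_def)
      finally have "\<bar>D j (x - x0 j) $ k\<bar> \<le> \<rho> / 4" using component_le_norm_cart order_trans by blast
      then have "\<bar>D j (x - x0 j) $ k / \<rho>\<bar> \<le> 1 / 4" using \<rho> by (simp add: field_simps)
      moreover have "u j x $ k = D j (x - x0 j) $ k / \<rho> + 1 / 2" using that(2) by (simp add: u_def h_def)
      ultimately show ?thesis by linarith
    qed
    have u01: "0 \<le> u j x $ k \<and> u j x $ k \<le> 1" if "x \<in> \<tau> j" for j x k
      using u_int[OF that, of k] uj[of j x] by (cases "k = j") auto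
    have cell_box: "cell j x \<in> index_box (K ^ n) (- {j})" if "x \<in> \<tau> j" for j x
    proof -
      have "cell j x k < K ^ n" if "k \<noteq> j" for k
      proof -
        have "real (K ^ n) * u j x $ k < real (K ^ n) * 1"
          using u_int[OF \<open>x \<in> \<tau> j\<close> that] N by (intro mult_strict_left_mono) auto
        then have "\<lfloor>real (K ^ n) * u j x $ k\<rfloor> < int (K ^ n)" by (simp add: floor_less_iff)
        moreover have "K ^ n > 0" using K by simp
        moreover have "nat z < m" if "z < int m" "m > 0" for z m using that by arith
        ultimately show ?thesis unfolding cell_def by blast
      qed
      then show ?thesis by (auto simp: index_box_def cell_def uj)
    qed
    have cell_close: "\<bar>u j x $ k - grid_pt n (cell j x) k\<bar> \<le> 1 / K ^ n" if "x \<in> \<tau> j" for j x k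
    proof -
      define w where "w = real (K ^ n) * u j x $ k"
      have w0: "w \<ge> 0" using u01[OF that] N unfolding w_def by (intro mult_nonneg_nonneg) auto
      have "\<bar>w - real (nat \<lfloor>w\<rfloor>)\<bar> \<le> 1" using w0 by (simp add: of_nat_nat abs_le_iff) linarith
      then have "\<bar>w - real (nat \<lfloor>w\<rfloor>)\<bar> / K ^ n \<le> 1 / K ^ n" using N by (intro divide_right_mono) auto
      moreover have "\<bar>w - real (nat \<lfloor>w\<rfloor>)\<bar> / K ^ n = \<bar>(w - real (nat \<lfloor>w\<rfloor>)) / K ^ n\<bar>" by (simp add: abs_divide)
      moreover have "(w - real (nat \<lfloor>w\<rfloor>)) / K ^ n = u j x $ k - grid_pt n (cell j x) k"
        unfolding grid_pt_def cell_def w_def[symmetric] using K by (simp add: w_def field_simps)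
      ultimately show ?thesis by (simp only:)
    qed
    \<comment> \<open>the surface in the new coordinates is indeed of the form \<open>u + r j u\<close>\<close>
    have S_eq: "S j x k = u j x $ k + r j (\<lambda>l. u j x $ l) k" for j x k
    proof -
      define y where "y = \<rho> *\<^sub>R B j (u j x - h j)"
      have hj: "h j $ j = 0" by (simp add: h_def)
      have "D j (B j (u j x - h j)) = u j x - h j" by (rule DB) (simp add: uj hj)
      then have "D j y = D j (x - x0 j)"
        unfolding y_def linear_scale[OF linD] using \<rho> by (simp add: u_def)
      then have "D j (y - (x - x0 j)) = 0" by (simp add: linear_diff[OF linD])
      then have "y = x - x0 j" using D_low[of "y - (x - x0 j)" j] by simp
      then have pt: "x0 j + \<rho> *\<^sub>R B j ((\<chi> l. u j x $ l) - h j) = x" by (simp add: y_def)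
      have "transpose ?N *v q j x = transpose ?N *v (F j x - F j (x0 j)) - D j (x - x0 j)"
        unfolding q_def D_def straight_deriv_def by (simp del: transpose_matrix_vector add: matrix_vector_mult_diff_distrib)
      then show ?thesis unfolding S_def r_def pt
        by (simp del: transpose_matrix_vector add: u_def diff_divide_distrib)
    qed
    have S_close: "\<bar>S j x k - surf n j (cell j x) k\<bar> \<le> 2 / K ^ n" if x: "x \<in> \<tau> j" for j x k
    proof -
      have "\<bar>r j (\<lambda>l. u j x $ l) k - r j (grid_pt n (cell j x)) k\<bar> \<le> (1 / K ^ n) / K"
      proof (rule Lip)
        show "0 \<le> grid_pt n (cell j x) l \<and> grid_pt n (cell j x) l \<le> 1" for l by (rule grid_pt_01[OF cell_box[OF x]])
        show "grid_pt n (cell j x) j = 0" by (simp add: grid_pt_def cell_def uj)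
      qed (use u01[OF x] uj cell_close[OF x] in auto)
      also have "\<dots> \<le> (1 / K ^ n) / 1" using K N by (intro divide_left_mono) auto
      finally have "\<bar>r j (\<lambda>l. u j x $ l) k - r j (grid_pt n (cell j x)) k\<bar> \<le> 1 / K ^ n" by simp
      then show ?thesis using cell_close[OF x, of k] unfolding S_eq surf_def by linarith
    qed
    have contF: "continuous_on UNIV (F j)" for j using F C11_bounded_continuous by blast
    have contN: "continuous_on UNIV (\<lambda>x. transpose ?N *v (F j x - F j (x0 j)))" for j
      by (rule continuous_on_compose2[OF linear_continuous_on[OF matrix_vector_mul_bounded_linear]])
         (auto intro!: continuous_intros contF)
    have S_meas: "(\<lambda>x. S j x k) \<in> borel_measurable (lebesgue_on (\<tau> j))" for j k
    proof (rule continuous_imp_measurable_on_sets_lebesgue)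
      have "continuous_on UNIV (\<lambda>x. S j x k)" unfolding S_def
        by (intro continuous_intros contN)
      then show "continuous_on (\<tau> j) (\<lambda>x. S j x k)" using continuous_on_subset by blast
    qed (use \<tau> in auto)
    have u_meas: "(\<lambda>x. u j x $ k) \<in> borel_measurable (lebesgue_on (\<tau> j))" for j k
    proof (rule continuous_imp_measurable_on_sets_lebesgue)
      have "continuous_on UNIV (\<lambda>x. D j (x - x0 j))"
        by (rule continuous_on_compose2[OF linear_continuous_on[OF linear_conv_bounded_linear[THEN iffD1, OF linD]]])
           (auto intro!: continuous_intros)
      then have "continuous_on UNIV (\<lambda>x. u j x $ k)" unfolding u_def by (intro continuous_intros)
      then show "continuous_on (\<tau> j) (\<lambda>x. u j x $ k)" using continuous_on_subset by blast
    qed (use \<tau> in auto)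
    have cell_meas: "cell j \<in> lebesgue_on (\<tau> j) \<rightarrow>\<^sub>M count_space UNIV" for j
    proof -
      have "(\<lambda>x. cell j x k) \<in> lebesgue_on (\<tau> j) \<rightarrow>\<^sub>M count_space UNIV" for k
        unfolding cell_def using u_meas[of j k] by measurable
      then have "{x \<in> space (lebesgue_on (\<tau> j)). cell j x k = a k} \<in> sets (lebesgue_on (\<tau> j))" for a k
        by measurable
      then have "{x \<in> space (lebesgue_on (\<tau> j)). \<forall>k. cell j x k = a k} \<in> sets (lebesgue_on (\<tau> j))" for a
        using sets.sets_Collect_finite_All'[of UNIV "lebesgue_on (\<tau> j)" "\<lambda>k x. cell j x k = a k"] by auto
      moreover have "cell j -` {a} \<inter> space (lebesgue_on (\<tau> j)) = {x \<in> space (lebesgue_on (\<tau> j)). \<forall>k. cell j x k = a k}" for a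
        by (auto simp: fun_eq_iff)
      ultimately show ?thesis by (simp add: measurable_count_space_eq2_countable)
    qed
    have \<tau>_lm: "\<tau> j \<in> lmeasurable" for j
      using \<tau> bounded_subset[OF bounded_ball] by (blast intro: bounded_set_imp_lmeasurable)
    define V where "V = V0 / real (K ^ n) ^ m"
    have V: "measure (lebesgue_on (\<tau> j)) {x \<in> space (lebesgue_on (\<tau> j)). cell j x = c} \<le> V" for j c
    proof (cases "{x \<in> \<tau> j. cell j x = c} = {}")
      case True
      then have empty: "{x \<in> space (lebesgue_on (\<tau> j)). cell j x = c} = {}" by simp
      show ?thesis unfolding empty using V0 by (simp add: V_def)
    next
      case False
      then obtain x' where x': "x' \<in> \<tau> j" "cell j x' = c" by auto
      define t where "t = C0 * \<rho> * ?d / K ^ n"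
      have t0: "t \<ge> 0" using C0 \<rho> by (simp add: t_def)
      let ?Q = "cbox (x' - (\<chi> i. 2 * t)) (x' + (\<chi> i. 2 * t))"
      have close: "norm (x - x') \<le> 2 * t" if "x \<in> \<tau> j" "cell j x = c" for x
      proof -
        have "norm (x - x') \<le> C0 * norm (D j (x - x'))" by (rule D_low)
        also have "D j (x - x') = \<rho> *\<^sub>R (u j x - u j x')"
          using \<rho> by (simp add: u_def linear_diff[OF linD] flip: scaleR_diff_right)
        also have "norm (\<rho> *\<^sub>R (u j x - u j x')) \<le> \<rho> * (\<Sum>l\<in>UNIV. \<bar>(u j x - u j x') $ l\<bar>)"
          using \<rho> norm_le_l1_cart[of "u j x - u j x'"] by simp
        also have "\<dots> \<le> \<rho> * (\<Sum>l\<in>(UNIV :: 'm option set). 2 / K ^ n)"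
        proof (intro mult_left_mono sum_mono)
          show "\<bar>(u j x - u j x') $ l\<bar> \<le> 2 / K ^ n" for l
            using cell_close[OF that(1), of l] cell_close[OF x'(1), of l] unfolding that(2) x'(2) vector_minus_component
            by linarith
        qed (use \<rho> in auto)
        also have "\<dots> = \<rho> * (?d * (2 / K ^ n))" by simp
        finally show ?thesis using C0 unfolding t_def by (simp add: mult_left_mono mult_ac)
      qed
      let ?X = "{x \<in> space (lebesgue_on (\<tau> j)). cell j x = c}"
      have "?X \<subseteq> ?Q"
      proof
        fix x assume "x \<in> ?X"
        then have "norm (x - x') \<le> 2 * t" by (intro close) auto
        then have "\<bar>x $ i - x' $ i\<bar> \<le> 2 * t" for i
          using component_le_norm_cart[of "x - x'" i] by simp
        then show "x \<in> ?Q" by (simp add: mem_box_cart abs_le_iff algebra_simps)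
      qed
      moreover have "?X \<in> sets lebesgue"
      proof -
        have "?X \<in> sets (lebesgue_on (\<tau> j))"
          using measurable_sets[OF cell_meas, of "{c}" j] by (simp add: vimage_def Int_def conj_commute)
        then show ?thesis using \<tau> sets_restrict_space_iff[of "\<tau> j" lebesgue ?X] by auto
      qed
      ultimately have "measure lebesgue ?X \<le> measure lebesgue ?Q"
        by (intro measure_mono_fmeasurable) auto
      also have "\<dots> = (\<Prod>i\<in>(UNIV::'m set). 4 * t)"
      proof -
        have "?Q \<noteq> {}" using t0 by (simp add: interval_ne_empty_cart)
        then have "measure lebesgue ?Q = (\<Prod>i\<in>(UNIV::'m set). (x' + (\<chi> i. 2 * t)) $ i - (x' - (\<chi> i. 2 * t)) $ i)"
          by (subst content_cbox_cart[symmetric]) auto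
        then show ?thesis by simp
      qed
      also have "\<dots> = V" unfolding V_def V0_def t_def m_def
        by (simp only: prod_constant times_divide_eq_right power_divide of_nat_power)
      finally show ?thesis using \<tau> by (subst measure_restrict_space) auto
    qed
    show "(\<Sum>\<xi>\<in>index_box (K ^ n) UNIV. \<Prod>j\<in>UNIV. norm (osc_int (\<tau> j) (g j) (F j) ((2 * pi / \<rho>) *\<^sub>R (?N *v (\<chi> k. real (\<xi> k))))) powr (2 * \<theta>))
     \<le> C * step_const ?d ^ n * (\<Prod>j\<in>UNIV. (L2_mass (\<tau> j) (g j)) powr \<theta>)"
    proof -
      have "(\<Sum>\<xi>\<in>index_box (K ^ n) UNIV. \<Prod>j\<in>UNIV. norm (LINT x|lebesgue_on (\<tau> j). g j x *
          cis (2 * pi * (\<Sum>k\<in>UNIV. real (\<xi> k) * S j x k))) powr (2 * \<theta>))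
        \<le> phase_const ?d ?d (4 * pi) (2 * \<theta>) * ((step_const ?d * K ^ ?d) ^ n
          * (\<Prod>j\<in>UNIV. (V * (L2_mass (\<tau> j) (g j))) powr \<theta>))"
      proof (rule cell_restriction[where G = G and cell = cell])
        show "finite_measure (lebesgue_on (\<tau> j))" for j by (rule finite_measure_lebesgue_on[OF \<tau>_lm])
      qed (use g cell_meas V S_meas cell_box S_close in auto)
      also have "\<dots> = C * step_const ?d ^ n * (\<Prod>j\<in>UNIV. (L2_mass (\<tau> j) (g j)) powr \<theta>)"
      proof -
        have "(real (K ^ n) ^ m) powr \<theta> = real (K ^ n) powr (real m * \<theta>)"
          using K by (simp only: powr_realpow[symmetric] N powr_powr)
        then have Nm: "(real (K ^ n) ^ m) powr \<theta> = real (K ^ n)" using N by (simp only: \<theta>m powr_one)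
        have I0: "(L2_mass (\<tau> j) (g j)) \<ge> 0" for j by (intro integral_nonneg_AE) auto
        have "V powr \<theta> = V0 powr \<theta> / real (K ^ n)"
          unfolding V_def using V0 N Nm by (subst powr_divide) auto
        then have "(V * (L2_mass (\<tau> j) (g j))) powr \<theta>
           = V0 powr \<theta> / real (K ^ n) * (L2_mass (\<tau> j) (g j)) powr \<theta>" for j
          using V0 N I0[of j] by (subst powr_mult) (auto simp: V_def)
        then have prod_eq: "(\<Prod>j\<in>UNIV. (V * (L2_mass (\<tau> j) (g j))) powr \<theta>)
           = (V0 powr \<theta> / real (K ^ n)) ^ ?d * (\<Prod>j\<in>UNIV. (L2_mass (\<tau> j) (g j)) powr \<theta>)"
          by (simp only: prod.distrib prod_constant)
        have pow_eq: "(step_const ?d * K ^ ?d) ^ n * (V0 powr \<theta> / real (K ^ n)) ^ ?d = step_const ?d ^ n * (V0 powr \<theta>) ^ ?d"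
        proof -
          have e: "real (K ^ ?d) ^ n = real (K ^ n) ^ ?d"
            by (simp only: of_nat_power power_mult[symmetric] mult.commute)
          have "real (K ^ n) ^ ?d \<noteq> 0" using N by simp
          moreover have "(a * x) * (b / x) = a * b" if "x \<noteq> 0" for a b x :: real using that by simp
          ultimately show ?thesis unfolding power_mult_distrib e power_divide by blast
        qed
        have rearrange: "P * (s * (x * y)) = (P * b) * t * y" if "s * x = t * b" for P s x y b t :: real
          using that by algebra
        show ?thesis unfolding C_def prod_eq by (rule rearrange[OF pow_eq])
      qed
      finally have main: "(\<Sum>\<xi>\<in>index_box (K ^ n) UNIV. \<Prod>j\<in>UNIV. norm (LINT x|lebesgue_on (\<tau> j). g j x *
          cis (2 * pi * (\<Sum>k\<in>UNIV. real (\<xi> k) * S j x k))) powr (2 * \<theta>))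
         \<le> C * step_const ?d ^ n * (\<Prod>j\<in>UNIV. (L2_mass (\<tau> j) (g j)) powr \<theta>)" .
      have "norm (osc_int (\<tau> j) (g j) (F j) ((2 * pi / \<rho>) *\<^sub>R (?N *v (\<chi> k. real (\<xi> k)))))
         = norm (LINT x|lebesgue_on (\<tau> j). g j x * cis (2 * pi * (\<Sum>k\<in>UNIV. real (\<xi> k) * S j x k)))" for j \<xi>
      proof -
        define z :: "real ^ 'm option" where "z = (\<chi> k. real (\<xi> k))"
        define c where "c = (2 * pi) * (z \<bullet> ((1 / \<rho>) *\<^sub>R (transpose ?N *v F j (x0 j)) - h j))"
        have "((2 * pi / \<rho>) *\<^sub>R (?N *v z)) \<bullet> F j x = 2 * pi * (\<Sum>k\<in>UNIV. real (\<xi> k) * S j x k) + c" for x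
        proof -
          have "(\<Sum>k\<in>UNIV. real (\<xi> k) * S j x k) = z \<bullet> ((1 / \<rho>) *\<^sub>R (transpose ?N *v (F j x - F j (x0 j))) + h j)"
            by (simp only: inner_vec_def S_def z_def vec_lambda_beta inner_real_def)
          also have "\<dots> = (1 / \<rho>) * ((?N *v z) \<bullet> F j x) - z \<bullet> ((1 / \<rho>) *\<^sub>R (transpose ?N *v F j (x0 j)) - h j)"
            by (simp del: transpose_matrix_vector add: inner_matrix_vector_transpose matrix_vector_mult_diff_distrib inner_diff_right inner_add_right right_diff_distrib diff_divide_distrib)
          finally have "(1 / \<rho>) * ((?N *v z) \<bullet> F j x) = (\<Sum>k\<in>UNIV. real (\<xi> k) * S j x k)
             + z \<bullet> ((1 / \<rho>) *\<^sub>R (transpose ?N *v F j (x0 j)) - h j)" by linarith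
          moreover have "((2 * pi / \<rho>) *\<^sub>R (?N *v z)) \<bullet> F j x = 2 * pi * ((1 / \<rho>) * ((?N *v z) \<bullet> F j x))" by simp
          ultimately show ?thesis unfolding c_def by (simp only: distrib_left)
        qed
        then have "(LINT x|lebesgue_on (\<tau> j). g j x * cis (((2 * pi / \<rho>) *\<^sub>R (?N *v z)) \<bullet> F j x))
          = (LINT x|lebesgue_on (\<tau> j). g j x * cis (2 * pi * (\<Sum>k\<in>UNIV. real (\<xi> k) * S j x k)) * cis c)"
          by (simp only: cis_mult[symmetric] mult.assoc)
        then show ?thesis by (simp add: z_def norm_mult)
      qed
      then show ?thesis using main by (simp only:)
    qed
  qed
qed

section \<open>From lattices to balls\<close>

abbreviation ball_integral :: "real \<Rightarrow> ('a::euclidean_space \<Rightarrow> real) \<Rightarrow> ennreal" where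
  "ball_integral R f \<equiv> (\<integral>\<^sup>+\<xi>. ennreal (f \<xi>) * indicator (ball 0 R) \<xi> \<partial>lborel)"

lemma borel_measurable_cis [measurable]:
  assumes "f \<in> borel_measurable M"
  shows "(\<lambda>x. cis (f x)) \<in> borel_measurable M"
  by (rule measurable_compose[OF assms borel_measurable_continuous_onI]) (intro continuous_intros)

lemma measurable_oscillatory_integral:
  fixes g :: "'a \<Rightarrow> complex" and F :: "'a \<Rightarrow> 'b::euclidean_space"
  assumes M: "sigma_finite_measure M" and [measurable]: "g \<in> borel_measurable M" "F \<in> borel_measurable M"
  shows "(\<lambda>\<xi>. LINT x|M. g x * cis (\<xi> \<bullet> F x)) \<in> borel_measurable borel"
proof (rule sigma_finite_measure.borel_measurable_lebesgue_integral[OF M])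
  show "case_prod (\<lambda>\<xi> x. g x * cis (\<xi> \<bullet> F x)) \<in> borel_measurable (borel \<Otimes>\<^sub>M M)"
    by measurable
qed

lemma nn_integral_lborel_shift:
  fixes f :: "'a::euclidean_space \<Rightarrow> ennreal"
  assumes [measurable]: "f \<in> borel_measurable borel"
  shows "(\<integral>\<^sup>+x. f (c + x) \<partial>lborel) = (\<integral>\<^sup>+x. f x \<partial>lborel)"
proof -
  have "(\<integral>\<^sup>+x. f x \<partial>lborel) = (\<integral>\<^sup>+x. f x \<partial>distr lborel borel ((+) c))"
    by (simp add: lborel_distr_plus)
  also have "\<dots> = (\<integral>\<^sup>+x. f (c + x) \<partial>lborel)" by (rule nn_integral_distr) auto
  finally show ?thesis ..
qed

text \<open>
  An integral is bounded by a sum over a lattice of translates that is uniform in the offset: integrate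
  the sum over the offset in a fixed ball.
\<close>

lemma nn_integral_le_covering:
  fixes \<Phi> :: "'a::euclidean_space \<Rightarrow> ennreal"
  assumes [measurable]: "\<Phi> \<in> borel_measurable borel" and Z: "finite Z"
    and cover: "\<And>\<xi>. \<xi> \<in> X \<Longrightarrow> \<exists>\<zeta>\<in>Z. \<xi> - b \<zeta> \<in> cball 0 t"
    and le: "\<And>\<eta>. (\<Sum>\<zeta>\<in>Z. \<Phi> (b \<zeta> + \<eta>)) \<le> ennreal B" and B: "B \<ge> 0"
  shows "(\<integral>\<^sup>+\<xi>. \<Phi> \<xi> * indicator X \<xi> \<partial>lborel) \<le> ennreal (measure lborel (cball 0 t :: 'a set) * B)"
proof -
  let ?P = "cball 0 t :: 'a set"
  have [measurable]: "?P \<in> sets borel" by simp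
  have [measurable]: "(\<lambda>\<xi>. indicator ?P (\<xi> - b \<zeta>) :: ennreal) \<in> borel_measurable borel" for \<zeta>
    by (rule measurable_compose[of "\<lambda>\<xi>. \<xi> - b \<zeta>" borel borel]) (auto intro!: borel_measurable_indicator)
  have "(\<integral>\<^sup>+\<xi>. \<Phi> \<xi> * indicator X \<xi> \<partial>lborel) \<le> (\<integral>\<^sup>+\<xi>. (\<Sum>\<zeta>\<in>Z. \<Phi> \<xi> * indicator ?P (\<xi> - b \<zeta>)) \<partial>lborel)"
  proof (rule nn_integral_mono)
    fix \<xi>
    show "\<Phi> \<xi> * indicator X \<xi> \<le> (\<Sum>\<zeta>\<in>Z. \<Phi> \<xi> * indicator ?P (\<xi> - b \<zeta>))"
    proof (cases "\<xi> \<in> X")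
      case True
      then obtain \<zeta> where \<zeta>: "\<zeta> \<in> Z" "\<xi> - b \<zeta> \<in> ?P" using cover by blast
      have "\<Phi> \<xi> * indicator X \<xi> = \<Phi> \<xi> * indicator ?P (\<xi> - b \<zeta>)" using True \<zeta> by simp
      also have "\<dots> \<le> (\<Sum>\<zeta>\<in>Z. \<Phi> \<xi> * indicator ?P (\<xi> - b \<zeta>))" by (rule member_le_sum) (use Z \<zeta> in auto)
      finally show ?thesis .
    qed simp
  qed
  also have "\<dots> = (\<Sum>\<zeta>\<in>Z. \<integral>\<^sup>+\<xi>. \<Phi> \<xi> * indicator ?P (\<xi> - b \<zeta>) \<partial>lborel)"
    by (rule nn_integral_sum) measurable
  also have "\<dots> = (\<Sum>\<zeta>\<in>Z. \<integral>\<^sup>+\<eta>. \<Phi> (b \<zeta> + \<eta>) * indicator ?P \<eta> \<partial>lborel)"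
  proof (rule sum.cong[OF refl])
    fix \<zeta>
    have "(\<integral>\<^sup>+\<xi>. \<Phi> \<xi> * indicator ?P (\<xi> - b \<zeta>) \<partial>lborel)
       = (\<integral>\<^sup>+\<eta>. \<Phi> (b \<zeta> + \<eta>) * indicator ?P (b \<zeta> + \<eta> - b \<zeta>) \<partial>lborel)"
      by (rule nn_integral_lborel_shift[symmetric]) measurable
    then show "(\<integral>\<^sup>+\<xi>. \<Phi> \<xi> * indicator ?P (\<xi> - b \<zeta>) \<partial>lborel) = (\<integral>\<^sup>+\<eta>. \<Phi> (b \<zeta> + \<eta>) * indicator ?P \<eta> \<partial>lborel)"
      by simp
  qed
  also have "\<dots> = (\<integral>\<^sup>+\<eta>. (\<Sum>\<zeta>\<in>Z. \<Phi> (b \<zeta> + \<eta>) * indicator ?P \<eta>) \<partial>lborel)"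
    by (rule nn_integral_sum[symmetric]) measurable
  also have "\<dots> \<le> (\<integral>\<^sup>+\<eta>. ennreal B * indicator ?P \<eta> \<partial>lborel)"
    by (intro nn_integral_mono) (use le in \<open>auto simp: sum_distrib_right[symmetric] intro: mult_right_mono\<close>)
  also have "\<dots> = ennreal B * emeasure lborel ?P" by (rule nn_integral_cmult_indicator) simp
  also have "\<dots> = ennreal (measure lborel ?P * B)"
  proof -
    have "emeasure lborel ?P \<noteq> top" using emeasure_bounded_finite[of ?P] by (auto simp: less_top)
    then show ?thesis using B by (simp add: emeasure_eq_ennreal_measure ennreal_mult' mult.commute)
  qed
  finally show ?thesis .
qed

lemma power_comparable:
  fixes K :: nat and x :: real
  assumes "K \<ge> 2" "x \<ge> 1"
  shows "\<exists>n. x \<le> real (K ^ n) \<and> real (K ^ n) \<le> K * x"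
proof -
  define n where "n = nat \<lceil>log K x\<rceil>"
  have K: "real K > 1" using assms by simp
  have l0: "log K x \<ge> 0" using assms K by simp
  have Kn: "real (K ^ n) = K powr real n" using K by (simp add: powr_realpow)
  have n1: "log K x \<le> real n" "real n \<le> log K x + 1" using l0 unfolding n_def by linarith+
  have x: "K powr (log K x) = x" using K assms by simp
  have "x \<le> K powr real n" using n1 K powr_mono[of "log K x" "real n" K] x by simp
  moreover have "K powr real n \<le> K * x" using n1 K powr_mono[of "real n" "log K x + 1" K] x by (simp add: powr_add mult.commute)
  ultimately show ?thesis by (intro exI[of _ n]) (simp only: Kn)
qed

text \<open>
  The bound of \<open>piece_estimate\<close> is uniform under translations of the frequency, because a translation only
  multiplies \<open>g j\<close> by a unimodular function. So it may be averaged over translates of the lattice, which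
  cover the ball once \<open>K\<^sup>n\<close> is comparable to \<open>R\<close>.
\<close>

theorem local_restriction:
  fixes A \<nu> \<epsilon> :: real
  assumes A: "A > 0" and \<nu>: "\<nu> > 0" and \<epsilon>: "\<epsilon> > 0"
  defines "\<theta> \<equiv> lw_exponent CARD('m::finite option)"
  shows "\<exists>\<kappa>>0. \<exists>C>0. \<forall>(F :: 'm option \<Rightarrow> real ^ 'm \<Rightarrow> real ^ 'm option) x0 \<tau> g G R.
     (\<forall>j. C11_bounded A (F j)) \<longrightarrow> wedge_det F x0 \<ge> \<nu> \<longrightarrow>
     (\<forall>j. \<tau> j \<in> sets lebesgue \<and> \<tau> j \<subseteq> ball (x0 j) \<kappa>) \<longrightarrow>
     (\<forall>j. g j \<in> borel_measurable (lebesgue_on (\<tau> j)) \<and> (\<forall>x. norm (g j x) \<le> G)) \<longrightarrow> R \<ge> 1 \<longrightarrow>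
     ball_integral R (\<lambda>\<xi>. \<Prod>j\<in>UNIV. norm (osc_int (\<tau> j) (g j) (F j) \<xi>) powr (2 * \<theta>))
     \<le> ennreal (C * R powr \<epsilon> * (\<Prod>j\<in>UNIV. (L2_mass (\<tau> j) (g j)) powr \<theta>))"
proof -
  let ?d = "CARD('m option)"
  \<comment> \<open>\<open>K\<close> is so large that the loss \<open>step_const\<close> per scale is at most \<open>K\<close> to the power \<open>\<epsilon>\<close>\<close>
  obtain K0 :: nat where K0: "real K0 \<ge> max 2 (step_const ?d powr (1 / \<epsilon>))" using real_arch_simple by blast
  define K where "K = K0"
  have K2: "K \<ge> 2" and K: "K > 0" using K0 by (simp_all add: K_def)
  have step: "step_const ?d \<le> real K powr \<epsilon>"
  proof -
    have "step_const ?d = (step_const ?d powr (1 / \<epsilon>)) powr \<epsilon>" using \<epsilon> step_const_pos[of ?d] by (simp add: powr_powr)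
    also have "\<dots> \<le> real K powr \<epsilon>" using K0 \<epsilon> by (intro powr_mono2) (auto simp: K_def)
    finally show ?thesis .
  qed
  obtain \<rho> \<kappa> C1 where \<rho>: "\<rho> > 0" and \<kappa>: "\<kappa> > 0" and C1: "C1 > 0"
    and piece: "\<And>(F :: 'm option \<Rightarrow> real ^ 'm \<Rightarrow> real ^ 'm option) x0 \<tau> g G n.
     (\<forall>j. C11_bounded A (F j)) \<Longrightarrow> wedge_det F x0 \<ge> \<nu> \<Longrightarrow>
     (\<forall>j. \<tau> j \<in> sets lebesgue \<and> \<tau> j \<subseteq> ball (x0 j) \<kappa>) \<Longrightarrow>
     (\<forall>j. g j \<in> borel_measurable (lebesgue_on (\<tau> j)) \<and> (\<forall>x. norm (g j x) \<le> G)) \<Longrightarrow>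
     (\<Sum>\<xi>\<in>index_box (K ^ n) UNIV. \<Prod>j\<in>UNIV. norm (osc_int (\<tau> j) (g j) (F j) ((2 * pi / \<rho>) *\<^sub>R (frame_normals F x0 *v (\<chi> k. real (\<xi> k))))) powr (2 * \<theta>))
     \<le> C1 * step_const CARD('m option) ^ n * (\<Prod>j\<in>UNIV. (L2_mass (\<tau> j) (g j)) powr \<theta>)"
    using piece_estimate[OF A \<nu> K, where 'm = 'm] unfolding \<theta>_def by blast
  obtain C0 where C0: "C0 \<ge> 1" and str: "\<And>(F :: 'm option \<Rightarrow> real ^ 'm \<Rightarrow> real ^ 'm option) x0.
     (\<forall>j k. norm (pderiv_at k (F j) (x0 j)) \<le> A) \<Longrightarrow> wedge_det F x0 \<ge> \<nu> \<Longrightarrow> straightened C0 F x0"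
    using straightening[OF A \<nu>, where 'm = 'm] by blast
  define c where "c = \<rho> / (2 * pi)"
  have c: "c > 0" using \<rho> by (simp add: c_def)
  have c_inv: "2 * pi / \<rho> = 1 / c" by (simp add: c_def)
  define C2 where "C2 = 2 * (C0 * c) + 5"
  have C2: "C2 \<ge> 1" using C0 c by (simp add: C2_def)
  define P where "P = (1 / c) * (C0 * ?d)"
  define mP where "mP = measure lborel (cball 0 P :: (real ^ 'm option) set)"
  define C where "C = mP * (C1 * (K * C2) powr \<epsilon>) + 1"
  have C: "C > 0" unfolding C_def mP_def using C1 by (simp add: add_nonneg_pos)
  show ?thesis
  proof (rule exI[of _ \<kappa>], rule conjI[OF \<kappa>], rule exI[of _ C], rule conjI[OF C], intro allI impI)
    fix F :: "'m option \<Rightarrow> real ^ 'm \<Rightarrow> real ^ 'm option" and x0 \<tau> and g :: "'m option \<Rightarrow> real ^ 'm \<Rightarrow> complex" and G R :: real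
    assume F: "\<forall>j. C11_bounded A (F j)" and wd: "wedge_det F x0 \<ge> \<nu>"
      and \<tau>: "\<forall>j. \<tau> j \<in> sets lebesgue \<and> \<tau> j \<subseteq> ball (x0 j) \<kappa>"
      and g: "\<forall>j. g j \<in> borel_measurable (lebesgue_on (\<tau> j)) \<and> (\<forall>x. norm (g j x) \<le> G)" and R: "R \<ge> 1"
    let ?N = "frame_normals F x0"
    have "\<forall>j k. norm (pderiv_at k (F j) (x0 j)) \<le> A" using F by (simp add: C11_bounded_def)
    note st = str[OF this wd, unfolded straightened_def]
    have N_up: "norm (?N *v z) \<le> C0 * norm z" for z using st by blast
    have N_inv: "\<exists>z. ?N *v z = y \<and> norm z \<le> C0 * norm y" for y using st by blast
    have "C2 * R \<ge> 1" using C2 R mult_mono[of 1 C2 1 R] by simp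
    then obtain n where n: "C2 * R \<le> real (K ^ n)" "real (K ^ n) \<le> K * (C2 * R)"
      using power_comparable[OF K2] by blast
    define L where "L = nat \<lceil>C0 * c * R\<rceil> + 1"
    have L: "C0 * c * R + 1 \<le> real L" "real L \<le> C0 * c * R + 2"
      using C0 c R unfolding L_def by (simp_all add: of_nat_nat ceiling_le_iff) linarith+
    have LK: "2 * L < K ^ n"
    proof -
      have "real (2 * L) \<le> 2 * (C0 * c) * R + 4 * 1" using L by simp
      also have "\<dots> \<le> 2 * (C0 * c) * R + 4 * R" using R by simp
      also have "\<dots> < C2 * R" using R unfolding C2_def by (simp add: algebra_simps)
      finally have "real (2 * L) < real (K ^ n)" using n by linarith
      then show ?thesis by (simp only: of_nat_less_iff)
    qed
    \<comment> \<open>the shift by \<open>L\<close> makes the lattice points near the origin have indices in the box, which starts at \<open>0\<close>\<close>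
    define b where "b \<zeta> = (1 / c) *\<^sub>R (?N *v (\<chi> k. real (\<zeta> k) - real L))" for \<zeta> :: "'m option \<Rightarrow> nat"
    define Q where "Q = (\<Prod>j\<in>UNIV. (L2_mass (\<tau> j) (g j)) powr \<theta>)"
    have Q0: "Q \<ge> 0" unfolding Q_def by (intro prod_nonneg) auto
    define \<Phi> where "\<Phi> \<xi> = (\<Prod>j\<in>UNIV. norm (osc_int (\<tau> j) (g j) (F j) \<xi>) powr (2 * \<theta>))" for \<xi>
    have \<tau>_lm: "\<tau> j \<in> lmeasurable" for j
      using \<tau> bounded_subset[OF bounded_ball] by (blast intro: bounded_set_imp_lmeasurable)
    have F_meas: "F j \<in> borel_measurable (lebesgue_on (\<tau> j))" for j
      by (rule continuous_imp_measurable_on_sets_lebesgue[OF C11_bounded_continuous]) (use F \<tau> in auto)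
    have \<Phi>_meas [measurable]: "\<Phi> \<in> borel_measurable borel"
    proof -
      have "(\<lambda>\<xi>. LINT x|lebesgue_on (\<tau> j). g j x * cis (\<xi> \<bullet> F j x)) \<in> borel_measurable borel" for j
        using g F_meas finite_measure_lebesgue_on[OF \<tau>_lm]
        by (intro measurable_oscillatory_integral) (auto simp: finite_measure_def)
      then show ?thesis unfolding \<Phi>_def by measurable
    qed
    have bound: "(\<Sum>\<zeta>\<in>index_box (K ^ n) UNIV. \<Phi> (b \<zeta> + \<eta>)) \<le> C1 * step_const ?d ^ n * Q" for \<eta>
    proof -
      define \<eta>' where "\<eta>' = \<eta> - (1 / c) *\<^sub>R (?N *v (\<chi> k. real L))"
      define g' where "g' j x = g j x * cis (\<eta>' \<bullet> F j x)" for j x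
      have g'_norm: "norm (g' j x) = norm (g j x)" for j x by (simp add: g'_def norm_mult)
      have split: "b \<zeta> + \<eta> = (1 / c) *\<^sub>R (?N *v (\<chi> k. real (\<zeta> k))) + \<eta>'" for \<zeta>
      proof -
        have "(\<chi> k. real (\<zeta> k) - real L) = (\<chi> k. real (\<zeta> k)) - (\<chi> k. real L)" by (simp add: vec_eq_iff)
        then show ?thesis by (simp add: b_def \<eta>'_def matrix_vector_mult_diff_distrib scaleR_diff_right)
      qed
      have "\<Phi> (b \<zeta> + \<eta>) = (\<Prod>j\<in>UNIV. norm (LINT x|lebesgue_on (\<tau> j). g' j x *
          cis (((1 / c) *\<^sub>R (?N *v (\<chi> k. real (\<zeta> k)))) \<bullet> F j x)) powr (2 * \<theta>))" for \<zeta>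
        unfolding \<Phi>_def split g'_def inner_add_left cis_mult[symmetric] by (simp only: mult_ac)
      then have "(\<Sum>\<zeta>\<in>index_box (K ^ n) UNIV. \<Phi> (b \<zeta> + \<eta>)) = (\<Sum>\<zeta>\<in>index_box (K ^ n) UNIV. \<Prod>j\<in>UNIV. norm (LINT x|lebesgue_on (\<tau> j). g' j x *
          cis (((1 / c) *\<^sub>R (?N *v (\<chi> k. real (\<zeta> k)))) \<bullet> F j x)) powr (2 * \<theta>))" by simp
      also have "\<dots> \<le> C1 * step_const ?d ^ n * (\<Prod>j\<in>UNIV. (L2_mass (\<tau> j) (g' j)) powr \<theta>)"
        unfolding c_inv[symmetric]
      proof (rule piece[OF F wd \<tau>, where G = G])
        have "(\<lambda>x. cis (\<eta>' \<bullet> F j x)) \<in> borel_measurable (lebesgue_on (\<tau> j))" for j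
          using F_meas[of j] by measurable
        then have "(\<lambda>x. g j x * cis (\<eta>' \<bullet> F j x)) \<in> borel_measurable (lebesgue_on (\<tau> j))" for j
          using g by (intro borel_measurable_times) auto
        moreover have "g' j = (\<lambda>x. g j x * cis (\<eta>' \<bullet> F j x))" for j by (simp add: fun_eq_iff g'_def)
        ultimately show "\<forall>j. g' j \<in> borel_measurable (lebesgue_on (\<tau> j)) \<and> (\<forall>x. norm (g' j x) \<le> G)"
          using g by (simp add: norm_mult)
      qed
      finally show ?thesis by (simp add: g'_norm Q_def)
    qed
    have "ball_integral R (\<lambda>\<xi>. \<Phi> \<xi>) \<le> ennreal (mP * (C1 * step_const ?d ^ n * Q))"
      unfolding mP_def
    proof (rule nn_integral_le_covering[where b = b and Z = "index_box (K ^ n) UNIV"])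
      fix \<eta>
      have "(\<Sum>\<zeta>\<in>index_box (K ^ n) UNIV. ennreal (\<Phi> (b \<zeta> + \<eta>))) = ennreal (\<Sum>\<zeta>\<in>index_box (K ^ n) UNIV. \<Phi> (b \<zeta> + \<eta>))"
        by (rule sum_ennreal) (auto simp: \<Phi>_def intro!: prod_nonneg)
      also have "\<dots> \<le> ennreal (C1 * step_const ?d ^ n * Q)" by (intro ennreal_leI bound)
      finally show "(\<Sum>\<zeta>\<in>index_box (K ^ n) UNIV. ennreal (\<Phi> (b \<zeta> + \<eta>))) \<le> ennreal (C1 * step_const ?d ^ n * Q)" .
    next
      fix \<xi> :: "real ^ 'm option" assume \<xi>: "\<xi> \<in> ball 0 R"
      obtain z where z: "?N *v z = c *\<^sub>R \<xi>" "norm z \<le> C0 * norm (c *\<^sub>R \<xi>)" using N_inv by blast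
      have "C0 * norm (c *\<^sub>R \<xi>) \<le> C0 * (c * R)" using \<xi> c C0 by (intro mult_left_mono) auto
      then have z_le: "\<bar>z $ k\<bar> \<le> C0 * c * R" for k using z(2) component_le_norm_cart[of z k] by (simp add: mult.assoc)
      define \<zeta> where "\<zeta> k = nat (\<lfloor>z $ k\<rfloor> + int L)" for k
      have fl: "\<lfloor>z $ k\<rfloor> + int L \<ge> 0" for k
      proof -
        have "z $ k \<ge> - real L" using z_le[of k] L by linarith
        then have "of_int (- int L) \<le> z $ k" by simp
        then have "- int L \<le> \<lfloor>z $ k\<rfloor>" using le_floor_iff by blast
        then show ?thesis by linarith
      qed
      have \<zeta>_real: "real (\<zeta> k) - real L = of_int \<lfloor>z $ k\<rfloor>" for k
        unfolding \<zeta>_def using fl[of k] by (simp add: of_nat_nat)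
      have "\<zeta> k < K ^ n" for k
      proof -
        have "real (\<zeta> k) \<le> 2 * real L"
          using \<zeta>_real[of k] z_le[of k] L of_int_floor_le[of "z $ k"] by linarith
        then have "real (\<zeta> k) \<le> real (2 * L)" by simp
        then have "\<zeta> k \<le> 2 * L" by (simp only: of_nat_le_iff)
        then show ?thesis using LK by linarith
      qed
      then have "\<zeta> \<in> index_box (K ^ n) UNIV" by (simp add: index_box_def)
      moreover have "\<xi> - b \<zeta> \<in> cball 0 P"
      proof -
        define w where "w = z - (\<chi> k. of_int \<lfloor>z $ k\<rfloor>)"
        have "\<xi> = (1 / c) *\<^sub>R (?N *v z)" using z(1) c by simp
        then have "\<xi> - b \<zeta> = (1 / c) *\<^sub>R (?N *v w)"
          by (simp add: b_def \<zeta>_real w_def matrix_vector_mult_diff_distrib scaleR_diff_right)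
        then have "norm (\<xi> - b \<zeta>) = (1 / c) * norm (?N *v w)" using c by simp
        also have "\<dots> \<le> (1 / c) * (C0 * ?d)"
        proof -
          have "norm w \<le> (\<Sum>k\<in>UNIV. \<bar>w $ k\<bar>)" by (rule norm_le_l1_cart)
          also have "\<dots> \<le> (\<Sum>k\<in>(UNIV :: 'm option set). 1)"
          proof (rule sum_mono)
            fix k show "\<bar>w $ k\<bar> \<le> 1" unfolding w_def by simp linarith
          qed
          finally have "C0 * norm w \<le> C0 * ?d" using C0 by (intro mult_left_mono) auto
          then show ?thesis using N_up[of w] c by (intro mult_left_mono) auto
        qed
        finally show ?thesis by (simp add: P_def)
      qed
      ultimately show "\<exists>\<zeta>\<in>index_box (K ^ n) UNIV. \<xi> - b \<zeta> \<in> cball 0 P" by blast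
    qed (use C1 Q0 step_const_pos[of ?d] in auto)
    also have "\<dots> \<le> ennreal (C * R powr \<epsilon> * Q)"
    proof (rule ennreal_leI)
      have "step_const ?d ^ n \<le> (real K powr \<epsilon>) ^ n" using step step_const_pos[of ?d] by (intro power_mono) auto
      also have "\<dots> = real (K ^ n) powr \<epsilon>" using K by (simp add: powr_power mult.commute powr_powr flip: powr_realpow)
      also have "\<dots> \<le> (K * (C2 * R)) powr \<epsilon>" using n \<epsilon> by (intro powr_mono2) auto
      also have "\<dots> = (K * C2) powr \<epsilon> * R powr \<epsilon>" using C2 R by (subst powr_mult[symmetric]) (auto simp: mult.assoc)
      finally have "mP * (C1 * step_const ?d ^ n * Q) \<le> mP * (C1 * ((K * C2) powr \<epsilon> * R powr \<epsilon>) * Q)"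
        using C1 Q0 by (intro mult_left_mono mult_right_mono) (auto simp: mP_def)
      also have "\<dots> \<le> C * R powr \<epsilon> * Q"
        using Q0 unfolding C_def by (simp add: algebra_simps)
      finally show "mP * (C1 * step_const ?d ^ n * Q) \<le> C * R powr \<epsilon> * Q" .
    qed
    finally show "ball_integral R (\<lambda>\<xi>. \<Prod>j\<in>UNIV. norm (osc_int (\<tau> j) (g j) (F j) \<xi>) powr (2 * \<theta>))
     \<le> ennreal (C * R powr \<epsilon> * (\<Prod>j\<in>UNIV. (L2_mass (\<tau> j) (g j)) powr \<theta>))"
      by (simp only: \<Phi>_def Q_def)
  qed
qed

section \<open>Finitely many pieces\<close>

lemma prod_norm_sum_powr_le:
  fixes z :: "'n::finite \<Rightarrow> 'i \<Rightarrow> complex"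
  assumes "finite I" "s > 0"
  shows "(\<Prod>j\<in>UNIV. norm (\<Sum>i\<in>I. z j i) powr s)
    \<le> (real (card I) powr s) ^ CARD('n) * (\<Sum>\<sigma>\<in>UNIV \<rightarrow> I. \<Prod>j\<in>UNIV. norm (z j (\<sigma> j)) powr s)"
proof -
  have "norm (\<Sum>i\<in>I. z j i) powr s \<le> real (card I) powr s * (\<Sum>i\<in>I. norm (z j i) powr s)" for j
  proof -
    have "norm (\<Sum>i\<in>I. z j i) powr s \<le> (\<Sum>i\<in>I. 1 * norm (z j i)) powr s"
      using assms by (intro powr_mono2) (auto intro: norm_sum)
    also have "\<dots> \<le> (\<Sum>i\<in>I. sqrt 1) powr s * (\<Sum>i\<in>I. 1 powr (s / 2) * norm (z j i) powr s)"
      using assms by (intro sum_powr_le_sum_powr) auto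
    finally show ?thesis by simp
  qed
  then have "(\<Prod>j\<in>UNIV. norm (\<Sum>i\<in>I. z j i) powr s) \<le> (\<Prod>j\<in>UNIV. real (card I) powr s * (\<Sum>i\<in>I. norm (z j i) powr s))"
    by (intro prod_mono) auto
  also have "\<dots> = (real (card I) powr s) ^ CARD('n) * (\<Sum>\<sigma>\<in>UNIV \<rightarrow> I. \<Prod>j\<in>UNIV. norm (z j (\<sigma> j)) powr s)"
    using assms by (simp only: prod.distrib prod_constant prod_sum_eq_sum_prod_choice)
  finally show ?thesis .
qed

text \<open>
  If each of the factors is a sum over \<open>I\<close>, then it suffices to estimate the products of single terms; the
  loss is a power of the number of terms, for convex and non-convex exponents alike.
\<close>

lemma ball_integral_sum_le:
  fixes z :: "real ^ 'n::finite \<Rightarrow> 'n \<Rightarrow> 'i \<Rightarrow> complex" and s X R :: real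
  assumes I: "finite I" and s: "s > 0" and X: "X \<ge> 0"
    and [measurable]: "\<And>j i. (\<lambda>\<xi>. z \<xi> j i) \<in> borel_measurable borel"
    and piece: "\<And>\<sigma>. \<sigma> \<in> UNIV \<rightarrow> I \<Longrightarrow>
      ball_integral R (\<lambda>\<xi>. \<Prod>j\<in>UNIV. norm (z \<xi> j (\<sigma> j)) powr s) \<le> ennreal X"
  shows "ball_integral R (\<lambda>\<xi>. \<Prod>j\<in>UNIV. norm (\<Sum>i\<in>I. z \<xi> j i) powr s)
    \<le> ennreal ((real (card I) powr s) ^ CARD('n) * (real (card I) ^ CARD('n) * X))"
proof -
  define c where "c = (real (card I) powr s) ^ CARD('n)"
  have c0: "c \<ge> 0" by (simp add: c_def)
  have cardPi: "card (UNIV \<rightarrow> I :: ('n \<Rightarrow> 'i) set) = card I ^ CARD('n)"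
    using card_PiE[of "UNIV :: 'n set" "\<lambda>_. I"] by (simp add: PiE_UNIV_domain)
  have [measurable]: "ball 0 R \<in> sets (borel :: (real ^ 'n) measure)" by simp
  have meas: "(\<lambda>\<xi>. ennreal (\<Prod>j\<in>UNIV. norm (z \<xi> j (\<sigma> j)) powr s) * indicator (ball 0 R) \<xi>) \<in> borel_measurable lborel" for \<sigma>
    by measurable
  have "ball_integral R (\<lambda>\<xi>. \<Prod>j\<in>UNIV. norm (\<Sum>i\<in>I. z \<xi> j i) powr s)
     \<le> (\<integral>\<^sup>+\<xi>. ennreal c * (\<Sum>\<sigma>\<in>UNIV \<rightarrow> I. ennreal (\<Prod>j\<in>UNIV. norm (z \<xi> j (\<sigma> j)) powr s) * indicator (ball 0 R) \<xi>) \<partial>lborel)"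
  proof (rule nn_integral_mono)
    fix \<xi>
    have "ennreal (\<Prod>j\<in>UNIV. norm (\<Sum>i\<in>I. z \<xi> j i) powr s)
       \<le> ennreal (c * (\<Sum>\<sigma>\<in>UNIV \<rightarrow> I. \<Prod>j\<in>UNIV. norm (z \<xi> j (\<sigma> j)) powr s))"
      unfolding c_def by (intro ennreal_leI prod_norm_sum_powr_le I s)
    also have "\<dots> = ennreal c * (\<Sum>\<sigma>\<in>UNIV \<rightarrow> I. ennreal (\<Prod>j\<in>UNIV. norm (z \<xi> j (\<sigma> j)) powr s))"
      using c0 by (simp add: ennreal_mult sum_nonneg prod_nonneg sum_ennreal)
    finally show "ennreal (\<Prod>j\<in>UNIV. norm (\<Sum>i\<in>I. z \<xi> j i) powr s) * indicator (ball 0 R) \<xi>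
      \<le> ennreal c * (\<Sum>\<sigma>\<in>UNIV \<rightarrow> I. ennreal (\<Prod>j\<in>UNIV. norm (z \<xi> j (\<sigma> j)) powr s) * indicator (ball 0 R) \<xi>)"
      by (simp add: sum_distrib_right[symmetric] mult.assoc[symmetric] mult_right_mono)
  qed
  also have "\<dots> = ennreal c * (\<Sum>\<sigma>\<in>UNIV \<rightarrow> I. ball_integral R (\<lambda>\<xi>. \<Prod>j\<in>UNIV. norm (z \<xi> j (\<sigma> j)) powr s))"
    by (subst nn_integral_cmult[OF borel_measurable_sum[OF meas]], subst nn_integral_sum[OF meas], rule refl)
  also have "\<dots> \<le> ennreal c * (\<Sum>\<sigma>\<in>(UNIV \<rightarrow> I :: ('n \<Rightarrow> 'i) set). ennreal X)"
    by (intro mult_left_mono sum_mono piece) auto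
  also have "\<dots> = ennreal (c * (real (card I ^ CARD('n)) * X))"
    using c0 X by (simp only: sum_constant cardPi ennreal_of_nat_eq_real_of_nat) (simp add: ennreal_mult)
  finally show ?thesis by (simp add: c_def)
qed

definition grid_index :: "real \<Rightarrow> real ^ 'm::finite \<Rightarrow> 'm \<Rightarrow> int" where
  "grid_index \<delta> x = (\<lambda>k. \<lfloor>x $ k / \<delta>\<rfloor>)"

lemma finite_grid_index:
  assumes "bounded (S :: (real ^ 'm::finite) set)" "\<delta> > 0"
  shows "finite (grid_index \<delta> ` S)"
proof -
  obtain b where b: "\<And>x. x \<in> S \<Longrightarrow> norm x \<le> b" using assms bounded_iff by blast
  define m where "m = \<lceil>b / \<delta>\<rceil> + 1"
  have "grid_index \<delta> ` S \<subseteq> {f. \<forall>k. f k \<in> {- m..m}}"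
  proof clarify
    fix x k assume "x \<in> S"
    then have "\<bar>x $ k\<bar> \<le> b" using b component_le_norm_cart order_trans by blast
    then have "\<bar>x $ k\<bar> / \<delta> \<le> b / \<delta>" using assms by (intro divide_right_mono) auto
    moreover have "\<bar>x $ k\<bar> / \<delta> = \<bar>x $ k / \<delta>\<bar>" using assms by simp
    ultimately have "\<bar>x $ k / \<delta>\<bar> \<le> b / \<delta>" by linarith
    then have "\<lfloor>x $ k / \<delta>\<rfloor> \<le> m \<and> - m \<le> \<lfloor>x $ k / \<delta>\<rfloor>" unfolding m_def by linarith
    then show "grid_index \<delta> x k \<in> {- m..m}" unfolding grid_index_def by simp
  qed
  moreover have "finite {f :: 'm \<Rightarrow> int. \<forall>k. f k \<in> {- m..m}}"
    using finite_set_of_finite_funs[of "UNIV :: 'm set" "{- m..m}" 0] by simp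
  ultimately show ?thesis using finite_subset by blast
qed

lemma grid_index_eq_imp_close:
  fixes \<delta> :: real
  assumes "grid_index \<delta> x = grid_index \<delta> y" "\<delta> > 0"
  shows "norm (x - y :: real ^ 'm::finite) \<le> CARD('m) * \<delta>"
proof -
  have "\<bar>(x - y) $ k\<bar> \<le> \<delta>" for k
  proof -
    have "\<lfloor>x $ k / \<delta>\<rfloor> = \<lfloor>y $ k / \<delta>\<rfloor>" using assms(1) unfolding grid_index_def by metis
    then have "\<bar>x $ k / \<delta> - y $ k / \<delta>\<bar> \<le> 1" by linarith
    then show ?thesis using assms(2) by (simp add: diff_divide_distrib[symmetric])
  qed
  then have "(\<Sum>k\<in>UNIV. \<bar>(x - y) $ k\<bar>) \<le> (\<Sum>k\<in>(UNIV::'m set). \<delta>)" by (intro sum_mono)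
  then show ?thesis using norm_le_l1_cart[of "x - y"] by simp
qed

lemma sets_grid_cell [measurable]: "{x :: real ^ 'm::finite. grid_index \<delta> x = i} \<in> sets borel"
proof -
  have "{x. grid_index \<delta> x = i} = {x \<in> space borel. \<forall>k\<in>UNIV. \<lfloor>x $ k / \<delta>\<rfloor> = i k}" by (auto simp: grid_index_def fun_eq_iff)
  also have "\<dots> \<in> sets borel"
  proof (rule sets.sets_Collect_finite_All')
    fix k
    have [measurable]: "(\<lambda>x :: real ^ 'm. x $ k) \<in> borel_measurable borel"
      by (intro borel_measurable_continuous_onI continuous_intros)
    show "{x \<in> space borel. \<lfloor>x $ k / \<delta>\<rfloor> = i k} \<in> sets borel" by measurable
  qed auto
  finally show ?thesis .
qed

text \<open>
  The endpoint. A grid of mesh \<open>\<delta>\<close> cuts the sets \<open>T j\<close> into a number of pieces that depends on \<open>U\<close>, \<open>A\<close>, \<open>\<nu>\<close>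
  and \<open>\<epsilon>\<close> only, and \<open>local_restriction\<close> applies to every combination of nonempty pieces, with base points
  taken from the pieces.
\<close>

theorem multilinear_restriction_L2:
  fixes A \<nu> \<epsilon> :: real and U :: "(real ^ 'm::finite) set"
  assumes A: "A > 0" and \<nu>: "\<nu> > 0" and \<epsilon>: "\<epsilon> > 0" and U: "bounded U"
  defines "\<theta> \<equiv> lw_exponent CARD('m option)"
  shows "\<exists>C>0. \<forall>(F :: 'm option \<Rightarrow> real ^ 'm \<Rightarrow> real ^ 'm option) T g G R.
     (\<forall>j. C11_bounded A (F j)) \<longrightarrow> (\<forall>j. T j \<in> sets lebesgue \<and> T j \<subseteq> U) \<longrightarrow>
     (\<forall>x. (\<forall>j. x j \<in> T j) \<longrightarrow> wedge_det F x \<ge> \<nu>) \<longrightarrow>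
     (\<forall>j. g j \<in> borel_measurable (lebesgue_on (T j)) \<and> (\<forall>x. norm (g j x) \<le> G)) \<longrightarrow> R \<ge> 1 \<longrightarrow>
     ball_integral R (\<lambda>\<xi>. \<Prod>j\<in>UNIV. norm (osc_int (T j) (g j) (F j) \<xi>) powr (2 * \<theta>))
     \<le> ennreal (C * R powr \<epsilon> * (\<Prod>j\<in>UNIV. (L2_mass (T j) (g j)) powr \<theta>))"
proof -
  let ?d = "CARD('m option)"
  have \<theta>: "\<theta> > 0" by (simp add: \<theta>_def lw_exponent_def)
  obtain \<kappa> C1 where \<kappa>: "\<kappa> > 0" and C1: "C1 > 0"
    and loc: "\<And>(F :: 'm option \<Rightarrow> real ^ 'm \<Rightarrow> real ^ 'm option) x0 \<tau> g G R.
     (\<forall>j. C11_bounded A (F j)) \<Longrightarrow> wedge_det F x0 \<ge> \<nu> \<Longrightarrow>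
     (\<forall>j. \<tau> j \<in> sets lebesgue \<and> \<tau> j \<subseteq> ball (x0 j) \<kappa>) \<Longrightarrow>
     (\<forall>j. g j \<in> borel_measurable (lebesgue_on (\<tau> j)) \<and> (\<forall>x. norm (g j x) \<le> G)) \<Longrightarrow> R \<ge> 1 \<Longrightarrow>
     ball_integral R (\<lambda>\<xi>. \<Prod>j\<in>UNIV. norm (osc_int (\<tau> j) (g j) (F j) \<xi>) powr (2 * \<theta>))
     \<le> ennreal (C1 * R powr \<epsilon> * (\<Prod>j\<in>UNIV. (L2_mass (\<tau> j) (g j)) powr \<theta>))"
    using local_restriction[OF A \<nu> \<epsilon>, where 'm = 'm] unfolding \<theta>_def by blast
  define \<delta> where "\<delta> = \<kappa> / (2 * CARD('m))"
  have \<delta>: "\<delta> > 0" "CARD('m) * \<delta> < \<kappa>" using \<kappa> by (simp_all add: \<delta>_def)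
  define I where "I = grid_index \<delta> ` U"
  have finI: "finite I" unfolding I_def by (rule finite_grid_index[OF U \<delta>(1)])
  define c where "c = (real (card I) powr (2 * \<theta>)) ^ ?d"
  have c0: "c \<ge> 0" by (simp add: c_def)
  define nI where "nI = real (card I) ^ ?d"
  define C where "C = c * (nI * C1) + 1"
  have C: "C > 0" using c0 C1 by (simp add: C_def nI_def add_nonneg_pos)
  show ?thesis
  proof (rule exI[of _ C], rule conjI[OF C], intro allI impI)
    fix F :: "'m option \<Rightarrow> real ^ 'm \<Rightarrow> real ^ 'm option" and T and g :: "'m option \<Rightarrow> real ^ 'm \<Rightarrow> complex" and G R :: real
    assume F: "\<forall>j. C11_bounded A (F j)" and T: "\<forall>j. T j \<in> sets lebesgue \<and> T j \<subseteq> U"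
      and wd: "\<forall>x. (\<forall>j. x j \<in> T j) \<longrightarrow> wedge_det F x \<ge> \<nu>"
      and g: "\<forall>j. g j \<in> borel_measurable (lebesgue_on (T j)) \<and> (\<forall>x. norm (g j x) \<le> G)" and R: "R \<ge> 1"
    define \<tau> where "\<tau> j i = T j \<inter> {x. grid_index \<delta> x = i}" for j i
    have cell_leb: "{x :: real ^ 'm. grid_index \<delta> x = i} \<in> sets lebesgue" for i by (simp add: sets_grid_cell sets_completionI_sets)
    have \<tau>_leb: "\<tau> j i \<in> sets lebesgue" for j i unfolding \<tau>_def using T cell_leb by blast
    have T_lm: "T j \<in> lmeasurable" for j using T U bounded_subset bounded_set_imp_lmeasurable by blast
    have g_\<tau>: "g j \<in> borel_measurable (lebesgue_on (\<tau> j i))" for j i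
      using g measurable_restrict_mono[of "g j" lebesgue "T j" borel "\<tau> j i"] by (simp add: \<tau>_def)
    have F_meas: "F j \<in> borel_measurable (lebesgue_on X)" if "X \<in> sets lebesgue" for j X
      by (rule continuous_imp_measurable_on_sets_lebesgue[OF C11_bounded_continuous]) (use F that in auto)
    have T_Un: "T j = (\<Union>i\<in>I. \<tau> j i)" for j using T by (auto simp: \<tau>_def I_def)
    have decomp: "(LINT x|lebesgue_on (T j). f x) = (\<Sum>i\<in>I. LINT x|lebesgue_on (\<tau> j i). f x)"
      if f: "integrable (lebesgue_on (T j)) f" for j and f :: "real ^ 'm \<Rightarrow> 'c::{banach, second_countable_topology}"
    proof -
      have set_int: "set_integrable lebesgue (T j) f" using f T by (simp add: integrable_restrict_space set_integrable_def)
      have "(LINT x|lebesgue_on (T j). f x) = (LINT x:(\<Union>i\<in>I. \<tau> j i)|lebesgue. f x)"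
        using T by (simp add: integral_restrict_space set_lebesgue_integral_def flip: T_Un)
      also have "\<dots> = (\<Sum>i\<in>I. LINT x:\<tau> j i|lebesgue. f x)"
      proof (rule set_integral_finite_Union[OF finI])
        show "disjoint_family_on (\<tau> j) I" by (auto simp: disjoint_family_on_def \<tau>_def)
        show "set_integrable lebesgue (\<tau> j i) f" for i
          by (rule set_integrable_subset[OF set_int \<tau>_leb]) (auto simp: \<tau>_def)
      qed (rule \<tau>_leb)
      finally show ?thesis using \<tau>_leb by (simp add: integral_restrict_space set_lebesgue_integral_def)
    qed
    define z where "z \<xi> j i = (osc_int (\<tau> j i) (g j) (F j) \<xi>)" for \<xi> j i
    have z_sum: "(osc_int (T j) (g j) (F j) \<xi>) = (\<Sum>i\<in>I. z \<xi> j i)" for \<xi> j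
      unfolding z_def
    proof (rule decomp)
      have [measurable]: "g j \<in> borel_measurable (lebesgue_on (T j))" "F j \<in> borel_measurable (lebesgue_on (T j))"
        using g F_meas T by auto
      show "integrable (lebesgue_on (T j)) (\<lambda>x. g j x * cis (\<xi> \<bullet> F j x))"
        by (rule finite_measure.integrable_const_bound[OF finite_measure_lebesgue_on[OF T_lm], of _ G])
           (use g in \<open>auto simp: norm_mult\<close>)
    qed
    have z_meas [measurable]: "(\<lambda>\<xi>. z \<xi> j i) \<in> borel_measurable borel" for j i
    proof -
      have "\<tau> j i \<in> lmeasurable"
        using \<tau>_leb T U bounded_subset[of U "\<tau> j i"] by (intro bounded_set_imp_lmeasurable) (auto simp: \<tau>_def)
      then show ?thesis unfolding z_def
        by (intro measurable_oscillatory_integral g_\<tau> F_meas[OF \<tau>_leb]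
            finite_measure.axioms(1)[OF finite_measure_lebesgue_on])
    qed
    define Q where "Q = (\<Prod>j\<in>UNIV. (L2_mass (T j) (g j)) powr \<theta>)"
    have Q0: "Q \<ge> 0" unfolding Q_def by (intro prod_nonneg) auto
    have piece: "ball_integral R (\<lambda>\<xi>. \<Prod>j\<in>UNIV. norm (z \<xi> j (\<sigma> j)) powr (2 * \<theta>))
        \<le> ennreal (C1 * R powr \<epsilon> * Q)" for \<sigma>
    proof (cases "\<forall>j. \<tau> j (\<sigma> j) \<noteq> {}")
      case False
      then obtain j where j: "\<tau> j (\<sigma> j) = {}" by blast
      have "z \<xi> j (\<sigma> j) = 0" for \<xi> unfolding z_def j by (simp add: integral_restrict_space)
      then have zero: "(\<Prod>j\<in>UNIV. norm (z \<xi> j (\<sigma> j)) powr (2 * \<theta>)) = 0" for \<xi>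
        by (intro prod_zero) (auto intro!: bexI[of _ j])
      show ?thesis unfolding zero by simp
    next
      case True
      then have "\<forall>j. \<exists>x. x \<in> \<tau> j (\<sigma> j)" by blast
      from choice[OF this] obtain x0 where x0: "\<And>j. x0 j \<in> \<tau> j (\<sigma> j)" by blast
      have "ball_integral R (\<lambda>\<xi>. \<Prod>j\<in>UNIV. norm (z \<xi> j (\<sigma> j)) powr (2 * \<theta>))
        \<le> ennreal (C1 * R powr \<epsilon> * (\<Prod>j\<in>UNIV. (L2_mass (\<tau> j (\<sigma> j)) (g j)) powr \<theta>))"
        unfolding z_def
      proof (rule loc[OF F, of x0 "\<lambda>j. \<tau> j (\<sigma> j)" g G R])
        show "wedge_det F x0 \<ge> \<nu>" using wd x0 by (auto simp: \<tau>_def)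
        show "\<forall>j. \<tau> j (\<sigma> j) \<in> sets lebesgue \<and> \<tau> j (\<sigma> j) \<subseteq> ball (x0 j) \<kappa>"
        proof (intro allI conjI \<tau>_leb subsetI)
          fix j x assume "x \<in> \<tau> j (\<sigma> j)"
          then have "grid_index \<delta> (x0 j) = grid_index \<delta> x" using x0[of j] by (simp add: \<tau>_def)
          then have "norm (x0 j - x) \<le> CARD('m) * \<delta>" by (rule grid_index_eq_imp_close[OF _ \<delta>(1)])
          then show "x \<in> ball (x0 j) \<kappa>" using \<delta>(2) by (simp add: dist_norm)
        qed
      qed (use g g_\<tau> R in auto)
      also have "\<dots> \<le> ennreal (C1 * R powr \<epsilon> * Q)"
      proof (intro ennreal_leI mult_left_mono)
        show "(\<Prod>j\<in>UNIV. (L2_mass (\<tau> j (\<sigma> j)) (g j)) powr \<theta>) \<le> Q"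
          unfolding Q_def
        proof (intro prod_mono conjI powr_mono2)
          fix j
          have [measurable]: "g j \<in> borel_measurable (lebesgue_on (T j))" using g by auto
          have g2: "integrable (lebesgue_on (T j)) (\<lambda>x. (norm (g j x))\<^sup>2)"
            by (rule finite_measure.integrable_const_bound[OF finite_measure_lebesgue_on[OF T_lm], of _ "G\<^sup>2"])
               (use g in \<open>auto intro!: power_mono\<close>)
          show "(L2_mass (\<tau> j (\<sigma> j)) (g j)) \<le> (L2_mass (T j) (g j))"
          proof (cases "\<sigma> j \<in> I")
            case True
            then show ?thesis unfolding decomp[OF g2] using finI by (intro member_le_sum) auto
          next
            case False
            moreover have "x0 j \<in> U" "grid_index \<delta> (x0 j) = \<sigma> j" using x0[of j] T by (auto simp: \<tau>_def)
            ultimately show ?thesis unfolding I_def by (metis imageI)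
          qed
        qed (use \<theta> in auto)
      qed (use C1 in auto)
      finally show ?thesis .
    qed
    have "ball_integral R (\<lambda>\<xi>. \<Prod>j\<in>UNIV. norm (\<Sum>i\<in>I. z \<xi> j i) powr (2 * \<theta>))
       \<le> ennreal (c * (nI * (C1 * R powr \<epsilon> * Q)))"
      unfolding c_def nI_def using \<theta> C1 Q0 by (intro ball_integral_sum_le finI piece z_meas) auto
    also have "\<dots> \<le> ennreal (C * R powr \<epsilon> * Q)"
      using Q0 by (intro ennreal_leI) (simp add: C_def algebra_simps)
    finally show "ball_integral R (\<lambda>\<xi>. \<Prod>j\<in>UNIV. norm (osc_int (T j) (g j) (F j) \<xi>) powr (2 * \<theta>))
     \<le> ennreal (C * R powr \<epsilon> * (\<Prod>j\<in>UNIV. (L2_mass (T j) (g j)) powr \<theta>))"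
      unfolding z_sum Q_def .
  qed
qed

section \<open>Dyadic level sets\<close>

text \<open>
  Level \<open>0\<close> collects the values up to \<open>1\<close>, level \<open>k\<close> those in \<open>(2\<^sup>k\<^sup>-\<^sup>1, 2\<^sup>k]\<close>, and the last level \<open>Suc L\<close> everything
  above \<open>2\<^sup>L\<close>.
\<close>

definition dyadic_level :: "nat \<Rightarrow> real \<Rightarrow> nat" where
  "dyadic_level L y = min (Suc L) (if y \<le> 1 then 0 else nat \<lceil>log 2 y\<rceil>)"

definition dyadic_part :: "nat \<Rightarrow> nat \<Rightarrow> complex \<Rightarrow> complex" where
  "dyadic_part L k z = (if dyadic_level L (norm z) = k then z else 0)"

lemma dyadic_level_le: "dyadic_level L y \<le> Suc L"
  by (simp add: dyadic_level_def)

lemma dyadic_level_upper: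
  assumes "dyadic_level L y = k" "k \<le> L"
  shows "y \<le> 2 powr real k"
proof (cases "y \<le> 1")
  case True
  have "1 \<le> 2 powr real k" by (rule ge_one_powr_ge_zero) auto
  then show ?thesis using True by linarith
next
  case False
  then have "nat \<lceil>log 2 y\<rceil> = k" using assms by (auto simp: dyadic_level_def min_def split: if_splits)
  then have "log 2 y \<le> real k" by linarith
  then show ?thesis using False by (subst (asm) log_le_iff) auto
qed

lemma dyadic_level_lower:
  assumes "dyadic_level L y = Suc k"
  shows "2 powr real k < y"
proof -
  have y: "\<not> y \<le> 1" "Suc k \<le> nat \<lceil>log 2 y\<rceil>" using assms by (auto simp: dyadic_level_def min_def split: if_splits)
  then have "real k < log 2 y" by linarith
  then show ?thesis using y by (subst (asm) less_log_iff) auto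
qed

lemma dyadic_part_sum:
  "z = (\<Sum>k\<le>Suc L. dyadic_part L k z)"
  using dyadic_level_le[of L "norm z"] by (simp add: dyadic_part_def)

lemma measurable_dyadic_part [measurable]:
  "dyadic_part L k \<in> borel_measurable borel"
proof -
  have [measurable]: "Measurable.pred borel (\<lambda>z :: complex. dyadic_level L (norm z) = k)"
    unfolding dyadic_level_def by measurable
  show ?thesis unfolding dyadic_part_def by measurable
qed

lemma norm_dyadic_part_le: "norm (dyadic_part L k z) \<le> norm z"
  by (simp add: dyadic_part_def)

lemma norm_dyadic_part_upper: "k \<le> L \<Longrightarrow> norm (dyadic_part L k z) \<le> 2 powr real k"
  using dyadic_level_upper[of L "norm z" k] by (simp add: dyadic_part_def)

lemma le_one_plus_powr:
  fixes y :: real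
  assumes "y \<ge> 0" "P \<ge> 1"
  shows "y \<le> 1 + y powr P"
proof (cases "y \<le> 1")
  case False
  then have "y powr 1 \<le> y powr P" using assms by (intro powr_mono) auto
  then show ?thesis using False by simp
qed (simp add: add_increasing2)

text \<open>
  The levels up to \<open>L\<close> are bounded functions on sets whose measure Chebyshev's inequality controls; the
  tail is small in \<open>L\<^sup>1\<close> because \<open>P > 1\<close>.
\<close>

locale dyadic_decomposition = finite_measure M for M :: "'a measure" +
  fixes g :: "'a \<Rightarrow> complex" and P B m :: real
  assumes g [measurable]: "g \<in> borel_measurable M"
    and P: "1 < P" "P \<le> 2"
    and int_P: "integrable M (\<lambda>x. norm (g x) powr P)"
    and B: "(LINT x|M. norm (g x) powr P) \<le> B"
    and m: "measure M (space M) \<le> m"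
begin

lemma B_nonneg: "B \<ge> 0"
proof -
  have "0 \<le> (LINT x|M. norm (g x) powr P)" by (intro integral_nonneg_AE) auto
  then show ?thesis using B by linarith
qed

lemma integrable_g: "integrable M g"
proof (rule Bochner_Integration.integrable_bound)
  show "integrable M (\<lambda>x. 1 + norm (g x) powr P)" using int_P by simp
  show "AE x in M. norm (g x) \<le> norm (1 + norm (g x) powr P)"
  proof (rule AE_I2)
    show "norm (g x) \<le> norm (1 + norm (g x) powr P)" for x
      using le_one_plus_powr[of "norm (g x)" P] P by simp
  qed
qed (rule g)

lemma integrable_part: "integrable M (\<lambda>x. dyadic_part L k (g x))"
  by (rule Bochner_Integration.integrable_bound[OF integrable_g]) (auto intro: norm_dyadic_part_le)

lemma L1_part_le: "(LINT x|M. norm (dyadic_part L k (g x))) \<le> m + B"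
proof -
  have "(LINT x|M. norm (dyadic_part L k (g x))) \<le> (LINT x|M. 1 + norm (g x) powr P)"
    using integrable_part int_P P
    by (intro integral_mono integrable_norm) (auto intro: order_trans[OF norm_dyadic_part_le le_one_plus_powr])
  also have "\<dots> = measure M (space M) + (LINT x|M. norm (g x) powr P)" using int_P by simp
  finally show ?thesis using B m by linarith
qed

lemma L1_tail_le: "(LINT x|M. norm (dyadic_part L (Suc L) (g x))) \<le> 2 powr (- real L * (P - 1)) * B"
proof -
  have "(LINT x|M. norm (dyadic_part L (Suc L) (g x))) \<le> (LINT x|M. 2 powr (- real L * (P - 1)) * norm (g x) powr P)"
  proof (intro integral_mono integrable_norm integrable_part integrable_mult_right int_P)
    fix x
    show "norm (dyadic_part L (Suc L) (g x)) \<le> 2 powr (- real L * (P - 1)) * norm (g x) powr P"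
    proof (cases "dyadic_level L (norm (g x)) = Suc L")
      case True
      let ?y = "norm (g x)"
      have y: "2 powr real L < ?y" by (rule dyadic_level_lower[OF True])
      have "(2 powr real L) powr (P - 1) \<le> ?y powr (P - 1)" using y P by (intro powr_mono2) auto
      then have "2 powr (real L * (P - 1)) \<le> ?y powr (P - 1)" by (simp add: powr_powr)
      then have le: "2 powr (- real L * (P - 1)) * (2 powr (real L * (P - 1)) * ?y) \<le> 2 powr (- real L * (P - 1)) * (?y powr (P - 1) * ?y)"
        by (intro mult_left_mono mult_right_mono) auto
      have lhs: "2 powr (- real L * (P - 1)) * (2 powr (real L * (P - 1)) * ?y) = ?y"
        by (simp add: mult.assoc[symmetric] powr_add[symmetric])
      have rhs: "?y powr (P - 1) * ?y = ?y powr P"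
        using powr_add[of ?y "P - 1" 1] by simp
      show ?thesis using le[unfolded lhs rhs] True by (simp only: dyadic_part_def if_True simp_thms)
    qed (simp add: dyadic_part_def)
  qed
  also have "\<dots> \<le> 2 powr (- real L * (P - 1)) * B" using B by (simp add: mult_left_mono)
  finally show ?thesis .
qed

lemma level_bounds:
  assumes k: "k \<le> L"
  obtains \<mu> where "0 \<le> \<mu>" "\<mu> \<le> (4 * B + m) * 2 powr (- real k * P)"
    "(LINT x|M. norm (dyadic_part L k (g x))) \<le> 2 powr real k * \<mu>"
    "(LINT x|M. (norm (dyadic_part L k (g x)))\<^sup>2) \<le> (2 powr real k)\<^sup>2 * \<mu>"
proof -
  define E where "E = {x \<in> space M. dyadic_level L (norm (g x)) = k}"
  have [measurable]: "E \<in> sets M" unfolding E_def dyadic_level_def by measurable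
  define \<mu> where "\<mu> = measure M E"
  have indE: "norm (dyadic_part L k (g x)) \<le> 2 powr real k * indicator E x" if "x \<in> space M" for x
    using norm_dyadic_part_upper[OF k, of "g x"] that by (auto simp: E_def dyadic_part_def indicator_def)
  have intE: "integrable M (\<lambda>x. c * indicator E x)" for c :: real
    by (intro integrable_mult_right integrable_real_indicator) (auto simp: less_top[symmetric])
  have part_int: "integrable M (\<lambda>x. norm (dyadic_part L k (g x)))" using integrable_part by simp
  have 1: "(LINT x|M. norm (dyadic_part L k (g x))) \<le> 2 powr real k * \<mu>"
  proof -
    have "(LINT x|M. norm (dyadic_part L k (g x))) \<le> (LINT x|M. 2 powr real k * indicator E x)"
      by (intro integral_mono part_int intE indE)
    then show ?thesis by (simp add: \<mu>_def)
  qed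
  have 2: "(LINT x|M. (norm (dyadic_part L k (g x)))\<^sup>2) \<le> (2 powr real k)\<^sup>2 * \<mu>"
  proof -
    have sq: "(norm (dyadic_part L k (g x)))\<^sup>2 \<le> (2 powr real k)\<^sup>2 * indicator E x" if "x \<in> space M" for x
    proof (cases "x \<in> E")
      case True
      then show ?thesis using power_mono[OF indE[OF that], of 2] by simp
    next
      case False
      then show ?thesis using that by (simp add: E_def dyadic_part_def)
    qed
    have "(LINT x|M. (norm (dyadic_part L k (g x)))\<^sup>2) \<le> (LINT x|M. (2 powr real k)\<^sup>2 * indicator E x)"
    proof (intro integral_mono intE sq)
      show "integrable M (\<lambda>x. (norm (dyadic_part L k (g x)))\<^sup>2)"
        by (rule integrable_const_bound[of _ "(2 powr real k)\<^sup>2"])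
           (auto intro!: power_mono norm_dyadic_part_upper k)
    qed
    then show ?thesis by (simp add: \<mu>_def)
  qed
  have 3: "\<mu> \<le> (4 * B + m) * 2 powr (- real k * P)"
  proof (cases k)
    case 0
    have "\<mu> \<le> measure M (space M)" unfolding \<mu>_def by (intro finite_measure_mono) (auto simp: E_def)
    then show ?thesis using 0 m B_nonneg by simp
  next
    case (Suc k')
    have "2 powr (real k' * P) * \<mu> = (LINT x|M. 2 powr (real k' * P) * indicator E x)" by (simp add: \<mu>_def)
    also have "\<dots> \<le> (LINT x|M. norm (g x) powr P)"
    proof (intro integral_mono intE int_P)
      fix x
      show "2 powr (real k' * P) * indicator E x \<le> norm (g x) powr P"
      proof (cases "x \<in> E")
        case True
        then have "2 powr real k' < norm (g x)" using dyadic_level_lower Suc by (auto simp: E_def)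
        then have "(2 powr real k') powr P \<le> norm (g x) powr P" using P by (intro powr_mono2) auto
        then show ?thesis using True by (simp add: powr_powr)
      qed simp
    qed
    finally have "2 powr (real k' * P) * \<mu> \<le> B" using B by linarith
    then have le: "2 powr (- real k * P) * 2 powr P * (2 powr (real k' * P) * \<mu>) \<le> 2 powr (- real k * P) * 2 powr P * B"
      by (intro mult_left_mono) auto
    have lhs: "2 powr (- real k * P) * 2 powr P * (2 powr (real k' * P) * \<mu>) = \<mu>"
    proof -
      have "- real k * P + P + real k' * P = 0" by (simp add: Suc algebra_simps)
      then have "2 powr (- real k * P) * 2 powr P * 2 powr (real k' * P) = (1::real)"
        unfolding powr_add[symmetric] by (simp only: powr_zero_eq_one) simp
      then show ?thesis by (simp only: mult.assoc[symmetric] mult_1_left)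
    qed
    have "2 powr (- real k * P) * 2 powr P * B \<le> 2 powr (- real k * P) * 4 * B"
      using powr_mono[of P 2 "2::real"] P B_nonneg by (intro mult_right_mono mult_left_mono) auto
    with le lhs have "\<mu> \<le> 2 powr (- real k * P) * 4 * B" by linarith
    moreover have "2 powr (- real k * P) * m \<ge> 0"
      using order_trans[OF measure_nonneg m] by (intro mult_nonneg_nonneg) auto
    moreover have "(4 * B + m) * 2 powr (- real k * P) = 2 powr (- real k * P) * 4 * B + 2 powr (- real k * P) * m"
      by (simp add: algebra_simps)
    ultimately show ?thesis by linarith
  qed
  have "0 \<le> \<mu>" by (simp add: \<mu>_def)
  then show thesis using 1 2 3 that by blast
qed

text \<open>
  On level \<open>k\<close>, with \<open>\<mu>\<close> the measure of its support, the two integrals are at most \<open>2\<^sup>k \<mu>\<close> and \<open>4\<^sup>k \<mu>\<close>. The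
  powers combine to \<open>2\<close> to the power \<open>k Q\<close> times \<open>\<mu>\<close> to the power \<open>Q - \<theta>\<close>, and since \<open>P (Q - \<theta>) = Q\<close> this is
  bounded when \<open>\<mu>\<close> is at most a multiple of \<open>2\<close> to the power \<open>- k P\<close>: the exponent \<open>P\<close> is exactly the one at
  which no level is preferred.
\<close>

lemma interpolated_level_bound:
  assumes k: "k \<le> L" and \<theta>: "\<theta> > 0" and Q: "2 * \<theta> \<le> Q" and PQ: "P * (Q - \<theta>) = Q"
  shows "(LINT x|M. norm (dyadic_part L k (g x))) powr (Q - 2 * \<theta>) * (LINT x|M. (norm (dyadic_part L k (g x)))\<^sup>2) powr \<theta>
    \<le> (4 * B + m) powr (Q - \<theta>)"
proof -
  obtain \<mu> where \<mu>: "0 \<le> \<mu>" "\<mu> \<le> (4 * B + m) * 2 powr (- real k * P)"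
    "(LINT x|M. norm (dyadic_part L k (g x))) \<le> 2 powr real k * \<mu>"
    "(LINT x|M. (norm (dyadic_part L k (g x)))\<^sup>2) \<le> (2 powr real k)\<^sup>2 * \<mu>"
    using level_bounds[OF k] by blast
  have m0: "m \<ge> 0" using m measure_nonneg[of M "space M"] by linarith
  have "(LINT x|M. norm (dyadic_part L k (g x))) powr (Q - 2 * \<theta>) * (LINT x|M. (norm (dyadic_part L k (g x)))\<^sup>2) powr \<theta>
    \<le> (2 powr real k * \<mu>) powr (Q - 2 * \<theta>) * ((2 powr real k)\<^sup>2 * \<mu>) powr \<theta>"
    using \<theta> Q \<mu>(3,4) by (intro mult_mono powr_mono2) (auto intro!: integral_nonneg_AE)
  also have "\<dots> = 2 powr (real k * Q) * \<mu> powr (Q - \<theta>)"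
  proof -
    have "((2 powr real k)\<^sup>2) powr \<theta> = 2 powr (real k * (2 * \<theta>))" by (subst power2_powr) (auto simp: powr_powr)
    then have "(2 powr real k * \<mu>) powr (Q - 2 * \<theta>) * ((2 powr real k)\<^sup>2 * \<mu>) powr \<theta>
      = (2 powr (real k * (Q - 2 * \<theta>)) * 2 powr (real k * (2 * \<theta>))) * (\<mu> powr (Q - 2 * \<theta>) * \<mu> powr \<theta>)"
      using \<mu>(1) by (simp add: powr_mult powr_powr)
    also have "\<dots> = 2 powr (real k * Q) * \<mu> powr (Q - \<theta>)"
    proof -
      have "real k * (Q - 2 * \<theta>) + real k * (2 * \<theta>) = real k * Q" by (simp add: algebra_simps)
      moreover have "Q - 2 * \<theta> + \<theta> = Q - \<theta>" by simp
      ultimately show ?thesis by (simp only: powr_add[symmetric])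
    qed
    finally show ?thesis .
  qed
  also have "\<dots> \<le> 2 powr (real k * Q) * ((4 * B + m) * 2 powr (- real k * P)) powr (Q - \<theta>)"
    using \<mu>(1,2) Q \<theta> by (intro mult_left_mono powr_mono2) auto
  also have "\<dots> = 2 powr (real k * Q) * (2 powr (- real k * (P * (Q - \<theta>))) * (4 * B + m) powr (Q - \<theta>))"
    using B_nonneg m0 by (simp add: powr_mult powr_powr mult_ac)
  also have "\<dots> = (4 * B + m) powr (Q - \<theta>)"
  proof -
    have "2 powr (real k * Q) * 2 powr (- real k * Q) = (1::real)" by (simp flip: powr_add)
    then show ?thesis unfolding PQ by (simp only: mult.assoc[symmetric] mult_1_left)
  qed
  finally show ?thesis .
qed

end

section \<open>Interpolation\<close>

lemma log_le_powr:
  fixes \<delta> c :: real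
  assumes "\<delta> > 0" "c \<ge> 0"
  shows "\<exists>C>0. \<forall>R\<ge>1. c * log 2 R + 4 \<le> C * R powr \<delta>"
proof (intro exI[of _ "c / (\<delta> * ln 2) + 4"] conjI allI impI)
  show "c / (\<delta> * ln 2) + 4 > 0" using assms by (intro add_nonneg_pos) auto
  fix R :: real assume R: "R \<ge> 1"
  have "ln R \<le> R powr \<delta> / \<delta>" by (rule ln_powr_bound) (use R assms in auto)
  then have "c / ln 2 * ln R \<le> c / ln 2 * (R powr \<delta> / \<delta>)" using assms by (intro mult_left_mono) auto
  then have "c * log 2 R \<le> c / (\<delta> * ln 2) * R powr \<delta>" by (simp add: log_def mult_ac)
  moreover have "1 \<le> R powr \<delta>" using R assms by (intro ge_one_powr_ge_zero) auto
  ultimately show "c * log 2 R + 4 \<le> (c / (\<delta> * ln 2) + 4) * R powr \<delta>" by (simp add: algebra_simps)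
qed

text \<open>
  In the application \<open>Q = q / d\<close>, so the relation between \<open>P\<close> and \<open>Q\<close> says \<open>1 / P = 1 - d / ((d - 1) q)\<close>. For
  a choice of levels without tails, \<open>Q - 2 \<theta>\<close> of the \<open>Q\<close> powers of each factor are bounded by the \<open>L\<^sup>1\<close>
  norm and the remaining \<open>2 \<theta>\<close> are left to the endpoint estimate. A choice with a tail is estimated by
  \<open>L\<^sup>1\<close> norms alone, because the tail gains more than the measure of the ball.
\<close>

theorem multilinear_restriction_Lp:
  fixes A \<nu> \<epsilon> Q P B :: real and U :: "(real ^ 'm::finite) set"
  assumes A: "A > 0" and \<nu>: "\<nu> > 0" and \<epsilon>: "\<epsilon> > 0" and U: "bounded U" and B: "B \<ge> 0"
  defines "\<theta> \<equiv> lw_exponent CARD('m option)"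
  assumes Q: "2 * \<theta> \<le> Q" and P: "1 < P" "P \<le> 2" and PQ: "P * (Q - \<theta>) = Q"
  shows "\<exists>C>0. \<forall>(F :: 'm option \<Rightarrow> real ^ 'm \<Rightarrow> real ^ 'm option) T g R.
     (\<forall>j. C11_bounded A (F j)) \<longrightarrow> (\<forall>j. T j \<in> sets lebesgue \<and> T j \<subseteq> U) \<longrightarrow>
     (\<forall>x. (\<forall>j. x j \<in> T j) \<longrightarrow> wedge_det F x \<ge> \<nu>) \<longrightarrow>
     (\<forall>j. g j \<in> borel_measurable (lebesgue_on (T j)) \<and> integrable (lebesgue_on (T j)) (\<lambda>x. norm (g j x) powr P) \<and>
        (LINT x|lebesgue_on (T j). norm (g j x) powr P) \<le> B) \<longrightarrow> R \<ge> 1 \<longrightarrow>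
     ball_integral R (\<lambda>\<xi>. \<Prod>j\<in>UNIV. norm (osc_int (T j) (g j) (F j) \<xi>) powr Q)
     \<le> ennreal (C * R powr \<epsilon>)"
proof -
  let ?d = "CARD('m option)"
  have \<theta>: "\<theta> > 0" by (simp add: \<theta>_def lw_exponent_def)
  have Q0: "Q > 0" using Q \<theta> by linarith
  have \<epsilon>2: "\<epsilon> / 2 > 0" using \<epsilon> by simp
  obtain C1 where C1: "C1 > 0"
    and L2: "\<And>(F :: 'm option \<Rightarrow> real ^ 'm \<Rightarrow> real ^ 'm option) T g G R.
     (\<forall>j. C11_bounded A (F j)) \<Longrightarrow> (\<forall>j. T j \<in> sets lebesgue \<and> T j \<subseteq> U) \<Longrightarrow>
     (\<forall>x. (\<forall>j. x j \<in> T j) \<longrightarrow> wedge_det F x \<ge> \<nu>) \<Longrightarrow>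
     (\<forall>j. g j \<in> borel_measurable (lebesgue_on (T j)) \<and> (\<forall>x. norm (g j x) \<le> G)) \<Longrightarrow> R \<ge> 1 \<Longrightarrow>
     ball_integral R (\<lambda>\<xi>. \<Prod>j\<in>UNIV. norm (osc_int (T j) (g j) (F j) \<xi>) powr (2 * \<theta>))
     \<le> ennreal (C1 * R powr (\<epsilon> / 2) * (\<Prod>j\<in>UNIV. (L2_mass (T j) (g j)) powr \<theta>))"
    using multilinear_restriction_L2[OF A \<nu> \<epsilon>2 U] unfolding \<theta>_def by blast
  obtain b where b: "U \<subseteq> cball 0 b" using U unfolding bounded_def by (metis (no_types, lifting) U bounded_iff mem_cball_0 subsetI)
  define m where "m = measure lebesgue (cball 0 b :: (real ^ 'm) set)"
  have m0: "m \<ge> 0" by (simp add: m_def)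
  define B1 where "B1 = m + B + 1"
  have B1: "B1 \<ge> 1" using m0 B by (simp add: B1_def)
  define vol where "vol = unit_ball_vol (real DIM(real ^ 'm option))"
  have vol: "vol \<ge> 0" by (simp add: vol_def)
  define C4 where "C4 = C1 * ((4 * B + m) powr (Q - \<theta>)) ^ ?d + (B1 powr Q) ^ ?d * vol"
  have C4: "C4 \<ge> 0" using C1 vol by (simp add: C4_def)
  \<comment> \<open>half of \<open>\<epsilon>\<close> goes to the endpoint estimate, the other half to the number of levels to the power \<open>Q d + d\<close>\<close>
  define \<delta> where "\<delta> = \<epsilon> / (2 * (Q * ?d + ?d))"
  have \<delta>: "\<delta> > 0" using \<epsilon> Q0 by (simp add: \<delta>_def add_pos_pos)
  define c where "c = ?d / ((P - 1) * Q)"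
  have c: "c \<ge> 0" using P Q0 by (simp add: c_def)
  obtain C3 where C3: "C3 > 0" "\<And>R. R \<ge> 1 \<Longrightarrow> c * log 2 R + 4 \<le> C3 * R powr \<delta>"
    using log_le_powr[OF \<delta> c] by blast
  define C where "C = C3 powr (Q * ?d + ?d) * C4 + 1"
  have C: "C > 0" using C4 by (simp add: C_def add_nonneg_pos)
  show ?thesis
  proof (rule exI[of _ C], rule conjI[OF C], intro allI impI)
    fix F :: "'m option \<Rightarrow> real ^ 'm \<Rightarrow> real ^ 'm option" and T and g :: "'m option \<Rightarrow> real ^ 'm \<Rightarrow> complex" and R :: real
    assume F: "\<forall>j. C11_bounded A (F j)" and T: "\<forall>j. T j \<in> sets lebesgue \<and> T j \<subseteq> U"
      and wd: "\<forall>x. (\<forall>j. x j \<in> T j) \<longrightarrow> wedge_det F x \<ge> \<nu>"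
      and g: "\<forall>j. g j \<in> borel_measurable (lebesgue_on (T j)) \<and> integrable (lebesgue_on (T j)) (\<lambda>x. norm (g j x) powr P) \<and>
        (LINT x|lebesgue_on (T j). norm (g j x) powr P) \<le> B" and R: "R \<ge> 1"
    have R0: "R > 0" using R by simp
    have T_lm: "T j \<in> lmeasurable" for j using T U bounded_subset bounded_set_imp_lmeasurable by blast
    interpret dd: dyadic_decomposition "lebesgue_on (T j)" "g j" P B m for j
    proof (intro dyadic_decomposition.intro dyadic_decomposition_axioms.intro finite_measure_lebesgue_on T_lm)
      have "measure lebesgue (T j) \<le> m" unfolding m_def
        by (rule measure_mono_fmeasurable) (use T b in auto)
      then show "measure (lebesgue_on (T j)) (space (lebesgue_on (T j))) \<le> m"
        using T by (simp add: measure_restrict_space)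
    qed (use g P in auto)
    have F_meas: "F j \<in> borel_measurable (lebesgue_on (T j))" for j
      by (rule continuous_imp_measurable_on_sets_lebesgue[OF C11_bounded_continuous]) (use F T in auto)
    \<comment> \<open>the least number of levels for which the tail outweighs the measure \<open>O(R\<^sup>d)\<close> of the ball\<close>
    define L where "L = nat \<lceil>c * log 2 R\<rceil>"
    have logR: "log 2 R \<ge> 0" using R by simp
    have L: "c * log 2 R \<le> real L" "real L \<le> c * log 2 R + 1"
      using c logR mult_nonneg_nonneg[OF c logR] unfolding L_def by linarith+
    define I where "I = {..Suc L}"
    define h where "h k j x = dyadic_part L k (g j x)" for k j x
    have h_meas: "h k j \<in> borel_measurable (lebesgue_on (T j))" for k j
      unfolding h_def using g by (intro measurable_compose[OF _ measurable_dyadic_part]) auto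
    define z where "z \<xi> j k = (osc_int (T j) (h k j) (F j) \<xi>)" for \<xi> j k
    define S where "S j k = (LINT x|lebesgue_on (T j). norm (h k j x))" for j k
    have h_int: "integrable (lebesgue_on (T j)) (h k j)" for k j
      unfolding h_def[abs_def] by (rule dd.integrable_part)
    have hc_int: "integrable (lebesgue_on (T j)) (\<lambda>x. h k j x * cis (\<xi> \<bullet> F j x))" for k j \<xi>
    proof (rule Bochner_Integration.integrable_bound[where f = "h k j"])
      show "integrable (lebesgue_on (T j)) (h k j)" by (rule h_int)
      have [measurable]: "F j \<in> borel_measurable (lebesgue_on (T j))" "h k j \<in> borel_measurable (lebesgue_on (T j))"
        using F_meas h_meas by auto
      show "(\<lambda>x. h k j x * cis (\<xi> \<bullet> F j x)) \<in> borel_measurable (lebesgue_on (T j))" by measurable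
    qed (simp add: norm_mult)
    have z_le: "norm (z \<xi> j k) \<le> S j k" for \<xi> j k
    proof -
      have "norm (z \<xi> j k) \<le> (LINT x|lebesgue_on (T j). norm (h k j x * cis (\<xi> \<bullet> F j x)))"
        unfolding z_def by (rule integral_norm_bound)
      then show ?thesis by (simp add: S_def norm_mult)
    qed
    have S0: "S j k \<ge> 0" for j k unfolding S_def by (intro integral_nonneg_AE) auto
    have z_sum: "(osc_int (T j) (g j) (F j) \<xi>) = (\<Sum>k\<in>I. z \<xi> j k)" for \<xi> j
    proof -
      have "g j x * cis (\<xi> \<bullet> F j x) = (\<Sum>k\<in>I. h k j x * cis (\<xi> \<bullet> F j x))" for x
      proof -
        have "g j x = (\<Sum>k\<in>I. h k j x)" unfolding h_def I_def by (rule dyadic_part_sum)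
        then show ?thesis by (metis sum_distrib_right)
      qed
      then show ?thesis unfolding z_def using hc_int by (simp add: Bochner_Integration.integral_sum)
    qed
    have z_meas [measurable]: "(\<lambda>\<xi>. z \<xi> j k) \<in> borel_measurable borel" for j k
      unfolding z_def
      by (intro measurable_oscillatory_integral h_meas F_meas finite_measure.axioms(1)[OF finite_measure_lebesgue_on] T_lm)
    have [measurable]: "ball 0 R \<in> sets (borel :: (real ^ 'm option) measure)" by simp
    have meas: "(\<lambda>\<xi>. ennreal (\<Prod>j\<in>UNIV. norm (z \<xi> j (\<sigma> j)) powr t) * indicator (ball 0 R) \<xi>) \<in> borel_measurable lborel" for \<sigma> t
      by measurable
    have R\<epsilon>: "R powr (\<epsilon> / 2) \<ge> 1" using R \<epsilon> by (intro ge_one_powr_ge_zero) auto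
    have piece: "ball_integral R (\<lambda>\<xi>. \<Prod>j\<in>UNIV. norm (z \<xi> j (\<sigma> j)) powr Q)
        \<le> ennreal (C4 * R powr (\<epsilon> / 2))" if \<sigma>: "\<sigma> \<in> UNIV \<rightarrow> I" for \<sigma>
    proof (cases "\<forall>j. \<sigma> j \<le> L")
      case True
      define W where "W = (\<Prod>j\<in>UNIV. S j (\<sigma> j) powr (Q - 2 * \<theta>))"
      have W0: "W \<ge> 0" unfolding W_def by (intro prod_nonneg) auto
      have "ball_integral R (\<lambda>\<xi>. \<Prod>j\<in>UNIV. norm (z \<xi> j (\<sigma> j)) powr Q)
         \<le> (\<integral>\<^sup>+\<xi>. ennreal W * (ennreal (\<Prod>j\<in>UNIV. norm (z \<xi> j (\<sigma> j)) powr (2 * \<theta>)) * indicator (ball 0 R) \<xi>) \<partial>lborel)"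
      proof (rule nn_integral_mono)
        fix \<xi>
        have "norm (z \<xi> j (\<sigma> j)) powr Q \<le> S j (\<sigma> j) powr (Q - 2 * \<theta>) * norm (z \<xi> j (\<sigma> j)) powr (2 * \<theta>)" for j
        proof -
          have "norm (z \<xi> j (\<sigma> j)) powr Q = norm (z \<xi> j (\<sigma> j)) powr (Q - 2 * \<theta>) * norm (z \<xi> j (\<sigma> j)) powr (2 * \<theta>)"
            by (simp add: powr_add[symmetric])
          also have "\<dots> \<le> S j (\<sigma> j) powr (Q - 2 * \<theta>) * norm (z \<xi> j (\<sigma> j)) powr (2 * \<theta>)"
            using z_le Q by (intro mult_right_mono powr_mono2) auto
          finally show ?thesis .
        qed
        then have "(\<Prod>j\<in>UNIV. norm (z \<xi> j (\<sigma> j)) powr Q) \<le> W * (\<Prod>j\<in>UNIV. norm (z \<xi> j (\<sigma> j)) powr (2 * \<theta>))"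
          unfolding W_def prod.distrib[symmetric] by (intro prod_mono) auto
        then have "ennreal (\<Prod>j\<in>UNIV. norm (z \<xi> j (\<sigma> j)) powr Q) \<le> ennreal W * ennreal (\<Prod>j\<in>UNIV. norm (z \<xi> j (\<sigma> j)) powr (2 * \<theta>))"
          using W0 by (simp add: ennreal_mult[symmetric] prod_nonneg ennreal_leI)
        then show "ennreal (\<Prod>j\<in>UNIV. norm (z \<xi> j (\<sigma> j)) powr Q) * indicator (ball 0 R) \<xi>
          \<le> ennreal W * (ennreal (\<Prod>j\<in>UNIV. norm (z \<xi> j (\<sigma> j)) powr (2 * \<theta>)) * indicator (ball 0 R) \<xi>)"
          by (simp add: mult.assoc[symmetric] mult_right_mono)
      qed
      also have "\<dots> = ennreal W * ball_integral R (\<lambda>\<xi>. \<Prod>j\<in>UNIV. norm (z \<xi> j (\<sigma> j)) powr (2 * \<theta>))"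
        by (rule nn_integral_cmult[OF meas])
      also have "\<dots> \<le> ennreal W * ennreal (C1 * R powr (\<epsilon> / 2) * (\<Prod>j\<in>UNIV. (L2_mass (T j) (h (\<sigma> j) j)) powr \<theta>))"
        unfolding z_def
      proof (intro mult_left_mono L2[OF F T wd, of "\<lambda>j. h (\<sigma> j) j" "2 powr real L" R] allI conjI h_meas R)
        fix j x
        have "norm (h (\<sigma> j) j x) \<le> 2 powr real (\<sigma> j)" unfolding h_def using True by (intro norm_dyadic_part_upper) auto
        also have "\<dots> \<le> 2 powr real L" using True by (intro powr_mono) auto
        finally show "norm (h (\<sigma> j) j x) \<le> 2 powr real L" .
      qed simp
      also have "\<dots> = ennreal (C1 * R powr (\<epsilon> / 2) * (\<Prod>j\<in>UNIV. S j (\<sigma> j) powr (Q - 2 * \<theta>) * (L2_mass (T j) (h (\<sigma> j) j)) powr \<theta>))"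
        using W0 C1 by (simp add: ennreal_mult[symmetric] prod_nonneg W_def prod.distrib mult_ac)
      also have "\<dots> \<le> ennreal (C1 * R powr (\<epsilon> / 2) * (\<Prod>j\<in>(UNIV :: 'm option set). (4 * B + m) powr (Q - \<theta>)))"
      proof (intro ennreal_leI mult_left_mono prod_mono conjI)
        fix j
        show "S j (\<sigma> j) powr (Q - 2 * \<theta>) * (L2_mass (T j) (h (\<sigma> j) j)) powr \<theta> \<le> (4 * B + m) powr (Q - \<theta>)"
          unfolding S_def h_def using True \<theta> Q PQ by (intro dd.interpolated_level_bound) auto
      qed (use C1 in auto)
      also have "\<dots> \<le> ennreal (C4 * R powr (\<epsilon> / 2))"
        using vol by (intro ennreal_leI) (simp add: C4_def algebra_simps)
      finally show ?thesis .
    next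
      case False
      then obtain i where i: "\<sigma> i = Suc L" using \<sigma> by (force simp: I_def Pi_iff not_le le_Suc_eq)
      define t where "t = 2 powr (- real L * (P - 1))"
      have t0: "t \<ge> 0" by (simp add: t_def)
      have S_le: "S j k \<le> B1" for j k using dd.L1_part_le[of j L k] by (simp add: S_def h_def B1_def)
      have S_i: "S i (\<sigma> i) \<le> t * B1"
      proof -
        have "S i (\<sigma> i) \<le> t * B" using dd.L1_tail_le[of i L] by (simp add: S_def h_def i t_def)
        also have "\<dots> \<le> t * B1" using t0 m0 by (intro mult_left_mono) (auto simp: B1_def)
        finally show ?thesis .
      qed
      have UNIV_i: "UNIV = insert i (- {i})" by auto
      have prod_le: "(\<Prod>j\<in>UNIV. norm (z \<xi> j (\<sigma> j)) powr Q) \<le> t powr Q * (B1 powr Q) ^ ?d" for \<xi>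
      proof -
        have "(\<Prod>j\<in>UNIV. norm (z \<xi> j (\<sigma> j)) powr Q) \<le> (\<Prod>j\<in>UNIV. (if j = i then t powr Q else 1) * B1 powr Q)"
        proof (intro prod_mono conjI)
          fix j
          show "norm (z \<xi> j (\<sigma> j)) powr Q \<le> (if j = i then t powr Q else 1) * B1 powr Q"
          proof (cases "j = i")
            case True
            have "norm (z \<xi> j (\<sigma> j)) powr Q \<le> (t * B1) powr Q"
              using True S_i z_le[of \<xi> j "\<sigma> j"] Q0 by (intro powr_mono2) auto
            then show ?thesis using True t0 B1 by (simp add: powr_mult)
          next
            case False
            then show ?thesis using S_le[of j "\<sigma> j"] z_le[of \<xi> j "\<sigma> j"] Q0 by (simp add: powr_mono2)
          qed
        qed simp
        also have "\<dots> = t powr Q * (B1 powr Q) ^ ?d"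
          by (simp only: prod.distrib prod.delta[OF finite] prod_constant UNIV_I if_True)
        finally show ?thesis .
      qed
      have t_R: "t powr Q * R ^ ?d \<le> 1"
      proof -
        have "R ^ ?d = 2 powr (log 2 R * ?d)" using R0 by (simp only: powr_powr[symmetric] powr_log_cancel powr_realpow)
        also have "\<dots> \<le> 2 powr (real L * (P - 1) * Q)"
        proof (rule powr_mono)
          have "c * log 2 R * ((P - 1) * Q) \<le> real L * ((P - 1) * Q)" using L P Q0 by (intro mult_right_mono) auto
          moreover have "c * log 2 R * ((P - 1) * Q) = log 2 R * ?d" using P Q0 unfolding c_def by (simp only: mult_ac) (simp add: field_simps)
          ultimately show "log 2 R * ?d \<le> real L * (P - 1) * Q" by (simp only: mult.assoc)
        qed simp
        finally have "t powr Q * R ^ ?d \<le> t powr Q * 2 powr (real L * (P - 1) * Q)" by (intro mult_left_mono) auto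
        also have "\<dots> = 1" by (simp add: t_def powr_powr flip: powr_add)
        finally show ?thesis .
      qed
      have "ball_integral R (\<lambda>\<xi>. \<Prod>j\<in>UNIV. norm (z \<xi> j (\<sigma> j)) powr Q)
         \<le> (\<integral>\<^sup>+\<xi>. ennreal (t powr Q * (B1 powr Q) ^ ?d) * indicator (ball 0 R) (\<xi> :: real ^ 'm option) \<partial>lborel)"
        by (intro nn_integral_mono mult_right_mono ennreal_leI prod_le) auto
      also have "\<dots> = ennreal (t powr Q * (B1 powr Q) ^ ?d) * emeasure lborel (ball 0 R :: (real ^ 'm option) set)"
        by (rule nn_integral_cmult_indicator) simp
      also have "\<dots> = ennreal (t powr Q * (B1 powr Q) ^ ?d * (vol * R ^ ?d))"
        using R0 vol by (simp add: emeasure_ball vol_def ennreal_mult)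
      also have "\<dots> \<le> ennreal (C4 * R powr (\<epsilon> / 2))"
      proof (rule ennreal_leI)
        have "t powr Q * (B1 powr Q) ^ ?d * (vol * R ^ ?d) = (t powr Q * R ^ ?d) * ((B1 powr Q) ^ ?d * vol)" by (simp only: mult_ac)
        also have "\<dots> \<le> 1 * ((B1 powr Q) ^ ?d * vol)" using t_R vol by (intro mult_right_mono) auto
        also have "\<dots> \<le> C4 * 1" using C1 by (simp add: C4_def)
        also have "\<dots> \<le> C4 * R powr (\<epsilon> / 2)" using R\<epsilon> C4 by (intro mult_left_mono)
        finally show "t powr Q * (B1 powr Q) ^ ?d * (vol * R ^ ?d) \<le> C4 * R powr (\<epsilon> / 2)" .
      qed
      finally show ?thesis .
    qed
    define X where "X = C4 * R powr (\<epsilon> / 2)"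
    have X0: "X \<ge> 0" using C4 by (simp add: X_def)
    define cI where "cI = (real (card I) powr Q) ^ ?d"
    have cI0: "cI \<ge> 0" by (simp add: cI_def)
    have finI: "finite I" by (simp add: I_def)
    have "ball_integral R (\<lambda>\<xi>. \<Prod>j\<in>UNIV. norm (\<Sum>i\<in>I. z \<xi> j i) powr Q) \<le> ennreal (cI * (real (card I) ^ ?d * X))"
      unfolding cI_def using Q0 X0 by (intro ball_integral_sum_le finI z_meas) (auto simp: X_def intro!: piece)
    also have "\<dots> \<le> ennreal (C * R powr \<epsilon>)"
    proof (rule ennreal_leI)
      have cI_pos: "real (card I) > 0" by (simp add: I_def)
      have "real (card I) = real L + 2" by (simp add: I_def)
      also have "\<dots> \<le> C3 * R powr \<delta>" using L C3(2)[OF R] by linarith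
      finally have card_le: "real (card I) \<le> C3 * R powr \<delta>" .
      have "cI * real (card I) ^ ?d = real (card I) powr (Q * ?d + ?d)"
        using cI_pos by (simp only: cI_def powr_add powr_powr[symmetric] of_nat_power powr_realpow powr_gt_zero)
      also have "\<dots> \<le> (C3 * R powr \<delta>) powr (Q * ?d + ?d)"
        using card_le cI_pos Q0 by (intro powr_mono2) auto
      also have "\<dots> = C3 powr (Q * ?d + ?d) * R powr (\<delta> * (Q * ?d + ?d))"
        using C3 by (subst powr_mult) (auto simp: powr_powr)
      also have "\<delta> * (Q * ?d + ?d) = \<epsilon> / 2"
      proof -
        have "Q * ?d + ?d > 0" using Q0 by (intro add_pos_pos) auto
        then show ?thesis by (simp only: \<delta>_def) (simp add: field_simps)
      qed
      finally have "cI * real (card I) ^ ?d * X \<le> C3 powr (Q * ?d + ?d) * R powr (\<epsilon> / 2) * X"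
        using X0 by (rule mult_right_mono)
      also have "\<dots> = C3 powr (Q * ?d + ?d) * C4 * (R powr (\<epsilon> / 2) * R powr (\<epsilon> / 2))" by (simp only: X_def mult_ac)
      also have "R powr (\<epsilon> / 2) * R powr (\<epsilon> / 2) = R powr \<epsilon>" by (simp flip: powr_add)
      also have "C3 powr (Q * ?d + ?d) * C4 * R powr \<epsilon> \<le> C * R powr \<epsilon>" by (intro mult_right_mono) (auto simp: C_def)
      finally show "cI * (real (card I) ^ ?d * X) \<le> C * R powr \<epsilon>" by (simp only: mult.assoc)
    qed
    finally show "ball_integral R (\<lambda>\<xi>. \<Prod>j\<in>UNIV. norm (osc_int (T j) (g j) (F j) \<xi>) powr Q) \<le> ennreal (C * R powr \<epsilon>)"
      unfolding z_sum .
  qed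
qed

section \<open>Extensions of class C2 and their derivatives\<close>

lemma C2_norm_extension:
  fixes S :: "real ^ 'm::finite \<Rightarrow> 'b::real_normed_vector" and A :: real
  assumes "C2_norm U S \<le> ennreal A" "A > 0"
  obtains F where "C11_bounded (CARD('m) * (A + 1)) F" "\<And>x. x \<in> U \<Longrightarrow> F x = S x"
proof -
  have "ennreal A < ennreal (A + 1)" using assms by (intro ennreal_lessI) auto
  then have "C2_norm U S < ennreal (A + 1)" using assms by (rule_tac le_less_trans)
  then obtain F where F: "Ck_on 2 UNIV F" "\<And>x. x \<in> U \<Longrightarrow> F x = S x" and le: "C2_norm_global F < ennreal (A + 1)"
    unfolding C2_norm_def INF_less_iff by blast
  have dF: "F differentiable (at x)" "pderiv_at k F differentiable (at x)" for x k
    using F(1) by (simp_all add: numeral_2_eq_2)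
  have p1: "norm (pderiv_at k F x) \<le> A + 1" for k x
  proof -
    have "ennreal (norm (pderiv_at k F x)) \<le> (SUP x. ennreal (norm (pderiv_at k F x)))" by (rule SUP_upper) simp
    also have "\<dots> \<le> (\<Sum>k\<in>UNIV. SUP x. ennreal (norm (pderiv_at k F x)))" by (rule member_le_sum) auto
    also have "\<dots> \<le> C2_norm_global F" unfolding C2_norm_global_def by (simp add: add.assoc add_increasing add_increasing2)
    also have "\<dots> \<le> ennreal (A + 1)" using le by simp
    finally show ?thesis using assms(2) by (subst (asm) ennreal_le_iff) auto
  qed
  have p2: "norm (pderiv_at l (pderiv_at k F) x) \<le> A + 1" for k l x
  proof -
    have "ennreal (norm (pderiv_at l (pderiv_at k F) x)) \<le> (SUP x. ennreal (norm (pderiv_at l (pderiv_at k F) x)))" by (rule SUP_upper) simp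
    also have "\<dots> \<le> (\<Sum>l\<in>UNIV. SUP x. ennreal (norm (pderiv_at l (pderiv_at k F) x)))" by (rule member_le_sum) auto
    also have "\<dots> \<le> (\<Sum>k\<in>UNIV. \<Sum>l\<in>UNIV. SUP x. ennreal (norm (pderiv_at l (pderiv_at k F) x)))"
      by (rule member_le_sum[of k UNIV "\<lambda>k. \<Sum>l\<in>UNIV. SUP x. ennreal (norm (pderiv_at l (pderiv_at k F) x))"]) auto
    also have "\<dots> \<le> C2_norm_global F" unfolding C2_norm_global_def by (simp add: add_increasing)
    also have "\<dots> \<le> ennreal (A + 1)" using le by simp
    finally show ?thesis using assms(2) by (subst (asm) ennreal_le_iff) auto
  qed
  have card1: "real CARD('m) \<ge> 1" using zero_less_card_finite[where 'a = 'm] by linarith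
  have card_A: "1 * (A + 1) \<le> CARD('m) * (A + 1)" using assms(2) by (intro mult_right_mono card1) auto
  have "norm (pderiv_at k F x - pderiv_at k F y) \<le> (CARD('m) * (A + 1)) * norm (x - y)" for k x y
  proof (rule differentiable_bound[of UNIV "pderiv_at k F" "\<lambda>z h. \<Sum>l\<in>UNIV. h $ l *\<^sub>R pderiv_at l (pderiv_at k F) z"])
    show "onorm (\<lambda>h. \<Sum>l\<in>UNIV. h $ l *\<^sub>R pderiv_at l (pderiv_at k F) z) \<le> CARD('m) * (A + 1)" for z
      by (intro onorm_le norm_sum_components_le p2)
    show "(pderiv_at k F has_derivative (\<lambda>h. \<Sum>l\<in>UNIV. h $ l *\<^sub>R pderiv_at l (pderiv_at k F) z)) (at z within UNIV)" for z
      using has_derivative_sum_pderiv[OF dF(2)] by simp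
  qed auto
  moreover have "norm (pderiv_at k F x) \<le> CARD('m) * (A + 1)" for k x
    using p1[of k x] card_A unfolding mult_1_left by (rule order_trans)
  ultimately have "C11_bounded (CARD('m) * (A + 1)) F" using dF(1) unfolding C11_bounded_def by blast
  then show thesis using that F(2) by blast
qed

text \<open>Arbitrarily many disjoint copies of a bounded set of positive measure do not fit into a ball.\<close>

lemma negligible_disjoint_translates:
  fixes E :: "'a::euclidean_space set"
  assumes E: "bounded E" "E \<in> sets lebesgue"
    and disj: "\<And>x t. x \<in> E \<Longrightarrow> t \<noteq> 0 \<Longrightarrow> x + t *\<^sub>R e \<notin> E"
  shows "negligible E"
proof -
  have El: "E \<in> lmeasurable" by (rule bounded_set_imp_lmeasurable[OF E])
  obtain b where b: "\<And>x. x \<in> E \<Longrightarrow> norm x \<le> b" using E(1) bounded_iff by blast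
  let ?B = "cball 0 (b + norm e) :: 'a set"
  have "real n * measure lebesgue E \<le> measure lebesgue ?B" for n
  proof (cases "n = 0")
    case False
    define v where "v i = (real i / real n) *\<^sub>R e" for i
    have v: "v i - v j = ((real i - real j) / real n) *\<^sub>R e" for i j
      by (simp add: v_def diff_divide_distrib scaleR_diff_left)
    have "real n * measure lebesgue E = (\<Sum>i<n. measure lebesgue ((+) (v i) ` E))" by (simp add: measure_translation)
    also have "\<dots> = measure lebesgue (\<Union>i<n. (+) (v i) ` E)"
    proof (rule measure_UNION'[symmetric])
      show "pairwise (\<lambda>i j. disjnt ((+) (v i) ` E) ((+) (v j) ` E)) {..<n}"
      proof (clarsimp simp: pairwise_def disjnt_iff)
        fix i j x y assume ij: "i \<noteq> j" and "x \<in> E" "y \<in> E" "v i + x = v j + y"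
        then have "y = x + (v i - v j)" by (simp add: algebra_simps)
        then have "x + ((real i - real j) / real n) *\<^sub>R e \<in> E" using \<open>y \<in> E\<close> v by simp
        moreover have "(real i - real j) / real n \<noteq> 0" using ij False by simp
        ultimately show False using disj \<open>x \<in> E\<close> by blast
      qed
    qed (auto intro: measurable_translation El)
    also have "\<dots> \<le> measure lebesgue ?B"
    proof (rule measure_mono_fmeasurable)
      show "(\<Union>i<n. (+) (v i) ` E) \<subseteq> ?B"
      proof clarsimp
        fix i x assume "i < n" "x \<in> E"
        have "norm (v i) = real i / real n * norm e" by (simp add: v_def)
        also have "\<dots> \<le> 1 * norm e" using \<open>i < n\<close> by (intro mult_right_mono) auto
        finally show "norm (v i + x) \<le> b + norm e" using b[OF \<open>x \<in> E\<close>] norm_triangle_ineq[of "v i" x] by linarith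
      qed
      show "(\<Union>i<n. (+) (v i) ` E) \<in> sets lebesgue"
        using measurable_translation[OF El] by (intro sets.finite_UN) auto
    qed auto
    finally show ?thesis .
  qed simp
  moreover have "measure lebesgue E \<ge> 0" by simp
  ultimately have "measure lebesgue E = 0"
    by (metis linorder_not_le order_le_less reals_Archimedean3)
  then show ?thesis using El negligible_iff_measure by blast
qed

text \<open>
  The transversality condition concerns the derivatives of \<open>S\<close>, whereas the norm of \<open>C\<^sup>2(U)\<close> controls those
  of an extension \<open>F\<close> of the restriction of \<open>S\<close> to \<open>U\<close>. At points where \<open>U\<close> is too thin, for instance at
  isolated points, these derivatives may differ. In a small ball around such a point some component
  of \<open>S - F\<close> is strictly monotone in the direction of \<open>k\<close>, while it vanishes on \<open>U\<close>; so inside the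
  ball \<open>U\<close> meets every line in that direction at most once, and the translates of this part of \<open>U\<close>
  along the line are disjoint.
\<close>

lemma negligible_pderiv_neq:
  fixes S F :: "real ^ 'm::finite \<Rightarrow> real ^ 'n::finite"
  assumes U: "U \<in> sets lebesgue" and V: "open V" "U \<subseteq> V" and S: "Ck_on 1 V S" and F: "C11_bounded A F"
    and eq: "\<And>x. x \<in> U \<Longrightarrow> F x = S x"
  shows "negligible {x \<in> U. pderiv_at k S x \<noteq> pderiv_at k F x}"
proof -
  let ?N = "{x \<in> U. pderiv_at k S x \<noteq> pderiv_at k F x}"
  have dF: "F differentiable (at x)" for x using F by (simp add: C11_bounded_def)
  have dS: "S differentiable (at x)" if "x \<in> V" for x using S that by simp
  have cS: "continuous_on V (pderiv_at k S)" using S by simp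
  have cF: "continuous_on V (pderiv_at k F)"
  proof (rule lipschitz_on_continuous_on[of "\<bar>A\<bar>"], rule lipschitz_onI)
    fix x y :: "real ^ 'm"
    have "norm (pderiv_at k F x - pderiv_at k F y) \<le> A * norm (x - y)" using F by (simp add: C11_bounded_def)
    also have "\<dots> \<le> \<bar>A\<bar> * norm (x - y)" by (intro mult_right_mono) auto
    finally show "dist (pderiv_at k F x) (pderiv_at k F y) \<le> \<bar>A\<bar> * dist x y" by (simp add: dist_norm)
  qed simp
  have "\<exists>W. openin (top_of_set ?N) W \<and> x \<in> W \<and> negligible W" if x: "x \<in> ?N" for x
  proof -
    obtain i where i: "pderiv_at k S x $ i \<noteq> pderiv_at k F x $ i" using x by (auto simp: vec_eq_iff)
    define c where "c y = pderiv_at k S y $ i - pderiv_at k F y $ i" for y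
    have c_cont: "continuous_on V c" unfolding c_def by (intro continuous_intros cS cF)
    have xV: "x \<in> V" using x V by auto
    have "open (- {0 :: real})" by (rule open_Compl[OF closed_singleton])
    then have "open (c -` (- {0}) \<inter> V)" using c_cont continuous_on_open_vimage[OF V(1)] by blast
    moreover have "x \<in> c -` (- {0}) \<inter> V" using i xV by (simp add: c_def)
    ultimately obtain \<rho> where \<rho>: "\<rho> > 0" "ball x \<rho> \<subseteq> c -` (- {0}) \<inter> V" using open_contains_ball by meson
    define E where "E = U \<inter> ball x \<rho>"
    have "negligible E"
    proof (rule negligible_disjoint_translates[where e = "axis k 1"])
      show "bounded E" unfolding E_def by (intro bounded_Int) auto
      show "E \<in> sets lebesgue" unfolding E_def using U by auto
      fix y t assume y: "y \<in> E" and t: "(t::real) \<noteq> 0"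
      show "y + t *\<^sub>R axis k 1 \<notin> E"
      proof
        assume yt: "y + t *\<^sub>R axis k 1 \<in> E"
        define \<phi> where "\<phi> s = S (y + s *\<^sub>R axis k 1) $ i - F (y + s *\<^sub>R axis k 1) $ i" for s
        have inball: "y + s *\<^sub>R axis k 1 \<in> ball x \<rho>" if s: "s \<in> closed_segment 0 t" for s
        proof -
          obtain u where u: "0 \<le> u" "u \<le> 1" "s = u * t" using s by (auto simp: in_segment)
          have "y + s *\<^sub>R axis k 1 = (1 - u) *\<^sub>R y + u *\<^sub>R (y + t *\<^sub>R axis k 1)" by (simp add: u algebra_simps)
          then show ?thesis using convexD_alt[OF convex_ball, of y x \<rho> "y + t *\<^sub>R axis k 1" u] y yt u by (simp add: E_def)
        qed
        have der: "(\<phi> has_real_derivative c (y + s *\<^sub>R axis k 1)) (at s)" if "s \<in> closed_segment 0 t" for s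
        proof -
          have sV: "y + s *\<^sub>R axis k 1 \<in> V" using inball[OF that] \<rho>(2) by auto
          have inner: "((\<lambda>s. y + s *\<^sub>R axis k 1) has_derivative (\<lambda>h. h *\<^sub>R axis k 1)) (at s)"
            by (auto intro!: derivative_eq_intros)
          have sum_axis: "(\<Sum>l\<in>UNIV. (h *\<^sub>R axis k 1 :: real ^ 'm) $ l *\<^sub>R pderiv_at l G z) = h *\<^sub>R pderiv_at k G z" for h z and G :: "real ^ 'm \<Rightarrow> real ^ 'n"
          proof -
            have "(\<Sum>l\<in>UNIV. (h *\<^sub>R axis k 1 :: real ^ 'm) $ l *\<^sub>R pderiv_at l G z) = (\<Sum>l\<in>UNIV. if l = k then h *\<^sub>R pderiv_at k G z else 0)"
              by (intro sum.cong) (auto simp: axis_def)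
            then show ?thesis by simp
          qed
          have "((\<lambda>s. S (y + s *\<^sub>R axis k 1)) has_derivative (\<lambda>h. h *\<^sub>R pderiv_at k S (y + s *\<^sub>R axis k 1))) (at s)"
            using has_derivative_compose[OF inner has_derivative_sum_pderiv[OF dS[OF sV]]] by (simp only: sum_axis)
          moreover have "((\<lambda>s. F (y + s *\<^sub>R axis k 1)) has_derivative (\<lambda>h. h *\<^sub>R pderiv_at k F (y + s *\<^sub>R axis k 1))) (at s)"
            using has_derivative_compose[OF inner has_derivative_sum_pderiv[OF dF]] by (simp only: sum_axis)
          ultimately have "((\<lambda>s. S (y + s *\<^sub>R axis k 1) - F (y + s *\<^sub>R axis k 1)) has_derivative (\<lambda>h. h *\<^sub>R (pderiv_at k S (y + s *\<^sub>R axis k 1) - pderiv_at k F (y + s *\<^sub>R axis k 1)))) (at s)"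
            using has_derivative_diff by (fastforce simp: scaleR_diff_right)
          then have "((\<lambda>s. (S (y + s *\<^sub>R axis k 1) - F (y + s *\<^sub>R axis k 1)) $ i) has_derivative (\<lambda>h. (h *\<^sub>R (pderiv_at k S (y + s *\<^sub>R axis k 1) - pderiv_at k F (y + s *\<^sub>R axis k 1))) $ i)) (at s)"
            by (rule bounded_linear.has_derivative[OF bounded_linear_vec_nth])
          then show ?thesis unfolding \<phi>_def[abs_def] c_def has_field_derivative_def by (simp add: mult_commute_abs)
        qed
        have "\<phi> 0 = 0" "\<phi> t = 0" using eq y yt by (auto simp: \<phi>_def E_def)
        moreover have "\<exists>s\<in>closed_segment 0 t. c (y + s *\<^sub>R axis k 1) = 0" if "a < b" "closed_segment 0 t = {a..b}" "\<phi> a = \<phi> b" for a b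
        proof -
          have "\<exists>s>a. s < b \<and> DERIV \<phi> s :> 0"
          proof (rule Rolle[OF that(1,3)])
            show "continuous_on {a..b} \<phi>"
              using der that(2) by (intro DERIV_continuous_on[of _ _ "\<lambda>s. c (y + s *\<^sub>R axis k 1)"]) (auto intro: has_field_derivative_at_within)
            show "\<phi> differentiable (at s)" if "a < s" "s < b" for s
              using der[of s] that \<open>closed_segment 0 t = {a..b}\<close> real_differentiable_def by auto
          qed
          then obtain s where s: "a < s" "s < b" "DERIV \<phi> s :> 0" by blast
          then have "s \<in> closed_segment 0 t" using that by simp
          then show ?thesis using DERIV_unique[OF s(3) der] by metis
        qed
        ultimately obtain s where s: "s \<in> closed_segment 0 t" "c (y + s *\<^sub>R axis k 1) = 0"
        proof (cases "t > 0")
          case True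
          then show ?thesis using that \<open>\<phi> 0 = 0\<close> \<open>\<phi> t = 0\<close>
            \<open>\<And>a b. a < b \<Longrightarrow> closed_segment 0 t = {a..b} \<Longrightarrow> \<phi> a = \<phi> b \<Longrightarrow> \<exists>s\<in>closed_segment 0 t. c (y + s *\<^sub>R axis k 1) = 0\<close>[of 0 t]
            by (auto simp: closed_segment_eq_real_ivl)
        next
          case False
          then show ?thesis using that t \<open>\<phi> 0 = 0\<close> \<open>\<phi> t = 0\<close>
            \<open>\<And>a b. a < b \<Longrightarrow> closed_segment 0 t = {a..b} \<Longrightarrow> \<phi> a = \<phi> b \<Longrightarrow> \<exists>s\<in>closed_segment 0 t. c (y + s *\<^sub>R axis k 1) = 0\<close>[of t 0]
            by (auto simp: closed_segment_eq_real_ivl)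
        qed
        then show False using inball[OF s(1)] \<rho>(2) by auto
      qed
    qed
    then have "negligible (?N \<inter> ball x \<rho>)" by (rule negligible_subset) (auto simp: E_def)
    moreover have "openin (top_of_set ?N) (?N \<inter> ball x \<rho>)" by (intro openin_open_Int) auto
    ultimately show ?thesis using x \<rho> by (intro exI[of _ "?N \<inter> ball x \<rho>"]) auto
  qed
  then show ?thesis by (subst locally_negligible_alt) blast
qed

section \<open>Lebesgue norms\<close>

lemma Lp_norm_le:
  assumes "(\<integral>\<^sup>+x. ennreal (norm (f x) powr r) \<partial>M) \<le> ennreal X" "X \<ge> 0" "r > 0"
  shows "Lp_norm M (ennreal r) f \<le> ennreal (X powr (1 / r))"
proof -
  let ?I = "\<integral>\<^sup>+x. ennreal (norm (f x) powr r) \<partial>M"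
  have "?I < \<infinity>" using assms(1) ennreal_less_top le_less_trans by (metis infinity_ennreal_def)
  then have I: "?I \<noteq> \<infinity>" by simp
  have "enn2real ?I \<le> X" using assms(1,2) by (simp add: enn2real_leI)
  then have "enn2real ?I powr (1 / r) \<le> X powr (1 / r)" using assms by (intro powr_mono2) auto
  then show ?thesis using I assms(3) by (simp add: Lp_norm_def Let_def ennreal_leI)
qed

text \<open>
  A function of norm one in \<open>L\<^sup>p\<close> has an integrable \<open>P\<close>-th power for \<open>P \<le> p\<close>, with a bound that depends on the
  measure of the space only, because \<open>t\<^sup>P \<le> 1 + t\<^sup>p\<close>. This treats all \<open>p\<close>, including \<open>\<infinity>\<close>, alike.
\<close>

lemma Lp_norm_cases:
  fixes f :: "'a \<Rightarrow> complex"
  assumes f: "f \<in> Lp_space M p" and M: "finite_measure M" and p: "1 \<le> p"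
  shows "Lp_norm M p f = 0 \<Longrightarrow> AE x in M. f x = 0"
    and "\<lbrakk>0 < lam; Lp_norm M p f = ennreal lam; 1 \<le> P; ennreal P \<le> p\<rbrakk> \<Longrightarrow>
      integrable M (\<lambda>x. norm (f x / of_real lam) powr P) \<and>
      (LINT x|M. norm (f x / of_real lam) powr P) \<le> measure M (space M) + 1"
proof -
  interpret finite_measure M by (rule M)
  have fm [measurable]: "f \<in> borel_measurable M" and fin: "Lp_norm M p f < \<infinity>" using f by (auto simp: Lp_space_def)
  show "AE x in M. f x = 0" if z: "Lp_norm M p f = 0"
  proof (cases "p = \<infinity>")
    case True
    then have "AE x in M. ennreal (norm (f x)) \<le> 0" using z esssup_AE[of "\<lambda>x. ennreal (norm (f x))" M] by (simp add: Lp_norm_def)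
    then show ?thesis by simp
  next
    case False
    define r where "r = enn2real p"
    let ?I = "\<integral>\<^sup>+x. ennreal (norm (f x) powr r) \<partial>M"
    have I: "?I \<noteq> \<infinity>" "ennreal (enn2real ?I powr (1 / r)) = 0"
      using z False by (auto simp: Lp_norm_def r_def Let_def split: if_splits)
    then have "enn2real ?I = 0" by (simp add: ennreal_eq_0_iff)
    then have "?I = 0" using I(1) by (simp add: enn2real_eq_0_iff)
    then have "AE x in M. ennreal (norm (f x) powr r) = 0" by (subst (asm) nn_integral_0_iff_AE) auto
    then show ?thesis by (auto simp: ennreal_eq_0_iff)
  qed
  assume lam: "0 < lam" and L: "Lp_norm M p f = ennreal lam" and P: "1 \<le> P" "ennreal P \<le> p"
  let ?h = "\<lambda>x. norm (f x / of_real lam)"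
  have hm [measurable]: "?h \<in> borel_measurable M" by measurable
  have nn: "(\<integral>\<^sup>+x. ennreal (?h x powr P) \<partial>M) \<le> ennreal (measure M (space M) + 1)"
  proof (cases "p = \<infinity>")
    case True
    then have "AE x in M. ennreal (norm (f x)) \<le> ennreal lam" using L esssup_AE[of "\<lambda>x. ennreal (norm (f x))" M] by (simp add: Lp_norm_def)
    then have "AE x in M. ennreal (?h x powr P) \<le> 1"
    proof eventually_elim
      case (elim x)
      then have "?h x \<le> 1" using lam by (simp add: norm_divide)
      then have "?h x powr P \<le> 1 powr P" using P by (intro powr_mono2) auto
      then show ?case by simp
    qed
    then have "(\<integral>\<^sup>+x. ennreal (?h x powr P) \<partial>M) \<le> (\<integral>\<^sup>+x. 1 \<partial>M)" by (rule nn_integral_mono_AE)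
    also have "\<dots> = ennreal (measure M (space M))" by (simp add: emeasure_eq_measure)
    also have "\<dots> \<le> ennreal (measure M (space M) + 1)" by (rule ennreal_leI) simp
    finally show ?thesis .
  next
    case False
    define r where "r = enn2real p"
    have pr: "p = ennreal r" using False by (simp add: r_def less_top)
    have r: "P \<le> r" "r > 0" using P p unfolding pr by (auto simp: ennreal_le_iff2)
    let ?I = "\<integral>\<^sup>+x. ennreal (norm (f x) powr r) \<partial>M"
    have I: "?I \<noteq> \<infinity>" "enn2real ?I powr (1 / r) = lam"
      using L False lam by (auto simp: Lp_norm_def r_def Let_def split: if_splits)
    have Ir: "enn2real ?I = lam powr r"
    proof -
      have "lam powr r = enn2real ?I powr (1 / r * r)" unfolding I(2)[symmetric] powr_powr ..
      then show ?thesis using r by simp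
    qed
    have "(\<integral>\<^sup>+x. ennreal (?h x powr P) \<partial>M) \<le> (\<integral>\<^sup>+x. 1 + ennreal (norm (f x) powr r) * ennreal (lam powr - r) \<partial>M)"
    proof (rule nn_integral_mono)
      fix x
      have "?h x powr P \<le> 1 + ?h x powr r"
      proof (cases "?h x \<le> 1")
        case True
        then have "?h x powr P \<le> 1 powr P" using P by (intro powr_mono2) auto
        then show ?thesis by (simp add: add_increasing2)
      next
        case False
        then have "?h x powr P \<le> ?h x powr r" using r by (intro powr_mono) auto
        then show ?thesis by simp
      qed
      also have "?h x powr r = norm (f x) powr r * lam powr - r"
        using lam by (simp add: norm_divide powr_divide powr_minus_divide)
      finally have "ennreal (?h x powr P) \<le> ennreal (1 + norm (f x) powr r * lam powr - r)" by (rule ennreal_leI)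
      then show "ennreal (?h x powr P) \<le> 1 + ennreal (norm (f x) powr r) * ennreal (lam powr - r)"
        by (simp add: ennreal_mult)
    qed
    also have "\<dots> = emeasure M (space M) + ?I * ennreal (lam powr - r)"
      by (subst nn_integral_add) (auto simp: nn_integral_multc)
    also have "\<dots> = ennreal (measure M (space M)) + ennreal (lam powr r) * ennreal (lam powr - r)"
      using I(1) Ir by (simp add: emeasure_eq_measure) (metis ennreal_enn2real_if infinity_ennreal_def)
    also have "\<dots> = ennreal (measure M (space M) + 1)"
      using lam by (simp add: ennreal_mult[symmetric] powr_add[symmetric])
    finally show ?thesis .
  qed
  have int: "integrable M (\<lambda>x. ?h x powr P)"
    by (rule integrableI_bounded) (use nn le_less_trans in \<open>auto simp: infinity_ennreal_def less_top[symmetric] top_unique\<close>)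
  moreover have "(LINT x|M. ?h x powr P) \<le> measure M (space M) + 1"
  proof -
    have "ennreal (LINT x|M. ?h x powr P) \<le> ennreal (measure M (space M) + 1)"
      using nn by (subst nn_integral_eq_integral[OF int, symmetric]) auto
    then show ?thesis by (subst (asm) ennreal_le_iff) (auto intro: add_nonneg_nonneg)
  qed
  ultimately show "integrable M (\<lambda>x. ?h x powr P) \<and> (LINT x|M. ?h x powr P) \<le> measure M (space M) + 1" by blast
qed

lemma integral_diff_negligible:
  fixes f :: "'a::euclidean_space \<Rightarrow> 'b::{banach, second_countable_topology}"
  assumes N: "negligible N" and U: "U \<in> sets lebesgue" and f: "integrable (lebesgue_on U) f"
  shows "integrable (lebesgue_on (U - N)) f" "(LINT x|lebesgue_on (U - N). f x) = (LINT x|lebesgue_on U. f x)"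
proof -
  have N': "N \<in> null_sets lebesgue" using N by (simp add: negligible_iff_null_sets)
  then have UN: "U - N \<in> sets lebesgue" using U by (blast dest: null_setsD2)
  have si: "set_integrable lebesgue U f" using f U by (simp add: integrable_restrict_space set_integrable_def)
  then have si': "set_integrable lebesgue (U - N) f" by (rule set_integrable_subset[OF _ UN]) auto
  then show "integrable (lebesgue_on (U - N)) f" using UN by (simp add: integrable_restrict_space set_integrable_def)
  have "(LINT x:(U - N)|lebesgue. f x) = (LINT x:U|lebesgue. f x)"
    unfolding set_lebesgue_integral_def
  proof (rule integral_cong_AE)
    show "AE x in lebesgue. indicator (U - N) x *\<^sub>R f x = indicator U x *\<^sub>R f x"
      using AE_not_in[OF N'] by eventually_elim (simp add: indicator_def)
  qed (use si si' in \<open>auto simp: set_integrable_def\<close>)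
  then show "(LINT x|lebesgue_on (U - N). f x) = (LINT x|lebesgue_on U. f x)"
    using U UN by (simp add: integral_restrict_space set_lebesgue_integral_def)
qed

text \<open>
  With \<open>y = (d - 1) q / d\<close>, the hypothesis on \<open>p\<close> says that \<open>p\<close> is at least the exponent conjugate to \<open>y\<close>.
\<close>

lemma exponent_of_conj_exponent_le:
  assumes p: "1 \<le> p" and le: "conj_exponent p \<le> ennreal y" and y: "y \<ge> 2"
  shows "ennreal (y / (y - 1)) \<le> p"
proof (cases p)
  case (real r)
  then have r: "r \<ge> 1" using p by (simp add: ennreal_ge_1)
  have "conj_exponent p = inverse (ennreal (1 - 1 / r))"
    using real r by (simp add: conj_exponent_def inverse_ennreal ennreal_minus[symmetric] divide_inverse)
  then have inv: "inverse (ennreal (1 - 1 / r)) \<le> ennreal y" using le by simp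
  have "1 - 1 / r > 0"
  proof (rule ccontr)
    assume "\<not> 1 - 1 / r > 0"
    then have "ennreal (1 - 1 / r) = 0" by (simp add: ennreal_eq_0_iff)
    then show False using inv by (simp add: top_unique)
  qed
  moreover from this inv have "1 / (1 - 1 / r) \<le> y" using y by (simp add: inverse_ennreal divide_inverse ennreal_le_iff)
  ultimately have "y / (y - 1) \<le> r" using r y by (simp add: field_simps)
  then show ?thesis using real by (simp add: ennreal_leI)
qed simp

lemma nn_integral_lebesgue_on_ball:
  fixes f :: "real ^ 'n::finite \<Rightarrow> ennreal"
  shows "(\<integral>\<^sup>+\<xi>. f \<xi> \<partial>lebesgue_on (ball 0 R)) = (\<integral>\<^sup>+\<xi>. f \<xi> * indicator (ball 0 R) \<xi> \<partial>lborel)"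
  by (simp add: nn_integral_restrict_space nn_integral_completion)

section \<open>Multilinear restriction\<close>

text \<open>
  Removing null sets from the \<open>U j\<close> turns the hypotheses into those of \<open>multilinear_restriction_Lp\<close> and leaves
  the extension operators unchanged.
\<close>

lemma extension_reduction:
  fixes U :: "'m::finite option \<Rightarrow> (real ^ 'm) set" and S :: "'m option \<Rightarrow> real ^ 'm \<Rightarrow> real ^ 'm option"
    and A \<nu> :: real
  assumes U: "\<And>j. compact (U j)" and A: "A > 0"
    and S: "\<And>j. smooth_parametrisation (U j) (S j)"
    and wd: "\<And>x. (\<And>j. x j \<in> U j) \<Longrightarrow> wedge_det S x \<ge> \<nu>"
    and C2: "\<And>j. C2_norm (U j) (S j) \<le> ennreal A"
  obtains F T where "\<And>j. C11_bounded (CARD('m) * (A + 1)) (F j)" "\<And>j. T j \<in> sets lebesgue \<and> T j \<subseteq> U j"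
    "\<And>x. (\<And>j. x j \<in> T j) \<Longrightarrow> wedge_det F x \<ge> \<nu>"
    "\<And>j g \<xi>. integrable (lebesgue_on (U j)) g \<Longrightarrow>
       extension_op (U j) (S j) g \<xi> = osc_int (T j) g (F j) \<xi>"
    "\<And>j f. integrable (lebesgue_on (U j)) f \<Longrightarrow>
       integrable (lebesgue_on (T j)) f \<and> (LINT x|lebesgue_on (T j). f x :: real) = (LINT x|lebesgue_on (U j). f x)"
proof -
  have "\<forall>j. \<exists>F. C11_bounded (CARD('m) * (A + 1)) F \<and> (\<forall>x\<in>U j. F x = S j x)"
  proof
    fix j
    obtain F where "C11_bounded (CARD('m) * (A + 1)) F" "\<And>x. x \<in> U j \<Longrightarrow> F x = S j x"
      by (rule C2_norm_extension[OF C2[of j] A]) blast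
    then show "\<exists>F. C11_bounded (CARD('m) * (A + 1)) F \<and> (\<forall>x\<in>U j. F x = S j x)" by blast
  qed
  from choice[OF this] obtain F where F: "\<And>j. C11_bounded (CARD('m) * (A + 1)) (F j)"
    and FS: "\<And>j x. x \<in> U j \<Longrightarrow> F j x = S j x" by blast
  have U_leb: "U j \<in> sets lebesgue" for j using U lmeasurable_compact by blast
  define N where "N j = (\<Union>k\<in>UNIV. {x \<in> U j. pderiv_at k (S j) x \<noteq> pderiv_at k (F j) x})" for j
  have N: "negligible (N j)" for j
  proof -
    obtain V where V: "open V" "U j \<subseteq> V" "smooth_map_on V (S j)"
      using S[of j] by (auto simp: smooth_parametrisation_def)
    have "negligible {x \<in> U j. pderiv_at k (S j) x \<noteq> pderiv_at k (F j) x}" for k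
      using V(3) by (intro negligible_pderiv_neq[OF U_leb V(1,2) _ F FS]) (auto simp: smooth_map_on_def)
    then show ?thesis unfolding N_def by (intro negligible_Union) auto
  qed
  define T where "T j = U j - N j" for j
  have T: "T j \<in> sets lebesgue \<and> T j \<subseteq> U j" for j
    using U_leb N unfolding T_def by (auto dest: negligible_imp_sets)
  have F_cont: "continuous_on X (F j)" for X j by (rule C11_bounded_continuous[OF F])
  show thesis
  proof (rule that[OF F T])
    fix x :: "'m option \<Rightarrow> real ^ 'm" assume x: "\<And>j. x j \<in> T j"
    have "wedge_field (S j) (x j) = wedge_field (F j) (x j)" for j
    proof -
      have "pderiv_at k (S j) (x j) = pderiv_at k (F j) (x j)" for k using x[of j] by (auto simp: T_def N_def)
      then have "tangent_frame_with (S j) (x j) v = tangent_frame_with (F j) (x j) v" for v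
        by (auto simp: tangent_frame_with_def vec_eq_iff split: option.split)
      then show ?thesis by (simp add: wedge_field_def)
    qed
    moreover have "wedge_det S x \<ge> \<nu>" by (rule wd) (use x in \<open>auto simp: T_def\<close>)
    ultimately show "wedge_det F x \<ge> \<nu>" by (simp add: wedge_det_def)
  next
    fix j \<xi> and g :: "real ^ 'm \<Rightarrow> complex" assume g: "integrable (lebesgue_on (U j)) g"
    have Fm [measurable]: "F j \<in> borel_measurable (lebesgue_on (U j))"
      by (rule continuous_imp_measurable_on_sets_lebesgue[OF F_cont U_leb])
    have gm [measurable]: "g \<in> borel_measurable (lebesgue_on (U j))" using g by auto
    have gc: "integrable (lebesgue_on (U j)) (\<lambda>x. g x * cis (\<xi> \<bullet> F j x))"
      by (rule Bochner_Integration.integrable_bound[OF g]) (auto simp: norm_mult)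
    have "extension_op (U j) (S j) g \<xi> = osc_int (U j) g (F j) \<xi>"
      unfolding extension_op_def
      by (intro Bochner_Integration.integral_cong refl) (simp add: FS cis_conv_exp)
    also have "\<dots> = osc_int (T j) g (F j) \<xi>"
      unfolding T_def by (rule integral_diff_negligible(2)[OF N U_leb gc, symmetric])
    finally show "extension_op (U j) (S j) g \<xi> = osc_int (T j) g (F j) \<xi>" .
  next
    fix j and f :: "real ^ 'm \<Rightarrow> real" assume f: "integrable (lebesgue_on (U j)) f"
    show "integrable (lebesgue_on (T j)) f \<and> (LINT x|lebesgue_on (T j). f x) = (LINT x|lebesgue_on (U j). f x)"
      unfolding T_def using integral_diff_negligible[OF N U_leb f] by blast
  qed
qed

lemma Lp_norm_zero: "Lp_norm M p (\<lambda>_. 0 :: complex) = 0"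
proof -
  have "esssup M (\<lambda>x. 0 :: ennreal) \<le> 0" by (intro esssup_I) auto
  then show ?thesis by (simp add: Lp_norm_def)
qed

lemma integrable_of_integrable_powr:
  fixes h :: "'a \<Rightarrow> complex"
  assumes "finite_measure M" "h \<in> borel_measurable M" "integrable M (\<lambda>x. norm (h x) powr P)" "P \<ge> 1"
  shows "integrable M h"
proof (rule Bochner_Integration.integrable_bound)
  interpret finite_measure M by fact
  show "integrable M (\<lambda>x. 1 + norm (h x) powr P)" using assms(3) by simp
  show "AE x in M. norm (h x) \<le> norm (1 + norm (h x) powr P)"
  proof (rule AE_I2)
    show "norm (h x) \<le> norm (1 + norm (h x) powr P)" for x using le_one_plus_powr[of "norm (h x)" P] assms(4) by simp
  qed
qed (rule assms(2))

theorem theorem1p16: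
  fixes d :: nat and A \<nu> \<epsilon> :: real and p q :: ennreal
    and U :: "'m::finite option \<Rightarrow> (real ^ 'm) set"
  assumes "d = CARD('m option)"
    and "A > 0" and "\<nu> > 0"
    and "\<And>j. compact (U j)" and "\<And>j. 0 \<in> interior (U j)"
    and "\<epsilon> > 0"
    and "ennreal (2 * real d / (real d - 1)) \<le> q"
    and "1 \<le> p"
    and "conj_exponent p \<le> ennreal ((real d - 1) / real d) * q"
  shows "\<exists>C::real. C > 0 \<and>
    (\<forall>S :: 'm option \<Rightarrow> real ^ 'm \<Rightarrow> real ^ 'm option.
      (\<forall>j. smooth_parametrisation (U j) (S j)) \<longrightarrow>
      (\<forall>x. (\<forall>j. x j \<in> U j) \<longrightarrow> wedge_det S x \<ge> \<nu>) \<longrightarrow>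
      (\<forall>j. C2_norm (U j) (S j) \<le> ennreal A) \<longrightarrow>
      (\<forall>(g :: 'm option \<Rightarrow> real ^ 'm \<Rightarrow> complex) (R::real).
        (\<forall>j. g j \<in> Lp_space (lebesgue_on (U j)) p) \<longrightarrow> R \<ge> 1 \<longrightarrow>
        Lp_norm (lebesgue_on (ball 0 R)) (q / of_nat d)
          (\<lambda>\<xi>. \<Prod>j\<in>UNIV. extension_op (U j) (S j) (g j) \<xi>)
        \<le> ennreal (C * R powr \<epsilon>) * (\<Prod>j\<in>UNIV. Lp_norm (lebesgue_on (U j)) p (g j))))"
proof -
  let ?d = "CARD('m option)"
  define A' where "A' = CARD('m) * (A + 1)"
  have A': "A' > 0" using assms(2) by (simp add: A'_def)
  have d_m: "?d = Suc CARD('m)" by simp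
  have "CARD('m) \<ge> 1" by (simp add: Suc_le_eq)
  then have d: "real d = real ?d" "real d \<ge> 2" "d > 0" unfolding assms(1) d_m by simp_all
  define B where "B = (\<Sum>j\<in>UNIV. measure lebesgue (U j)) + 1"
  have B1: "B \<ge> 1" unfolding B_def by (simp add: sum_nonneg)
  have U_lm: "U j \<in> lmeasurable" for j using assms(4) lmeasurable_compact by blast
  have U_leb: "U j \<in> sets lebesgue" for j using U_lm by auto
  have finU: "finite_measure (lebesgue_on (U j))" for j by (rule finite_measure_lebesgue_on[OF U_lm])
  have mU: "measure (lebesgue_on (U j)) (space (lebesgue_on (U j))) + 1 \<le> B" for j
  proof -
    have "measure lebesgue (U j) \<le> (\<Sum>j\<in>UNIV. measure lebesgue (U j))" by (rule member_le_sum) auto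
    then show ?thesis using U_leb by (simp add: B_def measure_restrict_space)
  qed
  define U0 where "U0 = (\<Union>j. U j)"
  have U0: "bounded U0" unfolding U0_def by (intro bounded_UN ballI compact_imp_bounded assms(4) finite)
  define good where "good S \<longleftrightarrow> (\<forall>j. smooth_parametrisation (U j) (S j)) \<and>
      (\<forall>x. (\<forall>j. x j \<in> U j) \<longrightarrow> wedge_det S x \<ge> \<nu>) \<and> (\<forall>j. C2_norm (U j) (S j) \<le> ennreal A)" for S
  define \<Phi> where "\<Phi> S g \<xi> = (\<Prod>j\<in>UNIV. extension_op (U j) (S j) (g j) \<xi>)"
    for S :: "'m option \<Rightarrow> real ^ 'm \<Rightarrow> real ^ 'm option" and g :: "'m option \<Rightarrow> real ^ 'm \<Rightarrow> complex" and \<xi>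
  have zero_case: "Lp_norm M r (\<Phi> S g) = 0"
    if g: "g j \<in> Lp_space (lebesgue_on (U j)) p" and z: "Lp_norm (lebesgue_on (U j)) p (g j) = 0" for S g j M r
  proof -
    have "AE x in lebesgue_on (U j). g j x = 0" by (rule Lp_norm_cases(1)[OF g finU assms(8) z])
    then have "extension_op (U j) (S j) (g j) \<xi> = 0" for \<xi>
      unfolding extension_op_def by (intro integral_eq_zero_AE) auto
    then have "\<Phi> S g \<xi> = 0" for \<xi> unfolding \<Phi>_def by (intro prod_zero) auto
    then have "\<Phi> S g = (\<lambda>_. 0)" by auto
    then show ?thesis by (simp add: Lp_norm_zero)
  qed
  \<comment> \<open>Functions of norm zero are treated separately; the others are divided by their norms \<open>lam\<close>.\<close>
  have main: "\<exists>C>0. \<forall>S g R lam. good S \<longrightarrow> (\<forall>j. g j \<in> Lp_space (lebesgue_on (U j)) p) \<longrightarrow> R \<ge> 1 \<longrightarrow>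
     (\<forall>j. 0 < lam j \<and> Lp_norm (lebesgue_on (U j)) p (g j) = ennreal (lam j)) \<longrightarrow>
     Lp_norm (lebesgue_on (ball 0 R)) (q / of_nat d) (\<Phi> S g) \<le> ennreal (C * R powr \<epsilon> * (\<Prod>j\<in>UNIV. lam j))"
  proof (cases "q = \<infinity>")
    case True
    show ?thesis
    proof (intro exI[of _ "B ^ ?d"] conjI allI impI)
      show "B ^ ?d > 0" using B1 by simp
      fix S and g :: "'m option \<Rightarrow> real ^ 'm \<Rightarrow> complex" and R :: real and lam
      assume S: "good S" and g: "\<forall>j. g j \<in> Lp_space (lebesgue_on (U j)) p" and R: "R \<ge> 1"
        and lam: "\<forall>j. 0 < lam j \<and> Lp_norm (lebesgue_on (U j)) p (g j) = ennreal (lam j)"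
      obtain F T where F: "\<And>j. C11_bounded A' (F j)" and T: "\<And>j. T j \<in> sets lebesgue \<and> T j \<subseteq> U j"
        and ext: "\<And>j g \<xi>. integrable (lebesgue_on (U j)) g \<Longrightarrow>
          extension_op (U j) (S j) g \<xi> = osc_int (T j) g (F j) \<xi>"
        by (rule extension_reduction[OF assms(4,2), where S = S and \<nu> = \<nu>, folded A'_def]) (use S in \<open>auto simp: good_def\<close>)
      have gm: "g j \<in> borel_measurable (lebesgue_on (U j))" for j using g by (auto simp: Lp_space_def)
      have unit: "integrable (lebesgue_on (U j)) (\<lambda>x. norm (g j x / of_real (lam j)) powr 1)"
        "(LINT x|lebesgue_on (U j). norm (g j x / of_real (lam j)) powr 1) \<le> B" for j
        using Lp_norm_cases(2)[OF g[rule_format] finU assms(8), of "lam j" j 1] lam assms(8) mU[of j] by force+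
      have g_int: "integrable (lebesgue_on (U j)) (g j)" for j
      proof -
        have "integrable (lebesgue_on (U j)) (\<lambda>x. of_real (lam j) * (g j x / of_real (lam j)))"
          using gm by (intro integrable_mult_right integrable_of_integrable_powr[OF finU _ unit(1)]) auto
        then show ?thesis using lam by (simp add: less_imp_neq[THEN not_sym])
      qed
      have ext_le: "norm (extension_op (U j) (S j) (g j) \<xi>) \<le> lam j * B" for j \<xi>
      proof -
        have "norm (extension_op (U j) (S j) (g j) \<xi>) \<le> (LINT x|lebesgue_on (U j). norm (g j x * exp (\<i> * of_real (\<xi> \<bullet> S j x))))"
          unfolding extension_op_def by (rule integral_norm_bound)
        also have "\<dots> = (LINT x|lebesgue_on (U j). lam j * norm (g j x / of_real (lam j)) powr 1)"
          using lam by (intro Bochner_Integration.integral_cong refl) (auto simp: norm_mult norm_divide less_imp_neq[THEN not_sym] abs_of_pos)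
        also have "\<dots> = lam j * (LINT x|lebesgue_on (U j). norm (g j x / of_real (lam j)) powr 1)"
          by (rule integral_mult_right_zero)
        also have "\<dots> \<le> lam j * B" using unit(2) lam by (intro mult_left_mono) (auto simp: less_imp_le)
        finally show ?thesis .
      qed
      have "norm (\<Phi> S g \<xi>) \<le> B ^ ?d * R powr \<epsilon> * (\<Prod>j\<in>UNIV. lam j)" for \<xi>
      proof -
        have "norm (\<Phi> S g \<xi>) = (\<Prod>j\<in>UNIV. norm (extension_op (U j) (S j) (g j) \<xi>))" by (simp add: \<Phi>_def prod_norm)
        also have "\<dots> \<le> (\<Prod>j\<in>UNIV. lam j * B)" by (intro prod_mono conjI ext_le) auto
        also have "\<dots> = 1 * (B ^ ?d * (\<Prod>j\<in>UNIV. lam j))" by (simp only: prod.distrib prod_constant mult_1_left mult.commute)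
        also have "\<dots> \<le> R powr \<epsilon> * (B ^ ?d * (\<Prod>j\<in>UNIV. lam j))"
          using R assms(6) B1 lam by (intro mult_right_mono ge_one_powr_ge_zero mult_nonneg_nonneg prod_nonneg) (auto simp: less_imp_le)
        finally show ?thesis by (simp only: mult_ac)
      qed
      then have le: "ennreal (norm (\<Phi> S g \<xi>)) \<le> ennreal (B ^ ?d * R powr \<epsilon> * (\<Prod>j\<in>UNIV. lam j))" for \<xi>
        by (rule ennreal_leI)
      have "\<Phi> S g \<in> borel_measurable borel"
      proof -
        have "T j \<in> lmeasurable" for j
          using T U_lm by (meson fmeasurableI2)
        moreover have "g j \<in> borel_measurable (lebesgue_on (T j))" for j
          using measurable_restrict_mono[OF gm] T by auto
        moreover have "F j \<in> borel_measurable (lebesgue_on (T j))" for j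
          using T by (intro continuous_imp_measurable_on_sets_lebesgue[OF C11_bounded_continuous[OF F]]) auto
        ultimately have "(\<lambda>\<xi>. LINT x|lebesgue_on (T j). g j x * cis (\<xi> \<bullet> F j x)) \<in> borel_measurable borel" for j
          by (intro measurable_oscillatory_integral finite_measure.axioms(1)[OF finite_measure_lebesgue_on]) auto
        then show ?thesis unfolding \<Phi>_def[abs_def] ext[OF g_int] by (intro borel_measurable_prod) auto
      qed
      then have "(\<lambda>\<xi>. ennreal (norm (\<Phi> S g \<xi>))) \<in> borel_measurable (lebesgue_on (ball 0 R))"
        by (intro measurable_restrict_space1 measurable_completion) (simp add: measurable_lborel2)
      then have "esssup (lebesgue_on (ball 0 R)) (\<lambda>\<xi>. ennreal (norm (\<Phi> S g \<xi>))) \<le> ennreal (B ^ ?d * R powr \<epsilon> * (\<Prod>j\<in>UNIV. lam j))"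
        using le by (intro esssup_I) auto
      moreover have "q / of_nat d = \<infinity>" using True by (simp add: ennreal_top_divide)
      ultimately show "Lp_norm (lebesgue_on (ball 0 R)) (q / of_nat d) (\<Phi> S g) \<le> ennreal (B ^ ?d * R powr \<epsilon> * (\<Prod>j\<in>UNIV. lam j))"
        by (simp add: Lp_norm_def)
    qed
  next
    case False
    define qr where "qr = enn2real q"
    have qr: "q = ennreal qr" using False by (simp add: qr_def less_top)
    have qr_ge: "2 * real d / (real d - 1) \<le> qr"
    proof -
      have "2 * real d / (real d - 1) > 0" using d by simp
      then show ?thesis using assms(7) unfolding qr by (subst (asm) ennreal_le_iff2) auto
    qed
    have qr0: "qr > 0" using qr_ge d by (smt (verit) divide_pos_pos)
    define \<theta> where "\<theta> = lw_exponent ?d"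
    have \<theta>: "\<theta> = 1 / (real d - 1)" by (simp only: \<theta>_def lw_exponent_def d(1))
    have \<theta>0: "\<theta> > 0" using d by (simp add: \<theta>)
    define Q where "Q = qr / real d"
    have Q0: "Q > 0" using qr0 d by (simp add: Q_def)
    define y where "y = (real d - 1) / real d * qr"
    have y_Q: "y = Q / \<theta>" using d by (simp add: y_def Q_def \<theta>)
    have Q: "2 * \<theta> \<le> Q" using qr_ge d by (simp add: Q_def \<theta> field_simps)
    have y2: "y \<ge> 2" using Q \<theta>0 by (simp add: y_Q field_simps)
    define P where "P = y / (y - 1)"
    have P: "1 < P" "P \<le> 2" using y2 by (simp_all add: P_def field_simps)
    have PQ: "P * (Q - \<theta>) = Q"
    proof -
      have "Q = y * \<theta>" using \<theta>0 by (simp add: y_Q)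
      then show ?thesis using y2 by (simp add: P_def field_simps)
    qed
    have Pp: "ennreal P \<le> p" unfolding P_def
    proof (rule exponent_of_conj_exponent_le[OF assms(8) _ y2])
      show "conj_exponent p \<le> ennreal y" 
      proof -
        have "ennreal y = ennreal ((real d - 1) / real d) * ennreal qr"
          unfolding y_def by (rule ennreal_mult) (use d(2) qr0 in auto)
        then show ?thesis using assms(9) unfolding qr by (simp only:)
      qed
    qed
    have \<epsilon>Q: "\<epsilon> * Q > 0" using assms(6) Q0 by simp
    have B0: "B \<ge> 0" using B1 by simp
    obtain C0 where C0: "C0 > 0" and est: "\<And>(F :: 'm option \<Rightarrow> real ^ 'm \<Rightarrow> real ^ 'm option) T g R.
     (\<forall>j. C11_bounded A' (F j)) \<Longrightarrow> (\<forall>j. T j \<in> sets lebesgue \<and> T j \<subseteq> U0) \<Longrightarrow>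
     (\<forall>x. (\<forall>j. x j \<in> T j) \<longrightarrow> wedge_det F x \<ge> \<nu>) \<Longrightarrow>
     (\<forall>j. g j \<in> borel_measurable (lebesgue_on (T j)) \<and> integrable (lebesgue_on (T j)) (\<lambda>x. norm (g j x) powr P) \<and>
        (LINT x|lebesgue_on (T j). norm (g j x) powr P) \<le> B) \<Longrightarrow> R \<ge> 1 \<Longrightarrow>
     ball_integral R (\<lambda>\<xi>. \<Prod>j\<in>UNIV. norm (osc_int (T j) (g j) (F j) \<xi>) powr Q) \<le> ennreal (C0 * R powr (\<epsilon> * Q))"
      using multilinear_restriction_Lp[OF A' assms(3) \<epsilon>Q U0 B0 Q[unfolded \<theta>_def] P PQ[unfolded \<theta>_def]] by blast
    show ?thesis
    proof (intro exI[of _ "C0 powr (1 / Q)"] conjI allI impI)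
      show "C0 powr (1 / Q) > 0" using C0 by simp
      fix S and g :: "'m option \<Rightarrow> real ^ 'm \<Rightarrow> complex" and R :: real and lam
      assume S: "good S" and g: "\<forall>j. g j \<in> Lp_space (lebesgue_on (U j)) p" and R: "R \<ge> 1"
        and lam: "\<forall>j. 0 < lam j \<and> Lp_norm (lebesgue_on (U j)) p (g j) = ennreal (lam j)"
      obtain F T where F: "\<And>j. C11_bounded A' (F j)" and T: "\<And>j. T j \<in> sets lebesgue \<and> T j \<subseteq> U j"
        and wd: "\<And>x. (\<And>j. x j \<in> T j) \<Longrightarrow> wedge_det F x \<ge> \<nu>"
        and ext: "\<And>j g \<xi>. integrable (lebesgue_on (U j)) g \<Longrightarrow>
          extension_op (U j) (S j) g \<xi> = osc_int (T j) g (F j) \<xi>"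
        and restr: "\<And>j f. integrable (lebesgue_on (U j)) f \<Longrightarrow>
          integrable (lebesgue_on (T j)) f \<and> (LINT x|lebesgue_on (T j). f x :: real) = (LINT x|lebesgue_on (U j). f x)"
        by (rule extension_reduction[OF assms(4,2), where S = S and \<nu> = \<nu>, folded A'_def]) (use S in \<open>auto simp: good_def\<close>)
      have gm: "g j \<in> borel_measurable (lebesgue_on (U j))" for j using g by (auto simp: Lp_space_def)
      define h where "h j x = g j x / of_real (lam j)" for j x
      define Lam where "Lam = (\<Prod>j\<in>UNIV. lam j)"
      have Lam: "Lam > 0" unfolding Lam_def using lam by (intro prod_pos) auto
      have hm: "h j \<in> borel_measurable (lebesgue_on (U j))" for j unfolding h_def using gm by (intro borel_measurable_divide) auto
      have unit: "integrable (lebesgue_on (U j)) (\<lambda>x. norm (h j x) powr P)"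
        "(LINT x|lebesgue_on (U j). norm (h j x) powr P) \<le> B" for j
        using Lp_norm_cases(2)[OF g[rule_format] finU assms(8), of "lam j" j P] lam P Pp mU[of j] unfolding h_def by force+
      have h_int: "integrable (lebesgue_on (U j)) (h j)" for j
        using P by (intro integrable_of_integrable_powr[OF finU hm unit(1)]) auto
      define z where "z j \<xi> = (osc_int (T j) (h j) (F j) \<xi>)" for j \<xi>
      have ext_z: "extension_op (U j) (S j) (g j) \<xi> = of_real (lam j) * z j \<xi>" for j \<xi>
      proof -
        have "g j x = of_real (lam j) * h j x" for x using lam by (simp add: h_def less_imp_neq[THEN not_sym])
        then have "extension_op (U j) (S j) (g j) \<xi> = of_real (lam j) * extension_op (U j) (S j) (h j) \<xi>"
          unfolding extension_op_def by (simp add: mult.assoc)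
        then show ?thesis unfolding z_def ext[OF h_int] .
      qed
      have z_meas [measurable]: "z j \<in> borel_measurable borel" for j
      proof -
        have "T j \<in> lmeasurable" using T U_lm by (meson fmeasurableI2)
        moreover have "h j \<in> borel_measurable (lebesgue_on (T j))"
          using measurable_restrict_mono[OF hm] T by auto
        moreover have "F j \<in> borel_measurable (lebesgue_on (T j))"
          using T by (intro continuous_imp_measurable_on_sets_lebesgue[OF C11_bounded_continuous[OF F]]) auto
        ultimately show ?thesis unfolding z_def[abs_def]
          by (intro measurable_oscillatory_integral finite_measure.axioms(1)[OF finite_measure_lebesgue_on]) auto
      qed
      have norm_\<Phi>: "norm (\<Phi> S g \<xi>) powr Q = Lam powr Q * (\<Prod>j\<in>UNIV. norm (z j \<xi>) powr Q)" for \<xi>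
      proof -
        have "norm (\<Phi> S g \<xi>) = Lam * (\<Prod>j\<in>UNIV. norm (z j \<xi>))"
          using lam by (simp add: \<Phi>_def ext_z prod_norm[symmetric] norm_mult prod.distrib Lam_def abs_of_pos)
        then show ?thesis using Lam by (simp add: powr_mult prod_nonneg prod_powr_distrib)
      qed
      have "(\<integral>\<^sup>+\<xi>. ennreal (norm (\<Phi> S g \<xi>) powr Q) \<partial>lebesgue_on (ball 0 R))
         = (\<integral>\<^sup>+\<xi>. ennreal (Lam powr Q) * (ennreal (\<Prod>j\<in>UNIV. norm (z j \<xi>) powr Q) * indicator (ball 0 R) \<xi>) \<partial>lborel)"
        unfolding nn_integral_lebesgue_on_ball norm_\<Phi> by (intro nn_integral_cong) (simp add: ennreal_mult prod_nonneg mult.assoc)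
      also have "\<dots> = ennreal (Lam powr Q) * ball_integral R (\<lambda>\<xi>. \<Prod>j\<in>UNIV. norm (z j \<xi>) powr Q)"
      proof -
        have [measurable]: "ball 0 R \<in> sets (borel :: (real ^ 'm option) measure)" by simp
        show ?thesis by (rule nn_integral_cmult) measurable
      qed
      also have "\<dots> \<le> ennreal (Lam powr Q) * ennreal (C0 * R powr (\<epsilon> * Q))"
        unfolding z_def
      proof (intro mult_left_mono est allI conjI impI)
        show "C11_bounded A' (F j)" for j by (rule F)
        show "T j \<in> sets lebesgue" "T j \<subseteq> U0" for j using T by (auto simp: U0_def)
        show "wedge_det F x \<ge> \<nu>" if "\<forall>j. x j \<in> T j" for x using that by (intro wd) auto
        show "h j \<in> borel_measurable (lebesgue_on (T j))" for j using measurable_restrict_mono[OF hm] T by auto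
        show "integrable (lebesgue_on (T j)) (\<lambda>x. norm (h j x) powr P)"
          "(LINT x|lebesgue_on (T j). norm (h j x) powr P) \<le> B" for j
          using restr[OF unit(1)[of j]] unit(2)[of j] by auto
        show "R \<ge> 1" by (rule R)
      qed simp
      also have "\<dots> = ennreal (Lam powr Q * (C0 * R powr (\<epsilon> * Q)))" using C0 by (simp add: ennreal_mult)
      finally have "Lp_norm (lebesgue_on (ball 0 R)) (ennreal Q) (\<Phi> S g) \<le> ennreal ((Lam powr Q * (C0 * R powr (\<epsilon> * Q))) powr (1 / Q))"
        using C0 Q0 by (intro Lp_norm_le) auto
      also have "(Lam powr Q * (C0 * R powr (\<epsilon> * Q))) powr (1 / Q) = C0 powr (1 / Q) * R powr \<epsilon> * Lam"
        using C0 Q0 Lam by (simp add: powr_mult powr_powr)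
      also have "ennreal Q = q / of_nat d"
        unfolding qr Q_def ennreal_of_nat_eq_real_of_nat
        by (rule divide_ennreal[symmetric]) (use d(3) qr0 in auto)
      finally show "Lp_norm (lebesgue_on (ball 0 R)) (q / of_nat d) (\<Phi> S g) \<le> ennreal (C0 powr (1 / Q) * R powr \<epsilon> * (\<Prod>j\<in>UNIV. lam j))"
        by (simp add: Lam_def)
    qed
  qed
  then obtain C where C: "C > 0" and main: "\<And>S g R lam. good S \<Longrightarrow> (\<forall>j. g j \<in> Lp_space (lebesgue_on (U j)) p) \<Longrightarrow> R \<ge> 1 \<Longrightarrow>
     (\<forall>j. 0 < lam j \<and> Lp_norm (lebesgue_on (U j)) p (g j) = ennreal (lam j)) \<Longrightarrow>
     Lp_norm (lebesgue_on (ball 0 R)) (q / of_nat d) (\<Phi> S g) \<le> ennreal (C * R powr \<epsilon> * (\<Prod>j\<in>UNIV. lam j))"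
    by blast
  show ?thesis
  proof (intro exI[of _ C] conjI C allI impI)
    fix S :: "'m option \<Rightarrow> real ^ 'm \<Rightarrow> real ^ 'm option" and g :: "'m option \<Rightarrow> real ^ 'm \<Rightarrow> complex" and R :: real
    assume S: "\<forall>j. smooth_parametrisation (U j) (S j)" "\<forall>x. (\<forall>j. x j \<in> U j) \<longrightarrow> \<nu> \<le> wedge_det S x"
      "\<forall>j. C2_norm (U j) (S j) \<le> ennreal A" and g: "\<forall>j. g j \<in> Lp_space (lebesgue_on (U j)) p" and R: "1 \<le> R"
    have "Lp_norm (lebesgue_on (ball 0 R)) (q / of_nat d) (\<Phi> S g)
        \<le> ennreal (C * R powr \<epsilon>) * (\<Prod>j\<in>UNIV. Lp_norm (lebesgue_on (U j)) p (g j))"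
    proof (cases "\<exists>j. Lp_norm (lebesgue_on (U j)) p (g j) = 0")
      case True
      then show ?thesis using zero_case g by force
    next
      case False
      define lam where "lam j = enn2real (Lp_norm (lebesgue_on (U j)) p (g j))" for j
      have lam: "0 < lam j \<and> Lp_norm (lebesgue_on (U j)) p (g j) = ennreal (lam j)" for j
      proof -
        have "Lp_norm (lebesgue_on (U j)) p (g j) < top" using g by (simp add: Lp_space_def)
        then show ?thesis using False by (simp add: lam_def enn2real_positive_iff zero_less_iff_neq_zero)
      qed
      have "Lp_norm (lebesgue_on (ball 0 R)) (q / of_nat d) (\<Phi> S g) \<le> ennreal (C * R powr \<epsilon> * (\<Prod>j\<in>UNIV. lam j))"
        by (rule main) (use S g R lam in \<open>auto simp: good_def\<close>)
      also have "\<dots> = ennreal (C * R powr \<epsilon>) * (\<Prod>j\<in>UNIV. ennreal (lam j))"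
        using C lam by (simp add: ennreal_mult prod_nonneg less_imp_le prod_ennreal)
      also have "(\<Prod>j\<in>UNIV. ennreal (lam j)) = (\<Prod>j\<in>UNIV. Lp_norm (lebesgue_on (U j)) p (g j))"
        using lam by simp
      finally show ?thesis .
    qed
    then show "Lp_norm (lebesgue_on (ball 0 R)) (q / of_nat d) (\<lambda>\<xi>. \<Prod>j\<in>UNIV. extension_op (U j) (S j) (g j) \<xi>)
        \<le> ennreal (C * R powr \<epsilon>) * (\<Prod>j\<in>UNIV. Lp_norm (lebesgue_on (U j)) p (g j))"
      by (simp only: \<Phi>_def[abs_def])
  qed
qed

end
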